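(* Let $(X,d)$ be a complete and connected metric space with $\mathcal H^1(X)<\infty$, equipped with the measure $\mathcal H^1$. Let $u$ be a function on $X$. Then the following hold: (1) If $\|Du\|(X)<\infty$, then $\mathrm{Var}(u,X)\le \|Du\|(X)$. (2) Suppose there exists a constant $C_0$ such that for all $x\in X$ $$\liminf_{r\to 0}\frac{\mathcal H^1(B(x,r))}{r}<C_0 .$$ If $\mathrm{Var}(u,X)<\infty$, then $\|Du\|(X)<\infty$.
   Context: $\mathcal H^1$ is the one-dimensional Hausdorff measure (normalized so that it agrees with length on $\mathbb R$); "a.e." and $L^1$ are with respect to $\mathcal H^1$. $B(x,r)$ is the open ball. Functions on $X$ are real-valued. Curves: a curve is a continuous map from a compact interval to $X$ of finite length; all curves are taken arc-length parametrized, $\gamma\colon[0,\ell_\gamma]\to X$. A curve is simple if it is injective. Curves are pairwise disjoint if their images are pairwise disjoint. Pointwise variation: for a function $v$ on $X$, $$\mathrm{pV}(v,X):=\sup\Big\{\sum_j |v\circ\gamma_j(\ell_j)-v\circ\gamma_j(0)|\Big\},$$ the supremum being over all finite collections of pairwise disjoint injective arc-length parametrized curves $\gamma_j\colon[0,\ell_j]\to X$. Further, $\mathrm{Var}(u,X):=\inf\{\mathrm{pV}(v,X):\ v=u \text{ a.e. on } X\}$. Upper gradient: a Borel function $g\colon X\to[0,\infty]$ is an upper gradient of $u\colon X\to\overline{\mathbb R}$ if $|u(\gamma(\ell_\gamma))-u(\gamma(0))|\le\int_\gamma g\,ds:=\int_0^{\ell_\gamma} g(\gamma(s))\,ds$ for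 every curve $\gamma$ (with the conventions $\infty-\infty=\infty$, $(-\infty)-(-\infty)=-\infty$). Total variation: $$\|Du\|(X):=\inf\Big\{\liminf_{i\to\infty}\int_X g_{u_i}\,d\mathcal H^1:\ u_i\to u \text{ in } L^1_{\mathrm{loc}}(X)\Big\},$$ where each $g_{u_i}$ is an upper gradient of $u_i$ in $X$. *)

theory Defs
  imports "HOL-Analysis.Analysis"
begin

section \<open>One-dimensional Hausdorff measure\<close>

text \<open>
  Covers are by arbitrary sets, weighted by their diameters with constant 1, so that the measure
  agrees with length on the real line. The boundedness requirement is needed because the real-valued
  \<^const>\<open>diameter\<close> is meaningless on unbounded sets. Finite covers are included, as the empty set has
  diameter 0.
\<close>

definition hausdorff1_pre :: "real \<Rightarrow> 'a::metric_space set \<Rightarrow> ennreal" where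
  "hausdorff1_pre \<delta> A =
     (INF E \<in> {E :: nat \<Rightarrow> 'a set. A \<subseteq> (\<Union>i. E i) \<and> (\<forall>i. bounded (E i) \<and> diameter (E i) \<le> \<delta>)}.
        \<Sum>i. ennreal (diameter (E i)))"

definition hausdorff1_outer :: "'a::metric_space set \<Rightarrow> ennreal" where
  "hausdorff1_outer A = (SUP \<delta>\<in>{0<..}. hausdorff1_pre \<delta> A)"

text \<open>
  The measure lives on all sets that are measurable in the sense of Caratheodory; in particular every
  set of outer measure zero is measurable.
\<close>

definition hausdorff1 :: "'a::metric_space measure" where
  "hausdorff1 = measure_of UNIV (lambda_system UNIV UNIV hausdorff1_outer) hausdorff1_outer"

lemma hausdorff1_pre_mono: "A \<subseteq> B \<Longrightarrow> hausdorff1_pre \<delta> A \<le> hausdorff1_pre \<delta> B"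
  unfolding hausdorff1_pre_def by (rule INF_superset_mono) auto

lemma hausdorff1_pre_empty:
  assumes "0 < \<delta>"
  shows "hausdorff1_pre \<delta> ({} :: 'a::metric_space set) = 0"
proof -
  have "hausdorff1_pre \<delta> ({} :: 'a set) \<le> (\<Sum>i::nat. ennreal (diameter ({} :: 'a set)))"
    unfolding hausdorff1_pre_def
    by (rule INF_lower[where i = "\<lambda>_. {}"]) (use assms in auto)
  then show ?thesis by simp
qed

lemma hausdorff1_pre_UN:
  fixes A :: "nat \<Rightarrow> 'a::metric_space set"
  shows "hausdorff1_pre \<delta> (\<Union>n. A n) \<le> (\<Sum>n. hausdorff1_pre \<delta> (A n))"
proof (cases "\<exists>n. hausdorff1_pre \<delta> (A n) = top")
  case True
  then obtain n where "hausdorff1_pre \<delta> (A n) = top" by blast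
  moreover have "hausdorff1_pre \<delta> (A n) \<le> (\<Sum>n. hausdorff1_pre \<delta> (A n))"
    using sum_le_suminf[OF summableI, of "{n}" "\<lambda>n. hausdorff1_pre \<delta> (A n)"] by simp
  ultimately show ?thesis by (simp add: top_unique)
next
  case False
  show ?thesis
  proof (rule ennreal_le_epsilon)
    fix e :: real assume e: "0 < e"
    have "\<exists>E. A n \<subseteq> (\<Union>i. E i) \<and> (\<forall>i. bounded (E i) \<and> diameter (E i) \<le> \<delta>) \<and>
           (\<Sum>i::nat. ennreal (diameter (E i))) < hausdorff1_pre \<delta> (A n) + ennreal (e * (1/2) ^ Suc n)" for n
    proof -
      have "hausdorff1_pre \<delta> (A n) < hausdorff1_pre \<delta> (A n) + ennreal (e * (1/2) ^ Suc n)"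
        using False e
          ennreal_add_left_cancel_less[of "hausdorff1_pre \<delta> (A n)" 0 "ennreal (e * (1/2) ^ Suc n)"]
        by simp
      then show ?thesis
        unfolding hausdorff1_pre_def[of \<delta> "A n"] INF_less_iff by auto
    qed
    then obtain E where cov: "\<And>n. A n \<subseteq> (\<Union>i. E n i)"
      and small: "\<And>n i. bounded (E n i) \<and> diameter (E n i) \<le> \<delta>"
      and E: "\<And>n. (\<Sum>i::nat. ennreal (diameter (E n i))) < hausdorff1_pre \<delta> (A n) + ennreal (e * (1/2) ^ Suc n)"
      by metis
    define F where "F = (\<lambda>k. case prod_decode k of (n, i) \<Rightarrow> E n i)"
    have "(\<Union>n. A n) \<subseteq> (\<Union>k. F k)"
    proof
      fix x assume "x \<in> (\<Union>n. A n)"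
      then obtain n i where "x \<in> E n i" using cov by blast
      then have "x \<in> F (prod_encode (n, i))" by (simp add: F_def)
      then show "x \<in> (\<Union>k. F k)" by blast
    qed
    moreover have "\<forall>k. bounded (F k) \<and> diameter (F k) \<le> \<delta>"
      using small by (simp add: F_def split: prod.split)
    ultimately have "hausdorff1_pre \<delta> (\<Union>n. A n) \<le> (\<Sum>k. ennreal (diameter (F k)))"
      unfolding hausdorff1_pre_def by (intro INF_lower) auto
    also have "\<dots> = (\<Sum>n. \<Sum>i. ennreal (diameter (E n i)))"
      by (subst suminf_ennreal_2dimen[where f = "\<lambda>(n, i). ennreal (diameter (E n i))" and g = "\<lambda>n. \<Sum>i. ennreal (diameter (E n i))", symmetric])
        (auto simp: F_def comp_def intro!: suminf_cong split: prod.split)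
    also have "\<dots> \<le> (\<Sum>n. hausdorff1_pre \<delta> (A n) + ennreal (e * (1/2) ^ Suc n))"
      using E by (intro suminf_le) (auto intro: less_imp_le)
    also have "\<dots> = (\<Sum>n. hausdorff1_pre \<delta> (A n)) + (\<Sum>n. ennreal (e * (1/2) ^ Suc n))"
      by (rule suminf_add[symmetric]) auto
    also have "(\<Sum>n. ennreal (e * (1/2) ^ Suc n)) = ennreal e"
    proof (rule suminf_ennreal_eq)
      show "(\<lambda>n. e * (1/2) ^ Suc n) sums e"
        using sums_mult[OF power_half_series, of e] by simp
    qed (use e in auto)
    finally show "hausdorff1_pre \<delta> (\<Union>n. A n) \<le> (\<Sum>n. hausdorff1_pre \<delta> (A n)) + ennreal e" .
  qed
qed

lemma outer_measure_space_hausdorff1_outer: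
  "outer_measure_space UNIV (hausdorff1_outer :: 'a::metric_space set \<Rightarrow> ennreal)"
  unfolding outer_measure_space_def
proof (intro conjI)
  show "positive UNIV (hausdorff1_outer :: 'a set \<Rightarrow> ennreal)"
    by (auto simp: positive_def hausdorff1_outer_def hausdorff1_pre_empty)
  show "increasing UNIV (hausdorff1_outer :: 'a set \<Rightarrow> ennreal)"
    unfolding increasing_def hausdorff1_outer_def
    by (auto intro!: SUP_mono hausdorff1_pre_mono)
  show "countably_subadditive UNIV (hausdorff1_outer :: 'a set \<Rightarrow> ennreal)"
    unfolding countably_subadditive_def
  proof (intro allI impI)
    fix A :: "nat \<Rightarrow> 'a set"
    show "hausdorff1_outer (\<Union>i. A i) \<le> (\<Sum>i. hausdorff1_outer (A i))"
      unfolding hausdorff1_outer_def[of "\<Union>i. A i"]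
    proof (rule SUP_least)
      fix \<delta> :: real assume \<delta>: "\<delta> \<in> {0<..}"
      have "hausdorff1_pre \<delta> (\<Union>i. A i) \<le> (\<Sum>i. hausdorff1_pre \<delta> (A i))"
        by (rule hausdorff1_pre_UN)
      also have "\<dots> \<le> (\<Sum>i. hausdorff1_outer (A i))"
        unfolding hausdorff1_outer_def
        by (intro suminf_le SUP_upper \<delta>) auto
      finally show "hausdorff1_pre \<delta> (\<Union>i. A i) \<le> (\<Sum>i. hausdorff1_outer (A i))" .
    qed
  qed
qed

lemma measure_space_hausdorff1:
  "measure_space UNIV (lambda_system UNIV UNIV (hausdorff1_outer :: 'a::metric_space set \<Rightarrow> ennreal))
     hausdorff1_outer"
  using sigma_algebra.caratheodory_lemma[OF sigma_algebra_Pow, of UNIV hausdorff1_outer]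
    outer_measure_space_hausdorff1_outer by simp

lemma space_hausdorff1 [simp]: "space hausdorff1 = UNIV"
  by (simp add: hausdorff1_def)

lemma sets_hausdorff1:
  "sets hausdorff1 = lambda_system UNIV UNIV (hausdorff1_outer :: 'a::metric_space set \<Rightarrow> ennreal)"
  using measure_space_hausdorff1[where ?'a = 'a]
  by (simp add: hausdorff1_def measure_space_def sigma_algebra.sigma_sets_eq)

lemma emeasure_hausdorff1:
  "A \<in> sets hausdorff1 \<Longrightarrow> emeasure hausdorff1 A = hausdorff1_outer (A :: 'a::metric_space set)"
  using measure_space_hausdorff1[where ?'a = 'a]
  unfolding sets_hausdorff1 unfolding hausdorff1_def measure_space_def
  by (subst emeasure_measure_of_sigma) auto

lemma AE_hausdorff1_iff:
  "(AE x in hausdorff1. P x) \<longleftrightarrow> hausdorff1_outer {x::'a::metric_space. \<not> P x} = 0"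
proof
  have mono: "A \<subseteq> B \<Longrightarrow> hausdorff1_outer A \<le> hausdorff1_outer B" for A B :: "'a set"
    using outer_measure_space_hausdorff1_outer[where ?'a = 'a]
    by (auto simp: outer_measure_space_def increasing_def)
  {
    assume "AE x in hausdorff1. P x"
    then obtain N where "{x. \<not> P x} \<subseteq> N" "N \<in> sets hausdorff1" "emeasure hausdorff1 N = 0"
      by (auto elim!: AE_E)
    then show "hausdorff1_outer {x. \<not> P x} = 0"
      using mono by (metis emeasure_hausdorff1 le_zero_eq)
  next
    assume 0: "hausdorff1_outer {x. \<not> P x} = 0"
    let ?N = "{x. \<not> P x}"
    have sub: "hausdorff1_outer x \<le> hausdorff1_outer (?N \<inter> x) + hausdorff1_outer ((UNIV - ?N) \<inter> x)" for x
    proof -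
      interpret ring_of_sets UNIV "UNIV :: 'a set set"
        using sigma_algebra_Pow[of "UNIV :: 'a set"]
        by (simp add: sigma_algebra_def algebra_def)
      have "subadditive UNIV (hausdorff1_outer :: 'a set \<Rightarrow> ennreal)"
        using outer_measure_space_hausdorff1_outer[where ?'a = 'a]
        by (intro countably_subadditive_subadditive) (simp_all add: outer_measure_space_def)
      then have "hausdorff1_outer ((?N \<inter> x) \<union> ((UNIV - ?N) \<inter> x)) \<le>
          hausdorff1_outer (?N \<inter> x) + hausdorff1_outer ((UNIV - ?N) \<inter> x)"
        by (rule subadditiveD) auto
      moreover have "(?N \<inter> x) \<union> ((UNIV - ?N) \<inter> x) = x" by blast
      ultimately show ?thesis by (simp only:)
    qed
    have z: "hausdorff1_outer (?N \<inter> x) = 0" for x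
      using mono[of "?N \<inter> x" ?N] 0 by auto
    have "?N \<in> sets hausdorff1"
      unfolding sets_hausdorff1 lambda_system_def
    proof (intro CollectI conjI ballI UNIV_I)
      fix x :: "'a set"
      have "hausdorff1_outer ((UNIV - ?N) \<inter> x) \<le> hausdorff1_outer x"
        by (rule mono) blast
      with sub[of x] z[of x] show
        "hausdorff1_outer (?N \<inter> x) + hausdorff1_outer ((UNIV - ?N) \<inter> x) = hausdorff1_outer x"
        by (simp only: add_0)
    qed
    then show "AE x in hausdorff1. P x"
      using 0 by (intro AE_I[of _ _ ?N]) (auto simp: emeasure_hausdorff1)
  }
qed

section \<open>Curves\<close>

definition curve_length :: "(real \<Rightarrow> 'a::metric_space) \<Rightarrow> real \<Rightarrow> real \<Rightarrow> ennreal" where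
  "curve_length \<gamma> a b =
     (SUP (n, t) \<in> {(n::nat, t::nat \<Rightarrow> real). (\<forall>i\<le>n. t i \<in> {a..b}) \<and> mono_on {..n} t}.
        \<Sum>i<n. ennreal (dist (\<gamma> (t i)) (\<gamma> (t (Suc i)))))"

text \<open>
  Only the values on \<open>{0..l}\<close> are relevant. Finite length is part of the arc-length condition
  (take \<open>s = 0\<close> and \<open>t = l\<close>).
\<close>

definition arclength_curve :: "real \<Rightarrow> (real \<Rightarrow> 'a::metric_space) \<Rightarrow> bool" where
  "arclength_curve l \<gamma> \<longleftrightarrow>
     0 \<le> l \<and> continuous_on {0..l} \<gamma> \<and>
     (\<forall>s t. 0 \<le> s \<and> s \<le> t \<and> t \<le> l \<longrightarrow> curve_length \<gamma> s t = ennreal (t - s))"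

section \<open>Variation\<close>

definition pV :: "('a::metric_space \<Rightarrow> real) \<Rightarrow> ennreal" where
  "pV v =
     (SUP (n, l, \<gamma>) \<in> {(n::nat, l :: nat \<Rightarrow> real, \<gamma> :: nat \<Rightarrow> real \<Rightarrow> 'a).
          (\<forall>j<n. arclength_curve (l j) (\<gamma> j) \<and> inj_on (\<gamma> j) {0..l j}) \<and>
          disjoint_family_on (\<lambda>j. \<gamma> j ` {0..l j}) {..<n}}.
        \<Sum>j<n. ennreal \<bar>v (\<gamma> j (l j)) - v (\<gamma> j 0)\<bar>)"

definition Var :: "('a::metric_space \<Rightarrow> real) \<Rightarrow> ennreal" where
  "Var u = (INF v \<in> {v. AE x in hausdorff1. v x = u x}. pV v)"

text \<open>
  If an end point has an infinite value, the left-hand side below is \<open>\<infinity>\<close>: in \<^typ>\<open>ereal\<close> both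
  \<open>\<infinity> - \<infinity>\<close> and \<open>(-\<infinity>) - (-\<infinity>)\<close> have absolute value \<open>\<infinity>\<close>.
\<close>

definition upper_gradient :: "('a::metric_space \<Rightarrow> ennreal) \<Rightarrow> ('a \<Rightarrow> ereal) \<Rightarrow> bool" where
  "upper_gradient g u \<longleftrightarrow>
     g \<in> borel_measurable borel \<and>
     (\<forall>l \<gamma>. arclength_curve l \<gamma> \<longrightarrow>
        \<bar>u (\<gamma> l) - u (\<gamma> 0)\<bar> \<le> enn2ereal (\<integral>\<^sup>+ s\<in>{0..l}. g (\<gamma> s) \<partial>lborel))"

text \<open>
  Convergence in \<open>L\<^sup>1\<close> on a neighbourhood of every point, for the measure \<^const>\<open>hausdorff1\<close>.
\<close>

definition L1loc_tendsto :: "(nat \<Rightarrow> 'a::metric_space \<Rightarrow> real) \<Rightarrow> ('a \<Rightarrow> real) \<Rightarrow> bool" where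
  "L1loc_tendsto us u \<longleftrightarrow>
     (\<forall>x. \<exists>r>0.
        set_integrable hausdorff1 (ball x r) u \<and>
        (\<forall>i. set_integrable hausdorff1 (ball x r) (us i)) \<and>
        (\<lambda>i. LINT y:ball x r|hausdorff1. \<bar>us i y - u y\<bar>) \<longlonglongrightarrow> 0)"

definition total_variation :: "('a::metric_space \<Rightarrow> real) \<Rightarrow> ennreal" where
  "total_variation u =
     (INF (us, gs) \<in> {(us, gs). L1loc_tendsto us u \<and>
                                (\<forall>i::nat. upper_gradient (gs i) (\<lambda>x. ereal (us i x)))}.
        liminf (\<lambda>i. \<integral>\<^sup>+ x. gs i x \<partial>hausdorff1))"

end

theory Submission
  imports Defs
begin

text \<open>
  (1) By the area formula on injective curves, an upper gradient \<open>g\<close> of \<open>w\<close> gives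
  \<open>pV w \<le> \<integral> g\<close>. Along suitable indices the approximating functions converge almost everywhere, and a
  pointwise cluster point (Tychonoff) of them is a representative of \<open>u\<close> whose pointwise variation
  is at most the lower limit of the integrals.

  (2) The space is compact and locally connected by injective curves. If \<open>pV v < \<infinity>\<close>, cut the space
  along finite sets into small path-connected cells: the oscillations of \<open>v\<close> over the cells sum up to
  at most \<open>pV v\<close>, so by Banach's indicatrix argument the number of points in \<open>frontier {v > t}\<close> has
  integral at most \<open>pV v\<close> in \<open>t\<close>. Every curve that leaves \<open>{v > t}\<close> meets this frontier. Hence the
  indicator of \<open>{v > t}\<close>, cut off to \<open>0\<close> near each frontier point \<open>x\<close> on a ball of radius \<open>r\<close> with
  measure at most \<open>C\<^sub>0 r\<close>, has an upper gradient of integral at most \<open>C\<^sub>0\<close> times the number of frontier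
  points. Averaging such functions over a fine grid of levels \<open>t\<close> approximates \<open>v\<close> in \<open>L\<^sup>1\<close> with upper
  gradients of bounded integral.
\<close>

section \<open>The one-dimensional Hausdorff measure\<close>

text \<open>\<open>pV\<close> reads values at single points, whereas convergence in L^1 leaves null
  sets undetermined. In (1) the representative needs a value at every exceptional point that
  respects all finite families of curves at once; hence the limit in a product topology.

  In (2) the density hypothesis gives good radii only along a sequence that depends on the point, so
  no single scale serves the whole space. The gradients use finitely many balls, each with its own
  radius \<open>r\<close>: height \<open>1 / r\<close> on measure at most \<open>C * r\<close> costs
  \<open>C\<close> per ball, whatever the radius. This asks for finite frontiers, but a single level
  can have an infinite one; only the integral of the count over all levels is controlled, hence the
  averaging. The radii stay below the mesh \<open>h\<close> of the grid, so that the L^1 error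
  caused by the cutoffs is at most \<open>h\<close> times the integral of the gradient.

  Counting frontier points by cells fails at the cut points, which lie in no cell. Cuts are made
  along metric spheres because almost every radius gives a finite sphere that avoids the countably
  many discontinuities of \<open>v\<close>; outside a countable set of levels, frontiers then miss
  the cuts.\<close>

lemma hausdorff1_pre_antimono: "\<delta> \<le> \<delta>' \<Longrightarrow> hausdorff1_pre \<delta>' A \<le> hausdorff1_pre \<delta> A"
  unfolding hausdorff1_pre_def by (rule INF_superset_mono) (auto intro: order_trans)

lemma hausdorff1_outer_mono: "A \<subseteq> B \<Longrightarrow> hausdorff1_outer A \<le> hausdorff1_outer B"
  using outer_measure_space_hausdorff1_outer
  by (auto simp: outer_measure_space_def increasing_def)

lemma hausdorff1_outer_empty [simp]: "hausdorff1_outer {} = 0"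
  using outer_measure_space_hausdorff1_outer
  by (auto simp: outer_measure_space_def positive_def)

text \<open>\<open>countably_subadditive\<close> speaks of disjoint sequences, so the sets are first
  made disjoint.\<close>

lemma hausdorff1_outer_UN:
  fixes A :: "nat \<Rightarrow> 'a::metric_space set"
  shows "hausdorff1_outer (\<Union>n. A n) \<le> (\<Sum>n. hausdorff1_outer (A n))"
proof -
  have "countably_subadditive UNIV (hausdorff1_outer :: 'a set \<Rightarrow> ennreal)"
    using outer_measure_space_hausdorff1_outer[where ?'a = 'a] by (simp add: outer_measure_space_def)
  then have "hausdorff1_outer (\<Union>n. disjointed A n) \<le> (\<Sum>n. hausdorff1_outer (disjointed A n))"
    using disjoint_family_disjointed[of A] by (auto simp: countably_subadditive_def)
  also have "\<dots> \<le> (\<Sum>n. hausdorff1_outer (A n))"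
    by (intro suminf_le hausdorff1_outer_mono disjointed_subset) auto
  finally show ?thesis by (simp add: UN_disjointed_eq)
qed

lemma hausdorff1_outer_Un:
  "hausdorff1_outer (A \<union> B) \<le> hausdorff1_outer A + hausdorff1_outer (B :: 'a::metric_space set)"
proof -
  interpret ring_of_sets UNIV "UNIV :: 'a set set"
    using sigma_algebra_Pow[of "UNIV :: 'a set"] by (simp add: sigma_algebra_def algebra_def)
  have "subadditive UNIV (hausdorff1_outer :: 'a set \<Rightarrow> ennreal)"
    using outer_measure_space_hausdorff1_outer[where ?'a = 'a]
    by (intro countably_subadditive_subadditive) (simp_all add: outer_measure_space_def)
  then show ?thesis
    unfolding subadditive_def by (metis UNIV_I hausdorff1_outer_mono subadditive_def
      Un_Diff_cancel Int_Diff Diff_disjoint add_left_mono order_trans Diff_subset)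
qed

section \<open>Additivity on separated sets and measurability of Borel sets\<close>

lemma hausdorff1_pre_separated:
  assumes sep: "\<And>x y. x \<in> A \<Longrightarrow> y \<in> B \<Longrightarrow> \<delta> < dist x y"
  shows "hausdorff1_pre \<delta> A + hausdorff1_pre \<delta> B \<le> hausdorff1_pre \<delta> (A \<union> B)"
  unfolding hausdorff1_pre_def[of \<delta> "A \<union> B"]
proof (rule INF_greatest)
  fix E :: "nat \<Rightarrow> 'a set"
  assume "E \<in> {E. A \<union> B \<subseteq> (\<Union>i. E i) \<and> (\<forall>i. bounded (E i) \<and> diameter (E i) \<le> \<delta>)}"
  then have cov: "A \<union> B \<subseteq> (\<Union>i. E i)" and E: "\<And>i. bounded (E i)" "\<And>i. diameter (E i) \<le> \<delta>"
    by auto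
  \<comment> \<open>A covering set of diameter at most \<open>\<delta>\<close> cannot meet both
    \<open>A\<close> and \<open>B\<close>, so the cover splits in two; discarded entries become
    empty and cost 0.\<close>
  define EA where "EA i = (if E i \<inter> A = {} then {} else E i)" for i
  define EB where "EB i = (if E i \<inter> A = {} then E i else {})" for i
  have "0 \<le> \<delta>" using E[of 0] diameter_ge_0[of "E 0"] by linarith
  have "A \<subseteq> (\<Union>i. EA i)"
    using cov unfolding EA_def by fastforce
  then have "hausdorff1_pre \<delta> A \<le> (\<Sum>i. ennreal (diameter (EA i)))"
    unfolding hausdorff1_pre_def using E \<open>0 \<le> \<delta>\<close> by (intro INF_lower) (auto simp: EA_def)
  moreover have "B \<subseteq> (\<Union>i. EB i)"
  proof
    fix y assume "y \<in> B"
    then obtain i where i: "y \<in> E i" using cov by auto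
    have "E i \<inter> A = {}"
    proof (rule ccontr)
      assume "E i \<inter> A \<noteq> {}"
      then obtain x where "x \<in> E i" "x \<in> A" by auto
      then show False
        using sep[OF \<open>x \<in> A\<close> \<open>y \<in> B\<close>] diameter_bounded_bound[OF E(1), of x i y] i E(2)[of i] by auto
    qed
    then show "y \<in> (\<Union>i. EB i)" using i by (auto simp: EB_def)
  qed
  then have "hausdorff1_pre \<delta> B \<le> (\<Sum>i. ennreal (diameter (EB i)))"
    unfolding hausdorff1_pre_def using E \<open>0 \<le> \<delta>\<close> by (intro INF_lower) (auto simp: EB_def)
  ultimately have "hausdorff1_pre \<delta> A + hausdorff1_pre \<delta> B
      \<le> (\<Sum>i. ennreal (diameter (EA i))) + (\<Sum>i. ennreal (diameter (EB i)))"
    by (rule add_mono)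
  also have "\<dots> = (\<Sum>i. ennreal (diameter (EA i)) + ennreal (diameter (EB i)))"
    by (rule suminf_add) auto
  also have "\<dots> = (\<Sum>i. ennreal (diameter (E i)))"
    by (rule suminf_cong) (auto simp: EA_def EB_def)
  finally show "hausdorff1_pre \<delta> A + hausdorff1_pre \<delta> B \<le> (\<Sum>i. ennreal (diameter (E i)))" .
qed

lemma hausdorff1_outer_separated:
  assumes "0 < d" and sep: "\<And>x y. x \<in> A \<Longrightarrow> y \<in> B \<Longrightarrow> d \<le> dist x y"
  shows "hausdorff1_outer A + hausdorff1_outer B \<le> hausdorff1_outer (A \<union> B)"
proof -
  have "hausdorff1_outer A + hausdorff1_outer B
      = (SUP \<delta>\<in>{0<..}. hausdorff1_pre \<delta> A + hausdorff1_pre \<delta> B)"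
    unfolding hausdorff1_outer_def
  proof (rule SUP_add_directed_ennreal[symmetric])
    fix i j :: real assume "i \<in> {0<..}" "j \<in> {0<..}"
    then show "\<exists>k\<in>{0<..}. hausdorff1_pre i A + hausdorff1_pre j B
        \<le> hausdorff1_pre k A + hausdorff1_pre k B"
      by (intro bexI[of _ "min i j"] add_mono hausdorff1_pre_antimono) auto
  qed
  also have "\<dots> \<le> hausdorff1_outer (A \<union> B)"
  proof (rule SUP_least)
    fix \<delta> :: real assume "\<delta> \<in> {0<..}"
    \<comment> \<open>\<open>hausdorff1_pre\<close> grows as its scale shrinks, so the scale may be
      taken below \<open>d\<close>, where the strict separation holds.\<close>
    define \<eta> where "\<eta> = min \<delta> (d/2)"
    have "hausdorff1_pre \<delta> A + hausdorff1_pre \<delta> B \<le> hausdorff1_pre \<eta> A + hausdorff1_pre \<eta> B"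
      by (intro add_mono hausdorff1_pre_antimono) (auto simp: \<eta>_def)
    also have "\<dots> \<le> hausdorff1_pre \<eta> (A \<union> B)"
    proof (rule hausdorff1_pre_separated)
      fix x y assume "x \<in> A" "y \<in> B"
      then show "\<eta> < dist x y" using sep[of x y] \<open>0 < d\<close> by (auto simp: \<eta>_def)
    qed
    also have "\<dots> \<le> hausdorff1_outer (A \<union> B)"
      unfolding hausdorff1_outer_def using \<open>0 < d\<close> \<open>\<delta> \<in> {0<..}\<close>
      by (intro SUP_upper) (auto simp: \<eta>_def)
    finally show "hausdorff1_pre \<delta> A + hausdorff1_pre \<delta> B \<le> hausdorff1_outer (A \<union> B)" .
  qed
  finally show ?thesis .
qed

lemma suminf_ennreal_tail:
  fixes f :: "nat \<Rightarrow> ennreal"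
  assumes fin: "(\<Sum>k. f k) < \<infinity>" and "0 < e"
  shows "\<exists>n. (\<Sum>k. f (k + n)) \<le> ennreal e"
proof -
  have f: "f k < top" for k
    using fin ennreal_suminf_lessD[of f top k] by auto
  define r where "r k = enn2real (f k)" for k
  have fr: "f = (\<lambda>k. ennreal (r k))"
    using f by (auto simp: r_def)
  have "summable r"
    using fin unfolding fr by (intro summable_suminf_not_top) (auto simp: r_def)
  then obtain n where n: "norm (\<Sum>k. r (k + n)) < e"
    using suminf_exist_split[OF \<open>0 < e\<close>, of r] by auto
  have "(\<Sum>k. f (k + n)) = ennreal (\<Sum>k. r (k + n))"
    unfolding fr
  proof (rule suminf_ennreal2)
    show "summable (\<lambda>k. r (k + n))" using \<open>summable r\<close> by (simp only: summable_iff_shift)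
  qed (simp add: r_def)
  then show ?thesis using n by (auto intro!: exI[of _ n] ennreal_leI)
qed

lemma in_sets_hausdorff1I:
  fixes F :: "'a::metric_space set"
  assumes "\<And>A. hausdorff1_outer (F \<inter> A) + hausdorff1_outer (A - F) \<le> hausdorff1_outer A"
  shows "F \<in> sets hausdorff1"
  unfolding sets_hausdorff1 lambda_system_def
proof (intro CollectI conjI ballI UNIV_I)
  fix A :: "'a set"
  have "A = (F \<inter> A) \<union> (A - F)" by auto
  then have "hausdorff1_outer A \<le> hausdorff1_outer (F \<inter> A) + hausdorff1_outer (A - F)"
    using hausdorff1_outer_Un[of "F \<inter> A" "A - F"] by simp
  moreover have "(UNIV - F) \<inter> A = A - F" by auto
  ultimately show "hausdorff1_outer (F \<inter> A) + hausdorff1_outer ((UNIV - F) \<inter> A) = hausdorff1_outer A"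
    using assms[of A] by (simp add: order_antisym)
qed

lemma null_in_sets_hausdorff1:
  assumes "hausdorff1_outer N = 0"
  shows "N \<in> sets hausdorff1"
proof (rule in_sets_hausdorff1I)
  fix A
  have "hausdorff1_outer (N \<inter> A) = 0"
    using hausdorff1_outer_mono[of "N \<inter> A" N] assms by auto
  then show "hausdorff1_outer (N \<inter> A) + hausdorff1_outer (A - N) \<le> hausdorff1_outer A"
    by (simp add: hausdorff1_outer_mono)
qed

text \<open>Caratheodory's criterion: the rings \<open>R k\<close> of even and of odd index are separated, so their
  measures are summable, and the part of \<open>A\<close> near \<open>F\<close> is negligible.\<close>

lemma closed_in_sets_hausdorff1:
  fixes F :: "'a::metric_space set"
  assumes "closed F"
  shows "F \<in> sets hausdorff1"
proof (cases "F = {}")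
  case False
  have *: "hausdorff1_outer (F \<inter> A) + hausdorff1_outer (A - F) \<le> hausdorff1_outer A" for A
  proof (cases "hausdorff1_outer A < \<infinity>")
    case fin: True
    define R where "R k = {x\<in>A. 1 / real (k+2) \<le> infdist x F \<and> infdist x F < 1 / real (k+1)}" for k
    define G where "G n = {x\<in>A. 1 / real (n+1) \<le> infdist x F}" for n
    have dist_infdist: "infdist x F - infdist y F \<le> dist x y" for x y
      using infdist_triangle[of x F y] by (auto simp: dist_commute)
    have sum_p: "(\<Sum>k<N. hausdorff1_outer (R (2*k+p))) \<le> hausdorff1_outer (\<Union>k<N. R (2*k+p))" for N p
    proof (induction N)
      case (Suc N)
      have "(\<Sum>k<Suc N. hausdorff1_outer (R (2*k+p)))
          \<le> hausdorff1_outer (\<Union>k<N. R (2*k+p)) + hausdorff1_outer (R (2*N+p))"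
        using Suc by (simp add: add_right_mono)
      also have "\<dots> \<le> hausdorff1_outer ((\<Union>k<N. R (2*k+p)) \<union> R (2*N+p))"
      proof (rule hausdorff1_outer_separated)
        fix x y assume "x \<in> (\<Union>k<N. R (2*k+p))" "y \<in> R (2*N+p)"
        then obtain k where "k < N" and x: "1 / real (2*k+p+2) \<le> infdist x F"
          and y: "infdist y F < 1 / real (2*N+p+1)"
          by (auto simp: R_def)
        \<comment> \<open>The half keeps the denominator positive for \<open>N = p = 0\<close>: the
          family of earlier rings is then empty, but a positive gap still has to be
          exhibited.\<close>
        have "1 / (real (2*N+p) + 1/2) \<le> 1 / real (2*k+p+2)"
          using \<open>k < N\<close> by (intro divide_left_mono) auto
        then show "1 / (real (2*N+p) + 1/2) - 1 / real (2*N+p+1) \<le> dist x y"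
          using x y dist_infdist[of x y] by linarith
      next
        show "0 < 1 / (real (2*N+p) + 1/2) - 1 / real (2*N+p+1)"
          using frac_less2[of 1 1 "real (2*N+p) + 1/2" "real (2*N+p+1)"] by simp
      qed
      also have "(\<Union>k<N. R (2*k+p)) \<union> R (2*N+p) = (\<Union>k<Suc N. R (2*k+p))"
        by (auto simp: lessThan_Suc)
      finally show ?case .
    qed simp
    have RA: "hausdorff1_outer (\<Union>k<N. R (2*k+p)) \<le> hausdorff1_outer A" for N p
      by (rule hausdorff1_outer_mono) (auto simp: R_def)
    have "(\<Sum>k<n. hausdorff1_outer (R k)) \<le> hausdorff1_outer A + hausdorff1_outer A" for n
    proof -
      have "(\<Sum>k<n. hausdorff1_outer (R k)) \<le> (\<Sum>k<2*n. hausdorff1_outer (R k))"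
        by (rule sum_mono2) auto
      also have "\<dots> = (\<Sum>k<n. hausdorff1_outer (R (2*k+0))) + (\<Sum>k<n. hausdorff1_outer (R (2*k+1)))"
        by (induction n) (auto simp: algebra_simps)
      also have "\<dots> \<le> hausdorff1_outer A + hausdorff1_outer A"
        using sum_p RA by (intro add_mono) (blast intro: order_trans)+
      finally show ?thesis .
    qed
    then have "(\<Sum>k. hausdorff1_outer (R k)) \<le> hausdorff1_outer A + hausdorff1_outer A"
      by (intro suminf_le_const) auto
    then have sumR: "(\<Sum>k. hausdorff1_outer (R k)) < \<infinity>"
      using fin by (auto simp: top_unique less_top[symmetric] dest: order.strict_trans1)
    show ?thesis
    proof (rule ennreal_le_epsilon)
      fix e :: real assume "0 < e"
      then obtain n where n: "(\<Sum>k. hausdorff1_outer (R (k + n))) \<le> ennreal e"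
        using suminf_ennreal_tail[OF sumR] by blast
      have "A - F \<subseteq> G n \<union> (\<Union>k. R (k + n))"
      proof
        fix x assume x: "x \<in> A - F"
        then have pos: "0 < infdist x F"
          using in_closed_iff_infdist_zero[OF assms False, of x] infdist_nonneg[of x F] by auto
        show "x \<in> G n \<union> (\<Union>k. R (k + n))"
        proof (cases "1 / real (n+1) \<le> infdist x F")
          case lt: False
          obtain m where "1 / real (Suc m) < infdist x F"
            using pos nat_approx_posE[of "infdist x F"] by auto
          then have ex: "1 / real (m+2) \<le> infdist x F"
            by (smt (verit) frac_le of_nat_mono le_add1 of_nat_0_less_iff zero_less_Suc add_2_eq_Suc' le_SucI order_refl)
          \<comment> \<open>The least such index is the ring of \<open>x\<close>. For
            \<open>k = 0\<close> the upper bound is 1, which holds because \<open>x\<close> lies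
            outside \<open>G n\<close>.\<close>
          define k where "k = (LEAST m. 1 / real (m+2) \<le> infdist x F)"
          have k: "1 / real (k+2) \<le> infdist x F"
            unfolding k_def by (rule LeastI, rule ex)
          have k': "infdist x F < 1 / real (k+1)"
          proof (cases k)
            case 0
            have "1 / real (n+1) \<le> 1" by simp
            then have "infdist x F < 1" using lt by linarith
            then show ?thesis using 0 by simp
          next
            case (Suc j)
            then have "\<not> 1 / real (j+2) \<le> infdist x F"
              using not_less_Least[of j "\<lambda>m. 1 / real (m+2) \<le> infdist x F"] by (auto simp: k_def)
            then show ?thesis using Suc by auto
          qed
          have "1 / real (k+2) < 1 / real (n+1)" using k lt by linarith
          then have "n \<le> k" by (simp add: field_simps)
          then have "x \<in> R ((k-n) + n)" using k k' x by (auto simp: R_def)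
          then show ?thesis by blast
        qed (use x in \<open>auto simp: G_def\<close>)
      qed
      then have "hausdorff1_outer (A - F) \<le> hausdorff1_outer (G n \<union> (\<Union>k. R (k + n)))"
        by (rule hausdorff1_outer_mono)
      also have "\<dots> \<le> hausdorff1_outer (G n) + hausdorff1_outer (\<Union>k. R (k + n))"
        by (rule hausdorff1_outer_Un)
      also have "\<dots> \<le> hausdorff1_outer (G n) + ennreal e"
        using hausdorff1_outer_UN[of "\<lambda>k. R (k + n)"] n by (intro add_left_mono) (rule order_trans)
      finally have "hausdorff1_outer (F \<inter> A) + hausdorff1_outer (A - F)
          \<le> (hausdorff1_outer (F \<inter> A) + hausdorff1_outer (G n)) + ennreal e"
        by (simp add: add.assoc add_left_mono)
      also have "hausdorff1_outer (F \<inter> A) + hausdorff1_outer (G n)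
          \<le> hausdorff1_outer ((F \<inter> A) \<union> G n)"
      proof (rule hausdorff1_outer_separated)
        fix x y assume "x \<in> F \<inter> A" "y \<in> G n"
        then show "1 / real (n+1) \<le> dist x y"
          using dist_infdist[of y x] infdist_zero[of x F] by (auto simp: G_def dist_commute)
      qed simp
      also have "\<dots> \<le> hausdorff1_outer A"
        by (rule hausdorff1_outer_mono) (auto simp: G_def)
      finally show "hausdorff1_outer (F \<inter> A) + hausdorff1_outer (A - F) \<le> hausdorff1_outer A + ennreal e"
        by (simp add: add_right_mono)
    qed
  qed (auto simp: not_less top_unique)
  show ?thesis by (rule in_sets_hausdorff1I) (rule *)
qed simp

lemma borel_in_sets_hausdorff1:
  "A \<in> sets borel \<Longrightarrow> A \<in> sets (hausdorff1 :: 'a::metric_space measure)"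
proof -
  have "sets borel = sigma_sets (space hausdorff1) (Collect closed :: 'a set set)"
    by (simp add: borel_eq_closed)
  also have "\<dots> \<subseteq> sets hausdorff1"
    by (intro sets.sigma_sets_subset) (auto intro: closed_in_sets_hausdorff1)
  finally show "A \<in> sets borel \<Longrightarrow> A \<in> sets (hausdorff1 :: 'a measure)" by blast
qed

lemma measurable_hausdorff1I: "f \<in> measurable borel N \<Longrightarrow> f \<in> measurable hausdorff1 N"
  by (auto simp: measurable_def intro: borel_in_sets_hausdorff1)

lemma open_in_sets_hausdorff1 [simp]: "open A \<Longrightarrow> A \<in> sets hausdorff1"
  by (simp add: borel_in_sets_hausdorff1)

lemma UNIV_in_sets_hausdorff1 [simp]: "UNIV \<in> sets (hausdorff1 :: 'a::metric_space measure)"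
  by (rule open_in_sets_hausdorff1) simp

section \<open>Lebesgue measure as a lower bound, separability and compactness of the space\<close>

lemma bdd_Sup_minus_Inf_le:
  fixes T :: "real set"
  assumes "T \<noteq> {}" and d: "\<And>a b. a \<in> T \<Longrightarrow> b \<in> T \<Longrightarrow> a - b \<le> d"
  shows "bdd_above T" "bdd_below T" "Sup T - Inf T \<le> d"
proof -
  obtain a where a: "a \<in> T" using assms by auto
  show "bdd_above T" using d[OF _ a] by (intro bdd_aboveI[of _ "a + d"]) (simp add: algebra_simps)
  show "bdd_below T" using d[OF a] by (intro bdd_belowI[of _ "a - d"]) (simp add: algebra_simps)
  have "b - d \<le> Inf T" if "b \<in> T" for b
    using d[OF that] by (intro cInf_greatest assms(1)) (simp add: algebra_simps)
  then have "Sup T \<le> Inf T + d"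
    by (intro cSup_least assms(1)) (simp add: algebra_simps)
  then show "Sup T - Inf T \<le> d" by simp
qed

text \<open>A 1-Lipschitz function carries each covering set into an interval no longer than its
  diameter. The Borel set \<open>S\<close> stands in for the image, whose measurability is not
  known.\<close>

lemma lborel_le_hausdorff1_outer:
  fixes f :: "'a::metric_space \<Rightarrow> real"
  assumes lip: "\<And>x y. x \<in> A \<Longrightarrow> y \<in> A \<Longrightarrow> f x - f y \<le> dist x y"
    and S: "S \<subseteq> f ` A" "S \<in> sets borel"
  shows "emeasure lborel S \<le> hausdorff1_outer A"
proof -
  have "emeasure lborel S \<le> hausdorff1_pre 1 A"
    unfolding hausdorff1_pre_def
  proof (rule INF_greatest)
    fix E :: "nat \<Rightarrow> 'a set"
    assume "E \<in> {E. A \<subseteq> (\<Union>i. E i) \<and> (\<forall>i. bounded (E i) \<and> diameter (E i) \<le> 1)}"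
    then have cov: "A \<subseteq> (\<Union>i. E i)" and E: "\<And>i. bounded (E i)"
      by auto
    define T where "T i = f ` (E i \<inter> A)" for i
    define I where "I i = (if T i = {} then {} else {Inf (T i)..Sup (T i)})" for i
    have T: "bdd_above (T i)" "bdd_below (T i)" "Sup (T i) - Inf (T i) \<le> diameter (E i)"
      if ne: "T i \<noteq> {}" for i
    proof -
      have *: "a - b \<le> diameter (E i)" if "a \<in> T i" "b \<in> T i" for a b
        using that order_trans[OF lip diameter_bounded_bound[OF E]] by (auto simp: T_def)
      from bdd_Sup_minus_Inf_le[OF ne *]
      show "bdd_above (T i)" "bdd_below (T i)" "Sup (T i) - Inf (T i) \<le> diameter (E i)"
        by auto
    qed
    have "S \<subseteq> (\<Union>i. I i)"
    proof
      fix s assume "s \<in> S"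
      then obtain x i where "x \<in> A" "s = f x" "x \<in> E i" using S cov by blast
      then have "s \<in> T i" by (auto simp: T_def)
      then have "s \<in> I i" using T[of i] by (auto simp: I_def intro: cInf_lower cSup_upper)
      then show "s \<in> (\<Union>i. I i)" by blast
    qed
    then have "emeasure lborel S \<le> emeasure lborel (\<Union>i. I i)"
      by (intro emeasure_mono) (auto simp: I_def)
    also have "\<dots> \<le> (\<Sum>i. emeasure lborel (I i))"
      by (intro emeasure_subadditive_countably) (auto simp: I_def)
    also have "\<dots> \<le> (\<Sum>i. ennreal (diameter (E i)))"
    proof (rule suminf_le)
      fix i
      show "emeasure lborel (I i) \<le> ennreal (diameter (E i))"
      proof (cases "T i = {}")
        case False
        then have "Inf (T i) \<le> Sup (T i)"
          using T(1,2)[OF False] cInf_le_cSup by blast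
        then show ?thesis using T(3)[OF False] False by (simp add: I_def ennreal_leI)
      qed (simp add: I_def)
    qed auto
    finally show "emeasure lborel S \<le> (\<Sum>i. ennreal (diameter (E i)))" .
  qed
  also have "\<dots> \<le> hausdorff1_outer A"
    unfolding hausdorff1_outer_def by (intro SUP_upper) auto
  finally show ?thesis .
qed

text \<open>Covers of arbitrarily fine mesh with one common bound on the sum of the diameters. The
  summand 1 lifts the bound strictly above the infimum, so that some cover stays below it.\<close>

lemma hausdorff1_cover:
  fixes A :: "'a::metric_space set"
  assumes "hausdorff1_outer A < \<infinity>" "0 < \<delta>"
  obtains E :: "nat \<Rightarrow> 'a set" where "A \<subseteq> (\<Union>i. E i)" "\<And>i. bounded (E i)" "\<And>i. diameter (E i) \<le> \<delta>"
    "(\<Sum>i. ennreal (diameter (E i))) \<le> hausdorff1_outer A + 1"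
proof -
  have "hausdorff1_pre \<delta> A \<le> hausdorff1_outer A"
    unfolding hausdorff1_outer_def using assms by (intro SUP_upper) auto
  also have "\<dots> < hausdorff1_outer A + 1"
    using assms ennreal_add_left_cancel_less[of "hausdorff1_outer A" 0 1] by auto
  finally show ?thesis
    unfolding hausdorff1_pre_def INF_less_iff using that by (auto intro: less_imp_le)
qed

lemma hausdorff1_UNIV: "emeasure hausdorff1 (UNIV :: 'a::metric_space set) = hausdorff1_outer (UNIV :: 'a::metric_space set)"
  by (rule emeasure_hausdorff1) (metis sets.top space_hausdorff1)

text \<open>One point is taken from each set of countable covers whose mesh tends to 0; an empty
  covering set contributes an arbitrary point, which does no harm.\<close>

lemma hausdorff1_finite_dense_sequence:
  assumes "emeasure hausdorff1 (UNIV :: 'a::metric_space set) < \<infinity>"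
  obtains d :: "nat \<Rightarrow> 'a::metric_space" where "\<And>x e. 0 < e \<Longrightarrow> \<exists>n. dist (d n) x < e"
proof -
  have "\<exists>E :: nat \<Rightarrow> 'a set. UNIV \<subseteq> (\<Union>i. E i) \<and> (\<forall>i. bounded (E i) \<and> diameter (E i) \<le> 1 / real (Suc m))" for m
    using hausdorff1_cover[of "UNIV :: 'a set" "1 / real (Suc m)"] assms
    unfolding hausdorff1_UNIV by (metis of_nat_0_less_iff zero_less_Suc zero_less_divide_1_iff)
  then obtain E :: "nat \<Rightarrow> nat \<Rightarrow> 'a set" where cov: "\<And>m. UNIV \<subseteq> (\<Union>i. E m i)"
    and E: "\<And>m i. bounded (E m i)" "\<And>m i. diameter (E m i) \<le> 1 / real (Suc m)"
    by metis
  define d where "d n = (case prod_decode n of (m, i) \<Rightarrow> SOME x. x \<in> E m i)" for n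
  have "\<exists>n. dist (d n) x < e" if "0 < e" for x e
  proof -
    obtain m where m: "1 / real (Suc m) < e" using nat_approx_posE[OF \<open>0 < e\<close>] by auto
    obtain i where i: "x \<in> E m i" using cov by blast
    have "d (prod_encode (m, i)) \<in> E m i"
      using i by (auto simp: d_def intro: someI)
    then have "dist (d (prod_encode (m, i))) x \<le> 1 / real (Suc m)"
      using diameter_bounded_bound[OF E(1) _ i] E(2) order_trans by blast
    then show ?thesis using m by (intro exI[of _ "prod_encode (m, i)"]) simp
  qed
  then show ?thesis by (rule that)
qed

lemma hausdorff1_outer_countable:
  assumes "countable N"
  shows "hausdorff1_outer N = 0"
proof -
  have *: "hausdorff1_outer {x} = 0" for x :: 'a
  proof -
    have "hausdorff1_pre \<delta> {x} \<le> 0" if "0 < \<delta>" for \<delta>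
    proof -
      have "hausdorff1_pre \<delta> {x} \<le> (\<Sum>i::nat. ennreal (diameter {x}))"
        unfolding hausdorff1_pre_def using that by (intro INF_lower) auto
      then show ?thesis by simp
    qed
    then show ?thesis by (auto simp: hausdorff1_outer_def)
  qed
  show ?thesis
  proof (cases "N = {}")
    case False
    have "hausdorff1_outer (\<Union>n. {from_nat_into N n}) \<le> (\<Sum>n. hausdorff1_outer {from_nat_into N n})"
      by (rule hausdorff1_outer_UN)
    then show ?thesis
      using range_from_nat_into[OF False assms] by (simp add: * UNION_singleton_eq_range)
  qed simp
qed

text \<open>Connectedness makes the distance from \<open>x\<close> take every value in
  \<open>{0..<r}\<close> inside the ball, and this distance is 1-Lipschitz.\<close>

lemma hausdorff1_ball_ge:
  fixes x :: "'a::metric_space"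
  assumes con: "connected (UNIV :: 'a set)" and "ball x r \<noteq> UNIV"
  shows "ennreal r \<le> emeasure hausdorff1 (ball x r)"
proof (cases "0 < r")
  case True
  have "\<exists>y. y \<notin> ball x r" using assms(2) by blast
  then obtain y where y: "r \<le> dist x y" by (auto simp: not_less)
  have "{0..<r} \<subseteq> dist x ` ball x r"
  proof
    fix s assume s: "s \<in> {0..<r}"
    have "connected (dist x ` UNIV)"
      by (intro connected_continuous_image con continuous_intros)
    moreover have "0 \<in> dist x ` UNIV" by (auto intro!: image_eqI[of _ _ x])
    ultimately have "s \<in> dist x ` UNIV"
      by (rule connectedD_interval[of _ 0 "dist x y"]) (use s y in auto)
    then show "s \<in> dist x ` ball x r" using s by auto
  qed
  then have "emeasure lborel {0..<r} \<le> hausdorff1_outer (ball x r)"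
  proof (rule lborel_le_hausdorff1_outer[rotated])
    show "dist x a - dist x b \<le> dist a b" for a b
      using dist_triangle[of x a b] by (simp add: dist_commute)
  qed simp
  then show ?thesis using True by (simp add: emeasure_hausdorff1)
qed (simp add: ennreal_neg not_less)

text \<open>A packing bound; it yields both total boundedness and the bound on the number of steps
  in a shortest chain.\<close>

lemma card_disjoint_balls_le:
  fixes F :: "'a::metric_space set"
  assumes con: "connected (UNIV :: 'a set)" and "finite F"
    and "disjoint_family_on (\<lambda>x. ball x r) F" and "\<And>x. x \<in> F \<Longrightarrow> ball x r \<noteq> UNIV"
  shows "of_nat (card F) * ennreal r \<le> emeasure hausdorff1 (UNIV :: 'a set)"
proof -
  have "of_nat (card F) * ennreal r = (\<Sum>x\<in>F. ennreal r)" by simp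
  also have "\<dots> \<le> (\<Sum>x\<in>F. emeasure hausdorff1 (ball x r))"
    by (intro sum_mono hausdorff1_ball_ge con assms)
  also have "\<dots> = emeasure hausdorff1 (\<Union>x\<in>F. ball x r)"
    using assms by (intro sum_emeasure) auto
  also have "\<dots> \<le> emeasure hausdorff1 (UNIV :: 'a set)"
    by (intro emeasure_mono) auto
  finally show ?thesis .
qed

lemma ennreal_of_nat_mult_unbounded:
  assumes "M < (\<infinity>::ennreal)" "0 < r"
  shows "\<exists>n. M < of_nat n * ennreal r"
proof -
  obtain m where m: "M = ennreal m" "0 \<le> m" using assms by (cases M) auto
  obtain n where "m < real n * r" using reals_Archimedean3[OF \<open>0 < r\<close>] by auto
  then have "M < ennreal (real n * r)" using m by (simp add: ennreal_less_iff)
  also have "ennreal (real n * r) = of_nat n * ennreal r"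
    unfolding ennreal_of_nat_eq_real_of_nat using \<open>0 < r\<close> by (intro ennreal_mult) auto
  finally show ?thesis by blast
qed

text \<open>Without a finite \<open>e\<close>-net there would be arbitrarily many disjoint balls of
  radius \<open>e/2\<close>, against the packing bound.\<close>

lemma compact_UNIV_if_hausdorff1_finite:
  assumes con: "connected (UNIV :: 'a::complete_space set)"
    and fin: "emeasure hausdorff1 (UNIV :: 'a::complete_space set) < \<infinity>"
  shows "compact (UNIV :: 'a::complete_space set)"
  unfolding compact_eq_totally_bounded
proof (intro conjI allI impI)
  show "complete (UNIV :: 'a set)" by (rule complete_UNIV)
  fix e :: real assume "0 < e"
  show "\<exists>k::'a set. finite k \<and> UNIV \<subseteq> (\<Union>x\<in>k. ball x e)"
  proof (rule ccontr)
    assume no: "\<not> ?thesis"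
    define P where "P n \<longleftrightarrow> (\<exists>F :: 'a set. finite F \<and> card F = n \<and> disjoint_family_on (\<lambda>x. ball x (e/2)) F)" for n
    have "P n" for n
    proof (induction n)
      case (Suc n)
      then obtain F :: "'a set" where F: "finite F" "card F = n" "disjoint_family_on (\<lambda>x. ball x (e/2)) F"
        unfolding P_def by auto
      obtain y where y: "y \<notin> (\<Union>x\<in>F. ball x e)" using no F(1) by blast
      have "ball x (e/2) \<inter> ball y (e/2) = {}" if "x \<in> F" for x
      proof -
        have "e \<le> dist x y" using y that by auto
        then show ?thesis by (intro disjoint_ballI) auto
      qed
      moreover have "y \<notin> F" using y \<open>0 < e\<close> by auto
      ultimately show ?case
        unfolding P_def using F
        by (intro exI[of _ "insert y F"]) (auto simp: disjoint_family_on_insert)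
    qed (auto simp: P_def disjoint_family_on_def intro!: exI[of _ "{}"])
    then have le: "of_nat n * ennreal (e/2) \<le> emeasure hausdorff1 (UNIV :: 'a set)" for n
    proof -
      obtain F :: "'a set" where F: "finite F" "card F = n" "disjoint_family_on (\<lambda>x. ball x (e/2)) F"
        using \<open>P n\<close> unfolding P_def by auto
      \<comment> \<open>A ball equal to the whole space would give an \<open>e\<close>-net with one
        centre.\<close>
      have "ball x (e/2) \<noteq> UNIV" for x :: 'a
        using no \<open>0 < e\<close> subset_ball[of "e/2" e x] by (auto dest!: spec[of _ "{x}"])
      then show ?thesis
        using card_disjoint_balls_le[OF con F(1,3)] F(2) by auto
    qed
    obtain n where "emeasure hausdorff1 (UNIV :: 'a set) < of_nat n * ennreal (e/2)"
      using ennreal_of_nat_mult_unbounded[OF fin, of "e/2"] \<open>0 < e\<close> by auto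
    then show False using le[of n] by simp
  qed
qed

section \<open>Paths of bounded length\<close>

text \<open>For an uncountable index type there may be no subsequence that converges at all
  coordinates. A cluster point still has every finite set of coordinates approximated along
  arbitrarily late terms.\<close>

lemma pointwise_cluster_point:
  fixes f :: "nat \<Rightarrow> 'i \<Rightarrow> 'b::metric_space"
  assumes K: "\<And>i. compact (K i)" and f: "\<And>n i. f n i \<in> K i"
  obtains g where "\<And>i. g i \<in> K i"
    "\<And>I e N. finite I \<Longrightarrow> 0 < e \<Longrightarrow> \<exists>n\<ge>N. \<forall>i\<in>I. dist (f n i) (g i) < e"
proof -
  have "compactin (product_topology (\<lambda>_. euclidean) UNIV) (PiE UNIV K)"
    using K by (auto simp: compactin_PiE)
  then have "compact (PiE UNIV K)"
    by (simp add: euclidean_product_topology)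
  then have "\<And>F. F \<le> principal (PiE UNIV K) \<Longrightarrow> F \<noteq> bot \<Longrightarrow> \<exists>x\<in>PiE UNIV K. inf (nhds x) F \<noteq> bot"
    unfolding compact_filter le_principal by auto
  moreover have "filtermap f sequentially \<le> principal (PiE UNIV K)"
    unfolding le_principal eventually_filtermap using f by (intro always_eventually) auto
  moreover have "filtermap f sequentially \<noteq> bot"
    by (simp add: filtermap_bot_iff)
  ultimately obtain g where g: "g \<in> PiE UNIV K" "inf (nhds g) (filtermap f sequentially) \<noteq> bot"
    by blast
  show ?thesis
  proof (rule that)
    show "g i \<in> K i" for i using g(1) by auto
    fix I :: "'i set" and e :: real and N
    assume "finite I" "0 < e"
    have "((\<lambda>h. h i) \<longlongrightarrow> g i) (nhds g)" for i
    proof -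
      have "continuous_on UNIV (\<lambda>h :: 'i \<Rightarrow> 'b. h i)"
        by (rule continuous_on_product_coordinates)
      then have "((\<lambda>h. h i) \<longlongrightarrow> g i) (at g)"
        unfolding continuous_on_def by blast
      then show ?thesis
        using tendsto_at_iff_tendsto_nhds[of "\<lambda>h. h i" g] by blast
    qed
    then have "\<forall>\<^sub>F h in nhds g. dist (h i) (g i) < e" for i
      using \<open>0 < e\<close> tendstoD by blast
    then have "\<forall>\<^sub>F h in nhds g. \<forall>i\<in>I. dist (h i) (g i) < e"
      using \<open>finite I\<close> by (intro eventually_ball_finite) auto
    moreover have "\<forall>\<^sub>F h in filtermap f sequentially. \<exists>n\<ge>N. h = f n"
      unfolding eventually_filtermap by (rule eventually_sequentiallyI[of N]) auto
    ultimately have "\<forall>\<^sub>F h in inf (nhds g) (filtermap f sequentially).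
        (\<forall>i\<in>I. dist (h i) (g i) < e) \<and> (\<exists>n\<ge>N. h = f n)"
      unfolding eventually_inf by blast
    then have "\<exists>h. (\<forall>i\<in>I. dist (h i) (g i) < e) \<and> (\<exists>n\<ge>N. h = f n)"
      using g(2) eventually_happens' by blast
    then show "\<exists>n\<ge>N. \<forall>i\<in>I. dist (f n i) (g i) < e" by blast
  qed
qed

text \<open>Plain 1-Lipschitz paths are used because they are closed under concatenation, reversal
  and limits; the injective arc-length curves that \<open>pV\<close> asks for are recovered from
  shortest ones.\<close>

definition joinable :: "'a::metric_space set \<Rightarrow> 'a \<Rightarrow> 'a \<Rightarrow> bool" where
  "joinable U x y \<longleftrightarrow>
     (\<exists>L\<ge>0::real. \<exists>\<gamma>. 1-lipschitz_on {0..L} \<gamma> \<and> \<gamma> 0 = x \<and> \<gamma> L = y \<and> \<gamma> ` {0..L} \<subseteq> U)"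

text \<open>The approximations \<open>c\<close> may be discontinuous: their error
  \<open>\<eta>\<close> disappears in a pointwise cluster point, since the Lipschitz condition
  involves two parameters at a time.\<close>

lemma lipschitz_path_limit:
  fixes x y :: "'a::metric_space"
  assumes K: "compact K" and "0 \<le> (L::real)"
    and c: "\<And>\<eta>::real. 0 < \<eta> \<Longrightarrow> \<exists>c. c ` {0..L} \<subseteq> K \<and> dist (c 0) x \<le> \<eta> \<and> dist (c L) y \<le> \<eta> \<and>
              (\<forall>s\<in>{0..L}. \<forall>t\<in>{0..L}. dist (c s) (c t) \<le> \<bar>s - t\<bar> + \<eta>)"
  obtains \<gamma> where "1-lipschitz_on {0..L} \<gamma>" "\<gamma> 0 = x" "\<gamma> L = y" "\<gamma> ` {0..L} \<subseteq> K"
proof -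
  obtain c where c: "\<And>n. c n ` {0..L} \<subseteq> K" "\<And>n. dist (c n 0) x \<le> 1 / real (Suc n)"
      "\<And>n. dist (c n L) y \<le> 1 / real (Suc n)"
      "\<And>n s t. s \<in> {0..L} \<Longrightarrow> t \<in> {0..L} \<Longrightarrow> dist (c n s) (c n t) \<le> \<bar>s - t\<bar> + 1 / real (Suc n)"
    using c[of "1 / real (Suc n)" for n] by (simp only: zero_less_divide_1_iff of_nat_0_less_iff zero_less_Suc) metis
  define f where "f n s = c n (max 0 (min L s))" for n s
  have fK: "f n s \<in> K" for n s
    using c(1)[of n] \<open>0 \<le> L\<close> by (auto simp: f_def image_subset_iff)
  obtain \<gamma> where g: "\<And>s. \<gamma> s \<in> K"
    "\<And>I e N. finite I \<Longrightarrow> 0 < e \<Longrightarrow> \<exists>n\<ge>N. \<forall>i\<in>I. dist (f n i) (\<gamma> i) < e"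
    using pointwise_cluster_point[of "\<lambda>_. K" f] K fK by metis
  have close: "\<exists>n. 1 / real (Suc n) < e \<and> (\<forall>i\<in>I. dist (c n i) (\<gamma> i) < e)"
    if fin: "finite I" and pos: "0 < e" and "I \<subseteq> {0..L}" for I e
  proof -
    obtain N where N: "1 / real (Suc N) < e" using nat_approx_posE[OF \<open>0 < e\<close>] by auto
    obtain n where n: "n \<ge> N" "\<forall>i\<in>I. dist (f n i) (\<gamma> i) < e" using g(2)[OF fin pos] by blast
    have "1 / real (Suc n) \<le> 1 / real (Suc N)" using n by (intro divide_left_mono) auto
    then have "1 / real (Suc n) < e" using N by linarith
    moreover have "f n i = c n i" if iI: "i \<in> I" for i
      using \<open>I \<subseteq> {0..L}\<close> iI by (auto simp: f_def subset_iff min_def max_def)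
    ultimately show ?thesis using n by auto
  qed
  show ?thesis
  proof (rule that)
    show "1-lipschitz_on {0..L} \<gamma>"
    proof (rule lipschitz_onI)
      fix s t assume st: "s \<in> {0..L}" "t \<in> {0..L}"
      show "dist (\<gamma> s) (\<gamma> t) \<le> 1 * dist s t"
      proof (rule field_le_epsilon)
        fix e :: real assume "0 < e"
        then obtain n where n: "1 / real (Suc n) < e/3" "dist (c n s) (\<gamma> s) < e/3" "dist (c n t) (\<gamma> t) < e/3"
          using close[of "{s, t}" "e/3"] st by auto
        have "dist (\<gamma> s) (\<gamma> t) \<le> dist (c n s) (\<gamma> s) + dist (c n s) (c n t) + dist (c n t) (\<gamma> t)"
          using dist_triangle[of "\<gamma> s" "\<gamma> t" "c n s"] dist_triangle[of "c n s" "\<gamma> t" "c n t"]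
          by (simp add: dist_commute)
        then show "dist (\<gamma> s) (\<gamma> t) \<le> 1 * dist s t + e"
          using n c(4)[OF st, of n] by (simp add: dist_real_def)
      qed
    qed simp
    have "dist (\<gamma> 0) x \<le> 0"
    proof (rule field_le_epsilon)
      fix e :: real assume "0 < e"
      then obtain n where n: "1 / real (Suc n) < e/2" "dist (c n 0) (\<gamma> 0) < e/2"
        using close[of "{0}" "e/2"] \<open>0 \<le> L\<close> by auto
      then show "dist (\<gamma> 0) x \<le> 0 + e"
        using c(2)[of n] dist_triangle[of "\<gamma> 0" x "c n 0"] by (simp add: dist_commute)
    qed
    then show "\<gamma> 0 = x" by simp
    have "dist (\<gamma> L) y \<le> 0"
    proof (rule field_le_epsilon)
      fix e :: real assume "0 < e"
      then obtain n where n: "1 / real (Suc n) < e/2" "dist (c n L) (\<gamma> L) < e/2"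
        using close[of "{L}" "e/2"] \<open>0 \<le> L\<close> by auto
      then show "dist (\<gamma> L) y \<le> 0 + e"
        using c(3)[of n] dist_triangle[of "\<gamma> L" y "c n L"] by (simp add: dist_commute)
    qed
    then show "\<gamma> L = y" by simp
    show "\<gamma> ` {0..L} \<subseteq> K" using g(1) by auto
  qed
qed

section \<open>Length of curves and its additivity\<close>

lemma dist_le_curve_length:
  assumes "a \<le> b"
  shows "ennreal (dist (\<gamma> a) (\<gamma> b)) \<le> curve_length \<gamma> a b"
  unfolding curve_length_def
  by (rule SUP_upper2[of "(1, \<lambda>i. if i = 0 then a else b)"])
     (use assms in \<open>auto simp: mono_on_def\<close>)

lemma curve_length_le_lipschitz:
  assumes lip: "1-lipschitz_on {a..b} \<gamma>" and "a \<le> b"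
  shows "curve_length \<gamma> a b \<le> ennreal (b - a)"
  unfolding curve_length_def
proof (rule SUP_least, clarify)
  fix n :: nat and t :: "nat \<Rightarrow> real"
  assume t: "\<forall>i\<le>n. t i \<in> {a..b}" "mono_on {..n} t"
  have mono: "t i \<le> t (Suc i)" if "i < n" for i
    using t(2) that by (auto simp: mono_on_def)
  have "(\<Sum>i<n. ennreal (dist (\<gamma> (t i)) (\<gamma> (t (Suc i))))) \<le> (\<Sum>i<n. ennreal (t (Suc i) - t i))"
  proof (intro sum_mono ennreal_leI)
    fix i assume "i \<in> {..<n}"
    then show "dist (\<gamma> (t i)) (\<gamma> (t (Suc i))) \<le> t (Suc i) - t i"
      using lipschitz_onD[OF lip, of "t i" "t (Suc i)"] t(1) mono[of i] by (auto simp: dist_real_def)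
  qed
  also have "\<dots> = ennreal (\<Sum>i<n. t (Suc i) - t i)"
    using mono by (intro sum_ennreal) auto
  also have "\<dots> = ennreal (t n - t 0)"
    by (simp add: sum_lessThan_telescope)
  also have "\<dots> \<le> ennreal (b - a)"
    using t(1) by (intro ennreal_leI) (smt (verit) atLeastAtMost_iff le0 order_refl)
  finally show "(\<Sum>i<n. ennreal (dist (\<gamma> (t i)) (\<gamma> (t (Suc i))))) \<le> ennreal (b - a)" .
qed

lemma curve_length_subadditive:
  assumes "a \<le> b" "b \<le> c"
  shows "curve_length \<gamma> a c \<le> curve_length \<gamma> a b + curve_length \<gamma> b c"
  unfolding curve_length_def[of \<gamma> a c]
proof (rule SUP_least, clarify)
  fix n :: nat and t :: "nat \<Rightarrow> real"
  assume t: "\<forall>i\<le>n. t i \<in> {a..c}" "mono_on {..n} t"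
  \<comment> \<open>The partition is cut at \<open>b\<close>. A step that crosses \<open>b\<close>
    is split by the triangle inequality through \<open>\<gamma> b\<close>; for any other step one of
    the two new ones is degenerate.\<close>
  define p where "p i = min (t i) b" for i
  define q where "q i = max (t i) b" for i
  have mono: "mono_on {..n} p" "mono_on {..n} q"
    using t(2) min.mono[OF _ order_refl[of b]] max.mono[OF _ order_refl[of b]]
    unfolding mono_on_def p_def q_def by blast+
  have "(\<Sum>i<n. ennreal (dist (\<gamma> (t i)) (\<gamma> (t (Suc i)))))
      \<le> (\<Sum>i<n. ennreal (dist (\<gamma> (p i)) (\<gamma> (p (Suc i)))) + ennreal (dist (\<gamma> (q i)) (\<gamma> (q (Suc i)))))"
  proof (rule sum_mono)
    fix i assume "i \<in> {..<n}"
    then have "t i \<le> t (Suc i)" using t(2) by (auto simp: mono_on_def)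
    then have "dist (\<gamma> (t i)) (\<gamma> (t (Suc i))) \<le> dist (\<gamma> (p i)) (\<gamma> (p (Suc i))) + dist (\<gamma> (q i)) (\<gamma> (q (Suc i)))"
      using dist_triangle[of "\<gamma> (t i)" "\<gamma> (t (Suc i))" "\<gamma> b"] by (auto simp: p_def q_def min_def max_def)
    then show "ennreal (dist (\<gamma> (t i)) (\<gamma> (t (Suc i))))
        \<le> ennreal (dist (\<gamma> (p i)) (\<gamma> (p (Suc i)))) + ennreal (dist (\<gamma> (q i)) (\<gamma> (q (Suc i))))"
      by (simp add: ennreal_plus[symmetric] ennreal_leI del: ennreal_plus)
  qed
  also have "\<dots> = (\<Sum>i<n. ennreal (dist (\<gamma> (p i)) (\<gamma> (p (Suc i))))) + (\<Sum>i<n. ennreal (dist (\<gamma> (q i)) (\<gamma> (q (Suc i)))))"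
    by (rule sum.distrib)
  also have "\<dots> \<le> curve_length \<gamma> a b + curve_length \<gamma> b c"
    unfolding curve_length_def
  proof (rule add_mono)
    show "(\<Sum>i<n. ennreal (dist (\<gamma> (p i)) (\<gamma> (p (Suc i))))) \<le>
      (SUP (n, t)\<in>{(n, t). (\<forall>i\<le>n. t i \<in> {a..b}) \<and> mono_on {..n} t}. \<Sum>i<n. ennreal (dist (\<gamma> (t i)) (\<gamma> (t (Suc i)))))"
      by (rule SUP_upper2[of "(n, p)"])
        (use t assms mono in \<open>auto simp: p_def\<close>)
    show "(\<Sum>i<n. ennreal (dist (\<gamma> (q i)) (\<gamma> (q (Suc i))))) \<le>
      (SUP (n, t)\<in>{(n, t). (\<forall>i\<le>n. t i \<in> {b..c}) \<and> mono_on {..n} t}. \<Sum>i<n. ennreal (dist (\<gamma> (t i)) (\<gamma> (t (Suc i)))))"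
      by (rule SUP_upper2[of "(n, q)"])
        (use t assms mono in \<open>auto simp: q_def\<close>)
  qed
  finally show "(\<Sum>i<n. ennreal (dist (\<gamma> (t i)) (\<gamma> (t (Suc i))))) \<le> curve_length \<gamma> a b + curve_length \<gamma> b c" .
qed

lemma curve_length_superadditive:
  assumes "a \<le> b" "b \<le> c"
  shows "curve_length \<gamma> a b + curve_length \<gamma> b c \<le> curve_length \<gamma> a c"
proof -
  let ?S = "\<lambda>a b. {(n::nat, t::nat \<Rightarrow> real). (\<forall>i\<le>n. t i \<in> {a..b}) \<and> mono_on {..n} t}"
  let ?l = "\<lambda>(n, t). \<Sum>i<n. ennreal (dist (\<gamma> (t i)) (\<gamma> (t (Suc i))))"
  have ne: "?S a b \<noteq> {}" "?S b c \<noteq> {}"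
    using assms by (auto intro!: exI[of _ 0] exI[of _ "\<lambda>_. b"] simp: mono_on_def)
  have "?l (n, p) + ?l (m, q) \<le> curve_length \<gamma> a c"
    if p: "(n, p) \<in> ?S a b" and q: "(m, q) \<in> ?S b c" for n p m q
  proof -
    \<comment> \<open>The partitions are run one after the other. The linking step from
      \<open>p n\<close> to \<open>q 0\<close> adds a nonnegative term, which is dropped.\<close>
    define t where "t i = (if i \<le> n then p i else q (i - Suc n))" for i
    have split: "(\<Sum>i<n+k. f i) = (\<Sum>i<n. f i) + (\<Sum>i<k. f (n+i))" for f :: "nat \<Rightarrow> ennreal" and k
      by (induction k) (auto simp: algebra_simps)
    have "?l (n, p) + ?l (m, q) \<le> ?l (n + Suc m, t)"
    proof -
      have "?l (n + Suc m, t) = (\<Sum>i<n. ennreal (dist (\<gamma> (t i)) (\<gamma> (t (Suc i)))))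
          + (\<Sum>i<Suc m. ennreal (dist (\<gamma> (t (n + i))) (\<gamma> (t (Suc (n + i))))))"
        unfolding prod.case by (rule split)
      also have "(\<Sum>i<n. ennreal (dist (\<gamma> (t i)) (\<gamma> (t (Suc i))))) = ?l (n, p)"
        by (auto simp: t_def intro!: sum.cong)
      also have "(\<Sum>i<Suc m. ennreal (dist (\<gamma> (t (n + i))) (\<gamma> (t (Suc (n + i))))))
          = ennreal (dist (\<gamma> (t n)) (\<gamma> (t (Suc n)))) + (\<Sum>i<m. ennreal (dist (\<gamma> (t (n + Suc i))) (\<gamma> (t (Suc (n + Suc i))))))"
        by (subst sum.lessThan_Suc_shift) simp
      also have "(\<Sum>i<m. ennreal (dist (\<gamma> (t (n + Suc i))) (\<gamma> (t (Suc (n + Suc i)))))) = ?l (m, q)"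
        by (auto simp: t_def intro!: sum.cong)
      finally show ?thesis by (simp add: add_left_mono)
    qed
    also have "(n + Suc m, t) \<in> ?S a c"
    proof -
      have range: "t i \<in> {a..c}" if "i \<le> n + Suc m" for i
      proof (cases "i \<le> n")
        case True
        then have "p i \<in> {a..b}" using p by auto
        then show ?thesis using True assms by (auto simp: t_def)
      next
        case False
        then have "q (i - Suc n) \<in> {b..c}" using q that by auto
        then show ?thesis using False assms by (auto simp: t_def)
      qed
      moreover have "t i \<le> t j" if "i \<le> j" "j \<le> n + Suc m" for i j
      proof -
        consider "j \<le> n" | "i \<le> n" "n < j" | "n < i" by linarith
        then show ?thesis
        proof cases
          case 1 then show ?thesis using p that by (auto simp: t_def mono_on_def)
        next
          case 2
          then have "p i \<le> b" "b \<le> q (j - Suc n)" using p q that by auto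
          then show ?thesis using 2 by (auto simp: t_def)
        next
          case 3
          then have "i - Suc n \<le> j - Suc n" "j - Suc n \<le> m" using that by auto
          then show ?thesis using q that 3 by (auto simp: t_def mono_on_def)
        qed
      qed
      ultimately show ?thesis by (auto simp: mono_on_def)
    qed
    then have "?l (n + Suc m, t) \<le> curve_length \<gamma> a c"
      unfolding curve_length_def by (rule SUP_upper)
    finally show ?thesis .
  qed
  then have "?l P + ?l Q \<le> curve_length \<gamma> a c" if "P \<in> ?S a b" "Q \<in> ?S b c" for P Q
    using that by (cases P, cases Q) blast
  then have "(SUP P\<in>?S a b. SUP Q\<in>?S b c. ?l P + ?l Q) \<le> curve_length \<gamma> a c"
    by (intro SUP_least) blast
  moreover have "(SUP P\<in>?S a b. ?l P) + (SUP Q\<in>?S b c. ?l Q) = (SUP P\<in>?S a b. ?l P + (SUP Q\<in>?S b c. ?l Q))"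
    by (rule ennreal_SUP_add_left[OF ne(1), symmetric])
  moreover have "\<dots> = (SUP P\<in>?S a b. SUP Q\<in>?S b c. ?l P + ?l Q)"
    by (intro SUP_cong refl ennreal_SUP_add_right ne(2))
  ultimately show ?thesis
    unfolding curve_length_def[of \<gamma> a b] curve_length_def[of \<gamma> b c] by (simp only:)
qed

lemma curve_length_add:
  "a \<le> b \<Longrightarrow> b \<le> c \<Longrightarrow> curve_length \<gamma> a c = curve_length \<gamma> a b + curve_length \<gamma> b c"
  by (intro antisym curve_length_subadditive curve_length_superadditive)

section \<open>Joinability as an equivalence relation, and shortest paths\<close>

lemma joinableI:
  fixes L :: real
  assumes "0 \<le> L" "1-lipschitz_on {0..L} \<gamma>" "\<gamma> 0 = x" "\<gamma> L = y" "\<gamma> ` {0..L} \<subseteq> U"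
  shows "joinable U x y"
  unfolding joinable_def by (rule exI[of _ L], rule conjI, fact, rule exI[of _ \<gamma>]) (simp add: assms)

lemma joinableE:
  assumes "joinable U x y"
  obtains L \<gamma> where "0 \<le> (L::real)" "1-lipschitz_on {0..L} \<gamma>" "\<gamma> 0 = x" "\<gamma> L = y" "\<gamma> ` {0..L} \<subseteq> U"
  using assms unfolding joinable_def by (elim exE conjE) (rule that)

lemma joinable_refl: "x \<in> U \<Longrightarrow> joinable U x x"
  by (rule joinableI[of 0 "\<lambda>_. x"]) (auto simp: lipschitz_on_def)

lemma joinable_mono: "joinable U x y \<Longrightarrow> U \<subseteq> V \<Longrightarrow> joinable V x y"
  by (elim joinableE) (rule joinableI, assumption+, blast)

lemma joinable_sym:
  assumes "joinable U x y" shows "joinable U y x"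
proof -
  obtain L \<gamma> where g: "(L::real) \<ge> 0" "1-lipschitz_on {0..L} \<gamma>" "\<gamma> 0 = x" "\<gamma> L = y" "\<gamma> ` {0..L} \<subseteq> U"
    using assms(1) by (rule joinableE)
  have "1-lipschitz_on {0..L} (\<lambda>s. \<gamma> (L - s))"
  proof (rule lipschitz_onI)
    fix s t assume "s \<in> {0..L}" "t \<in> {0..L}"
    then show "dist (\<gamma> (L - s)) (\<gamma> (L - t)) \<le> 1 * dist s t"
      using lipschitz_onD[OF g(2), of "L - s" "L - t"] by (simp add: dist_real_def)
  qed simp
  then show ?thesis
    using g by (intro joinableI[of L "\<lambda>s. \<gamma> (L - s)"]) (auto simp: image_subset_iff)
qed

lemma joinable_trans:
  assumes "joinable U x y" "joinable U y z" shows "joinable U x z"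
proof -
  obtain L \<gamma> where g: "(L::real) \<ge> 0" "1-lipschitz_on {0..L} \<gamma>" "\<gamma> 0 = x" "\<gamma> L = y" "\<gamma> ` {0..L} \<subseteq> U"
    using assms(1) by (rule joinableE)
  obtain M \<eta> where h: "(M::real) \<ge> 0" "1-lipschitz_on {0..M} \<eta>" "\<eta> 0 = y" "\<eta> M = z" "\<eta> ` {0..M} \<subseteq> U"
    using assms(2) by (rule joinableE)
  define k where "k s = (if s \<le> L then \<gamma> s else \<eta> (s - L))" for s
  have k: "dist (k s) (k t) \<le> t - s" if "0 \<le> s" "s \<le> t" "t \<le> L + M" for s t
  proof -
    consider "t \<le> L" | "s \<le> L" "L < t" | "L < s" by linarith
    then show ?thesis
    proof cases
      case 1 then show ?thesis using lipschitz_onD[OF g(2), of s t] that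
        by (simp add: k_def dist_real_def)
    next
      case 2
      then have "dist (\<gamma> s) (\<gamma> L) \<le> L - s" "dist (\<eta> 0) (\<eta> (t - L)) \<le> t - L"
        using lipschitz_onD[OF g(2), of s L] lipschitz_onD[OF h(2), of 0 "t - L"] that g(1) h(1)
        by (auto simp: dist_real_def)
      then show ?thesis
        using dist_triangle[of "\<gamma> s" "\<eta> (t - L)" y] g h 2 by (simp add: k_def)
    next
      case 3 then show ?thesis using lipschitz_onD[OF h(2), of "s - L" "t - L"] that
        by (simp add: k_def dist_real_def)
    qed
  qed
  have "1-lipschitz_on {0..L+M} k"
  proof (rule lipschitz_onI)
    fix s t assume "s \<in> {0..L+M}" "t \<in> {0..L+M}"
    then show "dist (k s) (k t) \<le> 1 * dist s t"
      using k[of s t] k[of t s] by (cases "s \<le> t") (auto simp: dist_commute dist_real_def)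
  qed simp
  moreover have "k 0 = x" "k ` {0..L+M} \<subseteq> U"
    using g h by (auto simp: k_def image_subset_iff)
  moreover have "k (L+M) = z"
    using g h by (cases "M = 0") (auto simp: k_def)
  ultimately show ?thesis
    using g(1) h(1) by (intro joinableI[of "L + M" k]) auto
qed

text \<open>An initial piece of the path joins \<open>x\<close> to each point on it. Hence the
  points of a class are joined inside the class, and curves chosen in different classes are
  disjoint.\<close>

lemma joinable_within_class:
  assumes "joinable U x y"
  shows "joinable {z. joinable U x z} x y"
proof -
  obtain L \<gamma> where g: "(L::real) \<ge> 0" "1-lipschitz_on {0..L} \<gamma>" "\<gamma> 0 = x" "\<gamma> L = y" "\<gamma> ` {0..L} \<subseteq> U"
    using assms(1) by (rule joinableE)
  have "joinable U x (\<gamma> s)" if "s \<in> {0..L}" for s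
    using g that lipschitz_on_subset[OF g(2), of "{0..s}"]
    by (intro joinableI[of s \<gamma>]) (auto simp: image_subset_iff)
  then show ?thesis
    using g by (intro joinableI[of L \<gamma>]) auto
qed

lemma arclength_curve_lipschitz:
  assumes "arclength_curve l \<gamma>"
  shows "1-lipschitz_on {0..l} \<gamma>"
proof (rule lipschitz_onI)
  have *: "dist (\<gamma> s) (\<gamma> t) \<le> t - s" if "0 \<le> s" "s \<le> t" "t \<le> l" for s t
  proof -
    have "curve_length \<gamma> s t = ennreal (t - s)"
      using assms that unfolding arclength_curve_def by blast
    then have "ennreal (dist (\<gamma> s) (\<gamma> t)) \<le> ennreal (t - s)"
      using dist_le_curve_length[OF that(2), of \<gamma>] by simp
    then show ?thesis using that by (simp add: ennreal_le_iff)
  qed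
  fix s t assume "s \<in> {0..l}" "t \<in> {0..l}"
  then show "dist (\<gamma> s) (\<gamma> t) \<le> 1 * dist s t"
    using *[of s t] *[of t s] by (cases "s \<le> t") (auto simp: dist_commute dist_real_def)
qed simp

text \<open>A shortest path is injective, as loops could be cut out, and parametrized by arc length, as
  otherwise its arc length parametrization would be shorter.\<close>

lemma joinable_arclength_curve:
  assumes K: "compact K" and "joinable K x y"
  obtains l \<gamma> where "arclength_curve l \<gamma>" "inj_on \<gamma> {0..l}" "\<gamma> 0 = x" "\<gamma> l = y" "\<gamma> ` {0..l} \<subseteq> K"
proof -
  define P where "P L \<gamma> \<longleftrightarrow> 0 \<le> L \<and> 1-lipschitz_on {0..L} \<gamma> \<and> \<gamma> 0 = x \<and> \<gamma> L = y \<and> \<gamma> ` {0..L} \<subseteq> K"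
    for L :: real and \<gamma>
  define S where "S = {L. \<exists>\<gamma>. P L \<gamma>}"
  define l where "l = Inf S"
  obtain L0 \<gamma>0 where "0 \<le> (L0::real)" "1-lipschitz_on {0..L0} \<gamma>0" "\<gamma>0 0 = x" "\<gamma>0 L0 = y" "\<gamma>0 ` {0..L0} \<subseteq> K"
    using assms(2) by (rule joinableE)
  then have "P L0 \<gamma>0" by (simp add: P_def)
  then have ne: "S \<noteq> {}" unfolding S_def by blast
  have bdd: "bdd_below S" by (intro bdd_belowI[of _ 0]) (auto simp: S_def P_def)
  have "0 \<le> l" unfolding l_def using ne by (intro cInf_greatest) (auto simp: S_def P_def)
  have min: "l \<le> L" if "P L \<gamma>" for L \<gamma>
    unfolding l_def using bdd that by (intro cInf_lower) (auto simp: S_def)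
  \<comment> \<open>The infimum is attained: a path defined on an interval shorter than
    \<open>l + \<eta>\<close> is cut off at \<open>l\<close>, where it is already within
    \<open>\<eta>\<close> of \<open>y\<close>.\<close>
  obtain \<gamma> where g: "1-lipschitz_on {0..l} \<gamma>" "\<gamma> 0 = x" "\<gamma> l = y" "\<gamma> ` {0..l} \<subseteq> K"
  proof (rule lipschitz_path_limit[OF K \<open>0 \<le> l\<close>])
    fix \<eta> :: real assume "0 < \<eta>"
    then obtain L where "L \<in> S" "L < l + \<eta>"
      using cInf_lessD[OF ne, of "l + \<eta>"] by (auto simp: l_def)
    then obtain c where c: "P L c" by (auto simp: S_def)
    have "l \<le> L" using min c by blast
    have lip: "1-lipschitz_on {0..L} c" and cK: "c ` {0..L} \<subseteq> K" using c by (auto simp: P_def)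
    have "c ` {0..l} \<subseteq> K" using cK \<open>l \<le> L\<close> by (auto simp: image_subset_iff)
    moreover have "dist (c l) y \<le> \<eta>"
      using lipschitz_onD[OF lip, of l L] \<open>l \<le> L\<close> \<open>L < l + \<eta>\<close> \<open>0 \<le> l\<close> c by (auto simp: P_def dist_real_def)
    moreover have "dist (c s) (c t) \<le> \<bar>s - t\<bar> + \<eta>" if "s \<in> {0..l}" "t \<in> {0..l}" for s t
      using lipschitz_onD[OF lip, of s t] \<open>l \<le> L\<close> \<open>0 < \<eta>\<close> that by (auto simp: dist_real_def)
    moreover have "dist (c 0) x \<le> \<eta>" using c \<open>0 < \<eta>\<close> by (auto simp: P_def)
    ultimately show "\<exists>c. c ` {0..l} \<subseteq> K \<and> dist (c 0) x \<le> \<eta> \<and> dist (c l) y \<le> \<eta> \<and>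
        (\<forall>s\<in>{0..l}. \<forall>t\<in>{0..l}. dist (c s) (c t) \<le> \<bar>s - t\<bar> + \<eta>)" by blast
  qed
  have inj: False if st: "0 \<le> s" "s < t" "t \<le> l" and eq: "\<gamma> s = \<gamma> t" for s t
  proof -
    define h where "h r = (if r \<le> s then \<gamma> r else \<gamma> (r + (t - s)))" for r
    have h: "dist (h p) (h q) \<le> q - p" if "0 \<le> p" "p \<le> q" "q \<le> l - (t - s)" for p q
    proof -
      consider "q \<le> s" | "p \<le> s" "s < q" | "s < p" by linarith
      then show ?thesis
      proof cases
        case 1 then show ?thesis using lipschitz_onD[OF g(1), of p q] that st
          by (simp add: h_def dist_real_def)
      next
        case 2
        then have "dist (\<gamma> p) (\<gamma> s) \<le> s - p" "dist (\<gamma> t) (\<gamma> (q + (t - s))) \<le> q - s"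
          using lipschitz_onD[OF g(1), of p s] lipschitz_onD[OF g(1), of t "q + (t - s)"] that st
          by (auto simp: dist_real_def)
        then show ?thesis
          using dist_triangle[of "\<gamma> p" "\<gamma> (q + (t - s))" "\<gamma> s"] eq 2 by (simp add: h_def)
      next
        case 3 then show ?thesis using lipschitz_onD[OF g(1), of "p + (t-s)" "q + (t-s)"] that st
          by (simp add: h_def dist_real_def)
      qed
    qed
    have "1-lipschitz_on {0..l - (t - s)} h"
    proof (rule lipschitz_onI)
      fix p q assume "p \<in> {0..l - (t - s)}" "q \<in> {0..l - (t - s)}"
      then show "dist (h p) (h q) \<le> 1 * dist p q"
        using h[of p q] h[of q p] by (cases "p \<le> q") (auto simp: dist_commute dist_real_def)
    qed simp
    moreover have "h 0 = x" using st g by (simp add: h_def)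
    moreover have "h (l - (t - s)) = y"
      using st g eq by (cases "t = l") (auto simp: h_def)
    moreover have "h ` {0..l - (t - s)} \<subseteq> K"
      using g(4) st by (auto simp: h_def image_subset_iff)
    ultimately have "P (l - (t - s)) h" using st by (auto simp: P_def)
    then show False using min st by fastforce
  qed
  define \<sigma> where "\<sigma> t = enn2real (curve_length \<gamma> 0 t)" for t
  have le: "curve_length \<gamma> s t \<le> ennreal (t - s)" if "0 \<le> s" "s \<le> t" "t \<le> l" for s t
    using that lipschitz_on_subset[OF g(1), of "{s..t}"] by (intro curve_length_le_lipschitz) auto
  have fin: "curve_length \<gamma> s t = ennreal (enn2real (curve_length \<gamma> s t))" if "0 \<le> s" "s \<le> t" "t \<le> l" for s t
    using le[OF that] by (metis ennreal_enn2real ennreal_less_top order_le_less_trans)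
  have add: "\<sigma> t = \<sigma> s + enn2real (curve_length \<gamma> s t)" if "0 \<le> s" "s \<le> t" "t \<le> l" for s t
  proof -
    have "ennreal (\<sigma> t) = ennreal (\<sigma> s) + ennreal (enn2real (curve_length \<gamma> s t))"
      using fin[of 0 s] fin[of s t] fin[of 0 t] that curve_length_add[of 0 s t \<gamma>] by (simp add: \<sigma>_def)
    then show ?thesis by (simp add: \<sigma>_def ennreal_plus[symmetric] del: ennreal_plus)
  qed
  have len: "enn2real (curve_length \<gamma> s t) \<le> t - s" if "0 \<le> s" "s \<le> t" "t \<le> l" for s t
    using enn2real_mono[OF le[OF that]] that by simp
  have dist_le: "dist (\<gamma> s) (\<gamma> t) \<le> \<sigma> t - \<sigma> s" if "0 \<le> s" "s \<le> t" "t \<le> l" for s t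
  proof -
    have "ennreal (dist (\<gamma> s) (\<gamma> t)) \<le> ennreal (enn2real (curve_length \<gamma> s t))"
      using dist_le_curve_length[of s t \<gamma>] that fin[OF that] by simp
    then show ?thesis using add[OF that] by simp
  qed
  have \<sigma>0: "\<sigma> 0 = 0" using len[of 0 0] \<open>0 \<le> l\<close> by (simp add: \<sigma>_def antisym)
  have cont: "continuous_on {0..l} \<sigma>"
  proof (rule lipschitz_on_continuous_on)
    show "1-lipschitz_on {0..l} \<sigma>"
    proof (rule lipschitz_onI)
      fix s t assume "s \<in> {0..l}" "t \<in> {0..l}"
      then show "dist (\<sigma> s) (\<sigma> t) \<le> 1 * dist s t"
        using add[of s t] add[of t s] len[of s t] len[of t s]
        by (cases "s \<le> t") (auto simp: dist_real_def)
    qed simp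
  qed
  \<comment> \<open>\<open>\<iota>\<close> will be an arbitrary right inverse of
    \<open>\<sigma>\<close>. The reparametrized path is 1-Lipschitz whatever the choice, because
    distances along \<open>\<gamma>\<close> are bounded by differences of
    \<open>\<sigma>\<close>.\<close>
  have "\<exists>t. t \<in> {0..l} \<and> \<sigma> t = s" if "s \<in> {0..\<sigma> l}" for s
    using IVT'[of \<sigma> 0 s l] cont \<sigma>0 that \<open>0 \<le> l\<close> by auto
  then obtain \<iota> where \<iota>: "\<And>s. s \<in> {0..\<sigma> l} \<Longrightarrow> \<iota> s \<in> {0..l}" "\<And>s. s \<in> {0..\<sigma> l} \<Longrightarrow> \<sigma> (\<iota> s) = s"
    by metis
  have dist_eq: "\<gamma> s = \<gamma> t" if "s \<in> {0..l}" "t \<in> {0..l}" "\<sigma> s = \<sigma> t" for s t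
  proof (cases "s \<le> t")
    case True
    then have "dist (\<gamma> s) (\<gamma> t) \<le> 0" using dist_le[of s t] that by simp
    then show ?thesis by simp
  next
    case False
    then have "dist (\<gamma> t) (\<gamma> s) \<le> 0" using dist_le[of t s] that by simp
    then show ?thesis by simp
  qed
  have "0 \<le> \<sigma> l" by (simp add: \<sigma>_def)
  have "P (\<sigma> l) (\<gamma> \<circ> \<iota>)"
    unfolding P_def
  proof (intro conjI)
    show "1-lipschitz_on {0..\<sigma> l} (\<gamma> \<circ> \<iota>)"
    proof (rule lipschitz_onI)
      fix s t assume "s \<in> {0..\<sigma> l}" "t \<in> {0..\<sigma> l}"
      then show "dist ((\<gamma> \<circ> \<iota>) s) ((\<gamma> \<circ> \<iota>) t) \<le> 1 * dist s t"
        using dist_le[of "\<iota> s" "\<iota> t"] dist_le[of "\<iota> t" "\<iota> s"] \<iota>[of s] \<iota>[of t]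
        by (cases "\<iota> s \<le> \<iota> t") (auto simp: dist_real_def dist_commute)
    qed simp
    show "(\<gamma> \<circ> \<iota>) 0 = x"
      using dist_eq[of "\<iota> 0" 0] \<iota>[of 0] \<sigma>0 g(2) \<open>0 \<le> l\<close> \<open>0 \<le> \<sigma> l\<close> by simp
    show "(\<gamma> \<circ> \<iota>) (\<sigma> l) = y"
      using dist_eq[of "\<iota> (\<sigma> l)" l] \<iota>[of "\<sigma> l"] g(3) \<open>0 \<le> l\<close> \<open>0 \<le> \<sigma> l\<close> by simp
    show "(\<gamma> \<circ> \<iota>) ` {0..\<sigma> l} \<subseteq> K" using \<iota>(1) g(4) by (auto simp: image_subset_iff)
  qed fact
  then have "l \<le> \<sigma> l" by (rule min)
  have "arclength_curve l \<gamma>"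
    unfolding arclength_curve_def
  proof (intro conjI allI impI)
    show "continuous_on {0..l} \<gamma>" using g(1) by (rule lipschitz_on_continuous_on)
    fix s t assume st: "0 \<le> s \<and> s \<le> t \<and> t \<le> l"
    \<comment> \<open>The lengths of the pieces before \<open>s\<close>, from \<open>s\<close> to
      \<open>t\<close> and after \<open>t\<close> are at most the parameter differences and add up
      to at least \<open>l\<close>, so each bound is attained.\<close>
    have "enn2real (curve_length \<gamma> s t) = t - s"
      using add[of s t] add[of t l] len[of 0 s] len[of s t] len[of t l] st \<open>l \<le> \<sigma> l\<close>
      by (simp add: \<sigma>_def)
    then show "curve_length \<gamma> s t = ennreal (t - s)" using fin[of s t] st by simp
  qed fact
  moreover have "inj_on \<gamma> {0..l}"
    by (rule linorder_inj_onI) (use inj in auto)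
  ultimately show ?thesis using g that by blast
qed

text \<open>The image of the given path serves as the compact set, so \<open>U\<close> may be
  arbitrary.\<close>

lemma joinable_arclength_curve':
  assumes "joinable U x y"
  obtains l \<gamma> where "arclength_curve l \<gamma>" "inj_on \<gamma> {0..l}" "\<gamma> 0 = x" "\<gamma> l = y" "\<gamma> ` {0..l} \<subseteq> U"
proof -
  obtain L \<gamma> where g: "(L::real) \<ge> 0" "1-lipschitz_on {0..L} \<gamma>" "\<gamma> 0 = x" "\<gamma> L = y" "\<gamma> ` {0..L} \<subseteq> U"
    using assms(1) by (rule joinableE)
  have "compact (\<gamma> ` {0..L})"
    using lipschitz_on_continuous_on[OF g(2)] by (intro compact_continuous_image) auto
  moreover have "joinable (\<gamma> ` {0..L}) x y"
    using g by (intro joinableI[of L \<gamma>]) auto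
  ultimately obtain l \<eta> where "arclength_curve l \<eta>" "inj_on \<eta> {0..l}" "\<eta> 0 = x" "\<eta> l = y" "\<eta> ` {0..l} \<subseteq> \<gamma> ` {0..L}"
    by (rule joinable_arclength_curve)
  then show ?thesis using g(5) by (intro that[of l \<eta>]) auto
qed

section \<open>The area formula for injective curves\<close>

lemma diameter_le_dist:
  fixes S :: "'a::metric_space set"
  assumes "\<And>x y. x \<in> S \<Longrightarrow> y \<in> S \<Longrightarrow> dist x y \<le> d" "0 \<le> d"
  shows "diameter S \<le> d"
proof (cases "S = {}")
  case False
  then show ?thesis
    unfolding diameter_def using assms by (auto intro!: cSUP_least)
qed (use assms in simp)

text \<open>Cut the interval into equal pieces no longer than \<open>\<delta>\<close>; the diameters
  of their images add up to at most \<open>b - a\<close>.\<close>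

lemma hausdorff1_outer_lipschitz_image_le:
  fixes \<gamma> :: "real \<Rightarrow> 'a::metric_space"
  assumes lip: "1-lipschitz_on {a..b} \<gamma>" and "a \<le> b"
  shows "hausdorff1_outer (\<gamma> ` {a..b}) \<le> ennreal (b - a)"
  unfolding hausdorff1_outer_def
proof (rule SUP_least)
  fix \<delta> :: real assume "\<delta> \<in> {0<..}"
  then obtain m where m: "b - a < real m * \<delta>" using reals_Archimedean3[of \<delta>] by auto
  define n where "n = Suc m"
  define h where "h = (b - a) / real n"
  have n: "0 < real n" by (simp add: n_def)
  have "b - a \<le> real n * \<delta>" using m \<open>\<delta> \<in> {0<..}\<close> by (simp add: n_def algebra_simps)
  then have h: "0 \<le> h" "h \<le> \<delta>" using n \<open>a \<le> b\<close> by (auto simp: h_def field_simps)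
  have nh: "real n * h = b - a" using n by (simp add: h_def)
  define E where "E i = (if i < n then \<gamma> ` ({a..b} \<inter> {a + real i * h..a + (real i + 1) * h}) else {})" for i
  have dist: "dist x y \<le> h" if xy: "x \<in> E i" "y \<in> E i" for x y i
  proof -
    obtain s t where st: "s \<in> {a..b} \<inter> {a + real i * h..a + (real i + 1) * h}"
      "t \<in> {a..b} \<inter> {a + real i * h..a + (real i + 1) * h}" "x = \<gamma> s" "y = \<gamma> t"
    proof -
      have "x \<in> \<gamma> ` ({a..b} \<inter> {a + real i * h..a + (real i + 1) * h})"
        "y \<in> \<gamma> ` ({a..b} \<inter> {a + real i * h..a + (real i + 1) * h})"
        using xy by (simp_all add: E_def split: if_splits)
      then show ?thesis by (elim imageE) (rule that)
    qed
    then have "dist x y \<le> dist s t" using lipschitz_onD[OF lip, of s t] by auto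
    also have "\<dots> \<le> h" using st by (auto simp: dist_real_def algebra_simps)
    finally show ?thesis .
  qed
  have diam: "diameter (E i) \<le> h" for i
    using dist h by (intro diameter_le_dist) auto
  have bdd: "bounded (E i)" for i
    unfolding bounded_two_points using dist by blast
  have "\<gamma> ` {a..b} \<subseteq> (\<Union>i. E i)"
  proof
    fix x assume "x \<in> \<gamma> ` {a..b}"
    then obtain s where s: "s \<in> {a..b}" "x = \<gamma> s" by auto
    have "\<exists>i<n. s \<in> {a + real i * h..a + (real i + 1) * h}"
    proof (cases "s = b")
      case True
      then show ?thesis using nh h by (intro exI[of _ m]) (auto simp: n_def algebra_simps)
    next
      case False
      then have "0 < h" using s n by (auto simp: h_def)
      define i where "i = nat \<lfloor>(s - a) / h\<rfloor>"
      have i: "real i \<le> (s - a) / h" "(s - a) / h < real i + 1"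
        using s \<open>0 < h\<close> by (auto simp: i_def)
      then have *: "real i * h \<le> s - a" "s - a < (real i + 1) * h"
        using \<open>0 < h\<close> by (auto simp: field_simps)
      have "real i * h < real n * h" using * nh s False by auto
      then have "i < n" using \<open>0 < h\<close> by simp
      then show ?thesis using * by (intro exI[of _ i]) auto
    qed
    then show "x \<in> (\<Union>i. E i)" using s by (auto simp: E_def)
  qed
  then have "hausdorff1_pre \<delta> (\<gamma> ` {a..b}) \<le> (\<Sum>i. ennreal (diameter (E i)))"
    unfolding hausdorff1_pre_def using diam bdd h(2)
    by (intro INF_lower) (auto intro: order_trans)
  also have "\<dots> = (\<Sum>i<n. ennreal (diameter (E i)))"
    by (rule suminf_finite) (auto simp: E_def)
  also have "\<dots> \<le> (\<Sum>i<n. ennreal h)"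
    using diam by (intro sum_mono ennreal_leI)
  also have "\<dots> = ennreal (b - a)"
    using h nh by (simp add: ennreal_of_nat_eq_real_of_nat ennreal_mult[symmetric])
  finally show "hausdorff1_pre \<delta> (\<gamma> ` {a..b}) \<le> ennreal (b - a)" .
qed

text \<open>Half-open intervals make consecutive arcs disjoint, so that their measures can be added.
  For \<open>a < b\<close> the image is a compact set minus one point.\<close>

lemma inj_image_Ico_borel:
  fixes \<gamma> :: "real \<Rightarrow> 'a::metric_space"
  assumes "continuous_on {a..b} \<gamma>" "inj_on \<gamma> {a..b}"
  shows "\<gamma> ` {a..<b} \<in> sets borel"
proof (cases "a < b")
  case True
  have "\<gamma> ` {a..<b} = \<gamma> ` {a..b} - {\<gamma> b}"
  proof -
    have "{a..<b} = {a..b} - {b}" by auto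
    then show ?thesis using inj_on_image_set_diff[OF assms(2), of "{a..b}" "{b}"] True by simp
  qed
  moreover have "compact (\<gamma> ` {a..b})" using assms(1) by (rule compact_continuous_image) simp
  then have "closed (\<gamma> ` {a..b})" by (rule compact_imp_closed)
  ultimately show ?thesis by simp
qed simp

text \<open>The distance from the initial point of an arc is 1-Lipschitz and attains every value
  below the distance of the end points, so the arc has at least that measure. By injectivity the
  arcs of a partition are disjoint.\<close>

lemma curve_length_le_hausdorff1:
  fixes \<gamma> :: "real \<Rightarrow> 'a::metric_space"
  assumes cont: "continuous_on {a..b} \<gamma>" and inj: "inj_on \<gamma> {a..b}" and "a \<le> b"
  shows "curve_length \<gamma> a b \<le> hausdorff1_outer (\<gamma> ` {a..<b})"
proof -
  have one: "ennreal (dist (\<gamma> c) (\<gamma> d)) \<le> hausdorff1_outer (\<gamma> ` {c..<d})" if cd: "a \<le> c" "c \<le> d" "d \<le> b" for c d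
  proof -
    have "{0..<dist (\<gamma> c) (\<gamma> d)} \<subseteq> dist (\<gamma> c) ` \<gamma> ` {c..<d}"
    proof
      fix s assume s: "s \<in> {0..<dist (\<gamma> c) (\<gamma> d)}"
      have "continuous_on {c..d} (\<lambda>t. dist (\<gamma> c) (\<gamma> t))"
        using continuous_on_subset[OF cont, of "{c..d}"] cd by (intro continuous_intros) auto
      then obtain t where t: "c \<le> t" "t \<le> d" "dist (\<gamma> c) (\<gamma> t) = s"
        using IVT'[of "\<lambda>t. dist (\<gamma> c) (\<gamma> t)" c s d] s cd by auto
      then have "t \<noteq> d" using s by auto
      then show "s \<in> dist (\<gamma> c) ` \<gamma> ` {c..<d}" using t by auto
    qed
    then have "emeasure lborel {0..<dist (\<gamma> c) (\<gamma> d)} \<le> hausdorff1_outer (\<gamma> ` {c..<d})"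
    proof (rule lborel_le_hausdorff1_outer[rotated])
      show "dist (\<gamma> c) x - dist (\<gamma> c) y \<le> dist x y" for x y
        using dist_triangle[of "\<gamma> c" x y] by (simp add: dist_commute)
    qed simp
    then show ?thesis by simp
  qed
  show ?thesis
    unfolding curve_length_def
  proof (rule SUP_least, clarify)
    fix n :: nat and t :: "nat \<Rightarrow> real"
    assume t: "\<forall>i\<le>n. t i \<in> {a..b}" "mono_on {..n} t"
    have mono: "t i \<le> t j" if "i \<le> j" "j \<le> n" for i j
      using t(2) that by (auto simp: mono_on_def)
    have range: "a \<le> t i" "t i \<le> b" if "i \<le> n" for i using t(1) that by auto
    have sets: "\<gamma> ` {t i..<t (Suc i)} \<in> sets borel" if "i < n" for i
      using range[of i] range[of "Suc i"] that
      by (intro inj_image_Ico_borel continuous_on_subset[OF cont] inj_on_subset[OF inj]) auto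
    have "(\<Sum>i<n. ennreal (dist (\<gamma> (t i)) (\<gamma> (t (Suc i))))) \<le> (\<Sum>i<n. hausdorff1_outer (\<gamma> ` {t i..<t (Suc i)}))"
      using mono range by (intro sum_mono one) auto
    also have "\<dots> = (\<Sum>i<n. emeasure hausdorff1 (\<gamma> ` {t i..<t (Suc i)}))"
      using sets by (intro sum.cong emeasure_hausdorff1[symmetric] borel_in_sets_hausdorff1) auto
    also have "\<dots> = emeasure hausdorff1 (\<Union>i<n. \<gamma> ` {t i..<t (Suc i)})"
    proof (rule sum_emeasure)
      show "disjoint_family_on (\<lambda>i. \<gamma> ` {t i..<t (Suc i)}) {..<n}"
        unfolding disjoint_family_on_def
      proof (intro ballI impI)
        fix i j assume ij: "i \<in> {..<n}" "j \<in> {..<n}" "i \<noteq> j"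
        have "{t i..<t (Suc i)} \<inter> {t j..<t (Suc j)} = {}"
          using mono[of "Suc i" j] mono[of "Suc j" i] ij by (cases "i < j") force+
        moreover have "{t i..<t (Suc i)} \<subseteq> {a..b}" "{t j..<t (Suc j)} \<subseteq> {a..b}"
          using range[of i] range[of "Suc i"] range[of j] range[of "Suc j"] ij by auto
        ultimately show "\<gamma> ` {t i..<t (Suc i)} \<inter> \<gamma> ` {t j..<t (Suc j)} = {}"
          using inj_on_image_Int[OF inj] by (metis image_empty)
      qed
    qed (use sets borel_in_sets_hausdorff1 in auto)
    also have "\<dots> = hausdorff1_outer (\<Union>i<n. \<gamma> ` {t i..<t (Suc i)})"
      using sets by (intro emeasure_hausdorff1 borel_in_sets_hausdorff1) auto
    also have "\<dots> \<le> hausdorff1_outer (\<gamma> ` {a..<b})"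
    proof (rule hausdorff1_outer_mono)
      show "(\<Union>i<n. \<gamma> ` {t i..<t (Suc i)}) \<subseteq> \<gamma> ` {a..<b}"
      proof (rule UN_least)
        fix i assume "i \<in> {..<n}"
        then show "\<gamma> ` {t i..<t (Suc i)} \<subseteq> \<gamma> ` {a..<b}"
          using range[of i] range[of "Suc i"] by (intro image_mono) auto
      qed
    qed
    finally show "(\<Sum>i<n. ennreal (dist (\<gamma> (t i)) (\<gamma> (t (Suc i))))) \<le> hausdorff1_outer (\<gamma> ` {a..<b})" .
  qed
qed

text \<open>Length bounds the measure from below by disjoint arcs and from above by covers. The
  half-open image is what a half-line cuts out in the area formula.\<close>

lemma hausdorff1_arclength_image:
  assumes "arclength_curve l \<gamma>" "inj_on \<gamma> {0..l}" "0 \<le> s" "s \<le> l"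
  shows "hausdorff1_outer (\<gamma> ` {s<..l}) = ennreal (l - s)" "hausdorff1_outer (\<gamma> ` {s..l}) = ennreal (l - s)"
proof -
  have lip: "1-lipschitz_on {s..l} \<gamma>"
    using assms(3) by (intro lipschitz_on_subset[OF arclength_curve_lipschitz[OF assms(1)]]) auto
  have "curve_length \<gamma> s l = ennreal (l - s)"
    using assms unfolding arclength_curve_def by blast
  moreover have "curve_length \<gamma> s l \<le> hausdorff1_outer (\<gamma> ` {s..<l})"
    using assms by (intro curve_length_le_hausdorff1 lipschitz_on_continuous_on[OF lip] inj_on_subset[OF assms(2)]) auto
  moreover have "hausdorff1_outer (\<gamma> ` {s..<l}) \<le> hausdorff1_outer (\<gamma> ` {s..l})"
    by (intro hausdorff1_outer_mono image_mono) auto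
  moreover have "hausdorff1_outer (\<gamma> ` {s..l}) \<le> hausdorff1_outer (\<gamma> ` {s<..l})"
  proof -
    have "{s..l} \<subseteq> {s<..l} \<union> {s}" by auto
    then have "\<gamma> ` {s..l} \<subseteq> \<gamma> ` {s<..l} \<union> {\<gamma> s}" by blast
    then have "hausdorff1_outer (\<gamma> ` {s..l}) \<le> hausdorff1_outer (\<gamma> ` {s<..l} \<union> {\<gamma> s})"
      by (rule hausdorff1_outer_mono)
    also have "\<dots> \<le> hausdorff1_outer (\<gamma> ` {s<..l}) + hausdorff1_outer {\<gamma> s}"
      by (rule hausdorff1_outer_Un)
    finally show ?thesis by (simp add: hausdorff1_outer_countable)
  qed
  moreover have "hausdorff1_outer (\<gamma> ` {s<..l}) \<le> hausdorff1_outer (\<gamma> ` {s..l})"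
    by (intro hausdorff1_outer_mono image_mono) auto
  moreover have "hausdorff1_outer (\<gamma> ` {s..l}) \<le> ennreal (l - s)"
    using hausdorff1_outer_lipschitz_image_le[OF lip] assms by auto
  ultimately show "hausdorff1_outer (\<gamma> ` {s<..l}) = ennreal (l - s)" "hausdorff1_outer (\<gamma> ` {s..l}) = ennreal (l - s)"
    by auto
qed

lemma arclength_area_formula:
  fixes \<gamma> :: "real \<Rightarrow> 'a::metric_space"
  assumes arc: "arclength_curve l \<gamma>" and inj: "inj_on \<gamma> {0..l}" and g: "g \<in> borel_measurable borel"
  shows "(\<integral>\<^sup>+ s\<in>{0..l}. g (\<gamma> s) \<partial>lborel) = (\<integral>\<^sup>+ x\<in>\<gamma> ` {0..l}. g x \<partial>hausdorff1)"
proof -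
  define K where "K = \<gamma> ` {0..l}"
  define h where "h = inv_into {0..l} \<gamma>"
  have "0 \<le> l" and cont: "continuous_on {0..l} \<gamma>"
    using arc by (auto simp: arclength_curve_def)
  have hg: "h (\<gamma> s) = s" if "s \<in> {0..l}" for s
    unfolding h_def using inj that by (rule inv_into_f_f)
  have "compact K" unfolding K_def using cont by (rule compact_continuous_image) simp
  then have K: "K \<in> sets borel" "K \<in> sets hausdorff1"
    by (simp_all add: compact_imp_closed borel_in_sets_hausdorff1 borel_closed)
  have "continuous_on K h"
    unfolding K_def using cont hg by (intro continuous_on_inv) auto
  then have "h \<in> measurable (restrict_space borel K) borel"
    by (rule borel_measurable_continuous_on_restrict)
  then have h: "h \<in> measurable (restrict_space hausdorff1 K) borel"
  proof (rule measurable_mono[THEN subsetD, rotated -1])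
    show "sets (restrict_space borel K) \<subseteq> sets (restrict_space hausdorff1 K)"
      unfolding sets_restrict_space using borel_in_sets_hausdorff1 by blast
  qed (auto simp: space_restrict_space)
  define M where "M = density lborel (indicator {0..l} :: real \<Rightarrow> ennreal)"
  define N where "N = distr (restrict_space hausdorff1 K) borel h"
  \<comment> \<open>Lebesgue measure on the parameter interval is the image of the measure on the
    curve under the inverse of \<open>\<gamma>\<close>: both are finite on half-lines and agree
    there.\<close>
  have "M = N"
  proof (rule measure_eqI_lessThan)
    show "sets M = sets borel" "sets N = sets borel" by (auto simp: M_def N_def)
    fix x :: real
    have M: "emeasure M {x<..} = emeasure lborel ({0..l} \<inter> {x<..})"
      unfolding M_def by (subst emeasure_density) (auto simp: nn_integral_indicator' indicator_inter_arith[symmetric])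
    have "emeasure lborel ({0..l} \<inter> {x<..}) \<le> emeasure lborel {0..l}"
      by (intro emeasure_mono) auto
    then show "emeasure M {x<..} < \<infinity>"
      unfolding M by (rule order.strict_trans1) (use \<open>0 \<le> l\<close> in simp)
    have "emeasure N {x<..} = emeasure (restrict_space hausdorff1 K) (h -` {x<..} \<inter> K)"
      unfolding N_def using h by (subst emeasure_distr) (auto simp: space_restrict_space)
    also have "\<dots> = emeasure hausdorff1 (h -` {x<..} \<inter> K)"
      using K by (intro emeasure_restrict_space) auto
    also have "h -` {x<..} \<inter> K = \<gamma> ` ({0..l} \<inter> {x<..})"
      using hg by (auto simp: K_def)
    also have "emeasure hausdorff1 \<dots> = hausdorff1_outer \<dots>"
    proof (rule emeasure_hausdorff1)
      have "h -` {x<..} \<inter> space (restrict_space hausdorff1 K) \<in> sets (restrict_space hausdorff1 K)"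
        using h by (rule measurable_sets) simp
      then have "h -` {x<..} \<inter> K \<in> sets hausdorff1"
        using K by (auto simp: space_restrict_space sets_restrict_space_iff)
      moreover have "h -` {x<..} \<inter> K = \<gamma> ` ({0..l} \<inter> {x<..})" using hg by (auto simp: K_def)
      ultimately show "\<gamma> ` ({0..l} \<inter> {x<..}) \<in> sets hausdorff1" by simp
    qed
    also have "\<dots> = emeasure lborel ({0..l} \<inter> {x<..})"
    proof -
      consider "x < 0" | "0 \<le> x" "x \<le> l" | "l < x" by linarith
      then show ?thesis
      proof cases
        case 1
        then have "{0..l} \<inter> {x<..} = {0..l}" by auto
        then show ?thesis using hausdorff1_arclength_image(2)[OF arc inj, of 0] \<open>0 \<le> l\<close> by simp
      next
        case 2
        then have "{0..l} \<inter> {x<..} = {x<..l}" by auto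
        then show ?thesis using hausdorff1_arclength_image(1)[OF arc inj 2] 2 by simp
      next
        case 3
        then have "{0..l} \<inter> {x<..} = {}" by auto
        then show ?thesis by simp
      qed
    qed
    finally show "emeasure M {x<..} = emeasure N {x<..}" using M by simp
  qed
  \<comment> \<open>A continuous extension of \<open>\<gamma>\<close> to the whole line, so that
    \<open>g\<close> composed with it is Borel.\<close>
  define c where "c s = \<gamma> (max 0 (min l s))" for s
  have "continuous_on UNIV c"
    unfolding c_def using \<open>0 \<le> l\<close>
    by (intro continuous_on_compose2[OF cont] continuous_intros) auto
  then have c: "c \<in> borel_measurable borel" by (rule borel_measurable_continuous_onI)
  have gc: "(\<lambda>s. g (c s)) \<in> borel_measurable borel" using c g by simp
  have "(\<integral>\<^sup>+ s\<in>{0..l}. g (\<gamma> s) \<partial>lborel) = (\<integral>\<^sup>+ s. indicator {0..l} s * g (c s) \<partial>lborel)"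
    by (rule nn_integral_cong) (auto simp: c_def indicator_def)
  also have "\<dots> = (\<integral>\<^sup>+ s. g (c s) \<partial>M)"
    unfolding M_def using gc by (subst nn_integral_density) auto
  also have "\<dots> = (\<integral>\<^sup>+ x. g (c (h x)) \<partial>restrict_space hausdorff1 K)"
    unfolding \<open>M = N\<close> N_def using h gc by (subst nn_integral_distr) auto
  also have "\<dots> = (\<integral>\<^sup>+ x. g (c (h x)) * indicator K x \<partial>hausdorff1)"
    using K by (subst nn_integral_restrict_space) auto
  also have "\<dots> = (\<integral>\<^sup>+ x. g x * indicator K x \<partial>hausdorff1)"
    using hg by (intro nn_integral_cong) (auto simp: K_def c_def indicator_def)
  finally show ?thesis by (simp add: K_def)
qed

section \<open>Lower semicontinuity of the pointwise variation\<close>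

lemma ennreal_le_iff_enn2ereal: "ereal a \<le> enn2ereal I \<Longrightarrow> ennreal a \<le> I"
  by (metis e2ennreal_ereal e2ennreal_mono e2ennreal_enn2ereal)

lemma upper_gradient_pV_le:
  fixes u :: "'a::metric_space \<Rightarrow> real"
  assumes ug: "upper_gradient g (\<lambda>x. ereal (u x))"
  shows "pV u \<le> (\<integral>\<^sup>+ x. g x \<partial>hausdorff1)"
  unfolding pV_def
proof (rule SUP_least, clarify)
  fix n :: nat and l :: "nat \<Rightarrow> real" and \<gamma> :: "nat \<Rightarrow> real \<Rightarrow> 'a"
  assume arc: "\<forall>j<n. arclength_curve (l j) (\<gamma> j) \<and> inj_on (\<gamma> j) {0..l j}"
    and disj: "disjoint_family_on (\<lambda>j. \<gamma> j ` {0..l j}) {..<n}"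
  have g: "g \<in> borel_measurable borel" using ug by (simp add: upper_gradient_def)
  then have gH: "g \<in> borel_measurable hausdorff1" by (rule measurable_hausdorff1I)
  have sets: "\<gamma> j ` {0..l j} \<in> sets hausdorff1" if "j < n" for j
    using arc that by (intro closed_in_sets_hausdorff1 compact_imp_closed compact_continuous_image)
      (auto simp: arclength_curve_def)
  have "(\<Sum>j<n. ennreal \<bar>u (\<gamma> j (l j)) - u (\<gamma> j 0)\<bar>) \<le> (\<Sum>j<n. \<integral>\<^sup>+ s\<in>{0..l j}. g (\<gamma> j s) \<partial>lborel)"
  proof (rule sum_mono)
    fix j assume "j \<in> {..<n}"
    then have "\<bar>ereal (u (\<gamma> j (l j))) - ereal (u (\<gamma> j 0))\<bar> \<le> enn2ereal (\<integral>\<^sup>+ s\<in>{0..l j}. g (\<gamma> j s) \<partial>lborel)"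
      using ug arc unfolding upper_gradient_def by blast
    then show "ennreal \<bar>u (\<gamma> j (l j)) - u (\<gamma> j 0)\<bar> \<le> (\<integral>\<^sup>+ s\<in>{0..l j}. g (\<gamma> j s) \<partial>lborel)"
      by (intro ennreal_le_iff_enn2ereal) simp
  qed
  also have "\<dots> = (\<Sum>j<n. \<integral>\<^sup>+ x\<in>\<gamma> j ` {0..l j}. g x \<partial>hausdorff1)"
    using arc by (intro sum.cong arclength_area_formula g) auto
  also have "\<dots> = (\<integral>\<^sup>+ x. (\<Sum>j<n. g x * indicator (\<gamma> j ` {0..l j}) x) \<partial>hausdorff1)"
    using sets gH by (intro nn_integral_sum[symmetric]) auto
  also have "\<dots> \<le> (\<integral>\<^sup>+ x. g x \<partial>hausdorff1)"
  proof (rule nn_integral_mono)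
    fix x
    show "(\<Sum>j<n. g x * indicator (\<gamma> j ` {0..l j}) x) \<le> g x"
    proof (cases "\<exists>j<n. x \<in> \<gamma> j ` {0..l j}")
      case True
      then obtain j where j: "j < n" "x \<in> \<gamma> j ` {0..l j}" by blast
      have "x \<notin> \<gamma> i ` {0..l i}" if "i < n" "i \<noteq> j" for i
        using disj j that unfolding disjoint_family_on_def by (metis disjoint_iff lessThan_iff)
      then have "(\<Sum>i<n. g x * indicator (\<gamma> i ` {0..l i}) x) = (\<Sum>i<n. if i = j then g x else 0)"
        using j by (intro sum.cong) (auto simp: indicator_def)
      then show ?thesis using j by simp
    next
      case False
      then have "(\<Sum>i<n. g x * indicator (\<gamma> i ` {0..l i}) x) = (\<Sum>i<n. 0)"
        by (intro sum.cong) (auto simp: indicator_def)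
      also have "\<dots> \<le> g x" by simp
      finally show ?thesis .
    qed
  qed
  finally show "(\<Sum>j<n. ennreal \<bar>u (\<gamma> j (l j)) - u (\<gamma> j 0)\<bar>) \<le> (\<integral>\<^sup>+ x. g x \<partial>hausdorff1)" .
qed

text \<open>The bridge from paths to \<open>pV\<close>: injective curves inside the disjoint sets
  \<open>E i\<close> are disjoint, so later arguments only have to exhibit joinable pairs.\<close>

lemma sum_joinable_le_pV:
  fixes v :: "'a::metric_space \<Rightarrow> real"
  assumes "finite I" and disj: "disjoint_family_on E I"
    and join: "\<And>i. i \<in> I \<Longrightarrow> joinable (E i) (y i) (z i)"
  shows "(\<Sum>i\<in>I. ennreal \<bar>v (z i) - v (y i)\<bar>) \<le> pV v"
proof -
  have "\<exists>l \<gamma>. arclength_curve l \<gamma> \<and> inj_on \<gamma> {0..l} \<and> \<gamma> 0 = y i \<and> \<gamma> l = z i \<and> \<gamma> ` {0..l} \<subseteq> E i"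
    if "i \<in> I" for i
    by (rule joinable_arclength_curve'[OF join[OF that]]) blast
  then obtain l \<gamma> where *: "\<And>i. i \<in> I \<Longrightarrow> arclength_curve (l i) (\<gamma> i) \<and> inj_on (\<gamma> i) {0..l i} \<and>
      \<gamma> i 0 = y i \<and> \<gamma> i (l i) = z i \<and> \<gamma> i ` {0..l i} \<subseteq> E i"
    by metis
  obtain f where "bij_betw f {0..<card I} I"
    using ex_bij_betw_nat_finite[OF \<open>finite I\<close>] by blast
  then have f: "bij_betw f {..<card I} I" by (simp add: lessThan_atLeast0)
  then have fI: "f j \<in> I" if "j < card I" for j
    using that by (auto simp: bij_betw_def)
  have "disjoint_family_on (\<lambda>j. \<gamma> (f j) ` {0..l (f j)}) {..<card I}"
    unfolding disjoint_family_on_def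
  proof (intro ballI impI)
    fix i j assume ij: "i \<in> {..<card I}" "j \<in> {..<card I}" "i \<noteq> j"
    then have "f i \<noteq> f j" using f by (auto simp: bij_betw_def inj_on_def)
    then have "E (f i) \<inter> E (f j) = {}" using disj fI ij by (auto simp: disjoint_family_on_def)
    then show "\<gamma> (f i) ` {0..l (f i)} \<inter> \<gamma> (f j) ` {0..l (f j)} = {}"
      using *[of "f i"] *[of "f j"] fI ij by blast
  qed
  then have mem: "(card I, l \<circ> f, \<gamma> \<circ> f) \<in> {(n, l, \<gamma>).
          (\<forall>j<n. arclength_curve (l j) (\<gamma> j) \<and> inj_on (\<gamma> j) {0..l j}) \<and>
          disjoint_family_on (\<lambda>j. \<gamma> j ` {0..l j}) {..<n}}"
    using * fI by auto
  have "(\<Sum>i\<in>I. ennreal \<bar>v (z i) - v (y i)\<bar>) = (\<Sum>j<card I. ennreal \<bar>v (z (f j)) - v (y (f j))\<bar>)"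
    using f by (rule sum.reindex_bij_betw[symmetric])
  also have "\<dots> = (\<Sum>j<card I. ennreal \<bar>v ((\<gamma> \<circ> f) j ((l \<circ> f) j)) - v ((\<gamma> \<circ> f) j 0)\<bar>)"
    using * fI by (intro sum.cong) auto
  also have "\<dots> \<le> pV v"
    unfolding pV_def by (rule SUP_upper2[OF mem]) simp
  finally show ?thesis .
qed

lemma joinable_le_pV:
  assumes "joinable U x y"
  shows "ennreal \<bar>v y - v x\<bar> \<le> pV v"
  using sum_joinable_le_pV[of "{()}" "\<lambda>_. U" "\<lambda>_. x" "\<lambda>_. y" v] assms
  by (simp add: disjoint_family_on_def)

lemma arclength_curve_joinable:
  assumes "arclength_curve l \<gamma>" "s \<in> {0..l}" "t \<in> {0..l}"
  shows "joinable (\<gamma> ` {0..l}) (\<gamma> s) (\<gamma> t)"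
proof -
  have "joinable (\<gamma> ` {0..l}) (\<gamma> 0) (\<gamma> r)" if "r \<in> {0..l}" for r
    using that lipschitz_on_subset[OF arclength_curve_lipschitz[OF assms(1)], of "{0..r}"]
    by (intro joinableI[of r \<gamma>]) auto
  from joinable_trans[OF joinable_sym[OF this[OF assms(2)]] this[OF assms(3)]] show ?thesis .
qed

text \<open>The witness is a cluster point of \<open>w\<close> in the product topology. A point where \<open>w\<close> is unbounded
  is not an end point of a nondegenerate injective curve, because such a curve has positive measure
  and therefore passes through a point of convergence.\<close>

lemma Var_le_if_pV_le_AE_tendsto:
  fixes w :: "nat \<Rightarrow> 'a::metric_space \<Rightarrow> real"
  assumes "0 \<le> L" and w: "\<And>n. pV (w n) \<le> ennreal (L + 1 / real (Suc n))"
    and AE: "AE x in hausdorff1. (\<lambda>n. w n x) \<longlonglongrightarrow> u x"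
  shows "Var u \<le> ennreal L"
proof -
  define B where "B = {x. Bseq (\<lambda>n. w n x)}"
  \<comment> \<open>Values at unbounded points are reset to 0, so that each coordinate ranges over a
    compact set.\<close>
  define w' where "w' n x = (if x \<in> B then w n x else 0)" for n x
  have "\<exists>K. compact K \<and> (\<forall>n. w' n x \<in> K)" for x
  proof (cases "x \<in> B")
    case True
    then obtain K where "\<And>n. norm (w n x) \<le> K" by (auto simp: B_def Bseq_def)
    then show ?thesis using True by (intro exI[of _ "cball 0 K"]) (auto simp: w'_def)
  qed (auto simp: w'_def intro!: exI[of _ "{0}"])
  then obtain K where K: "\<And>x. compact (K x)" "\<And>n x. w' n x \<in> K x" by metis
  obtain v where v: "\<And>I e N. finite I \<Longrightarrow> 0 < e \<Longrightarrow> \<exists>n\<ge>N. \<forall>x\<in>I. dist (w' n x) (v x) < e"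
    using pointwise_cluster_point[of K w', OF K] by metis
  have conv: "v x = u x" if "(\<lambda>n. w n x) \<longlonglongrightarrow> u x" for x
  proof -
    have "x \<in> B" using that convergent_imp_Bseq by (auto simp: B_def convergent_def)
    have "dist (v x) (u x) \<le> 0"
    proof (rule field_le_epsilon)
      fix e :: real assume "0 < e"
      then obtain N where N: "\<And>n. n \<ge> N \<Longrightarrow> dist (w n x) (u x) < e/2"
        using \<open>(\<lambda>n. w n x) \<longlonglongrightarrow> u x\<close> metric_LIMSEQ_D half_gt_zero by blast
      obtain n where "n \<ge> N" "dist (w' n x) (v x) < e/2"
        using v[of "{x}" "e/2" N] \<open>0 < e\<close> by auto
      then show "dist (v x) (u x) \<le> 0 + e"
        using N[of n] dist_triangle[of "v x" "u x" "w n x"] \<open>x \<in> B\<close> by (simp add: w'_def dist_commute)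
    qed
    then show ?thesis by simp
  qed
  have "AE x in hausdorff1. v x = u x"
    using AE by eventually_elim (rule conv)
  then have "Var u \<le> pV v"
    unfolding Var_def by (intro INF_lower) simp
  also have "\<dots> \<le> ennreal L"
    unfolding pV_def
  proof (rule SUP_least, clarify)
    fix n :: nat and l :: "nat \<Rightarrow> real" and \<gamma> :: "nat \<Rightarrow> real \<Rightarrow> 'a"
    assume arc: "\<forall>j<n. arclength_curve (l j) (\<gamma> j) \<and> inj_on (\<gamma> j) {0..l j}"
      and disj: "disjoint_family_on (\<lambda>j. \<gamma> j ` {0..l j}) {..<n}"
    have l: "0 \<le> l j" if "j < n" for j using arc that by (auto simp: arclength_curve_def)
    have inB: "\<gamma> j p \<in> B" if j: "j < n" "0 < l j" and p: "p \<in> {0..l j}" for j p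
    proof -
      have "hausdorff1_outer (\<gamma> j ` {0..l j}) = ennreal (l j)"
        using hausdorff1_arclength_image(2)[of "l j" "\<gamma> j" 0] arc j by auto
      then have "0 < hausdorff1_outer (\<gamma> j ` {0..l j})" using j by simp
      moreover have "hausdorff1_outer {x. \<not> (\<lambda>n. w n x) \<longlonglongrightarrow> u x} = 0"
        using AE by (simp add: AE_hausdorff1_iff)
      ultimately have "\<not> \<gamma> j ` {0..l j} \<subseteq> {x. \<not> (\<lambda>n. w n x) \<longlonglongrightarrow> u x}"
        using hausdorff1_outer_mono[of "\<gamma> j ` {0..l j}" "{x. \<not> (\<lambda>n. w n x) \<longlonglongrightarrow> u x}"] by auto
      then obtain s where s: "s \<in> {0..l j}" "(\<lambda>n. w n (\<gamma> j s)) \<longlonglongrightarrow> u (\<gamma> j s)" by blast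
      then have "Bseq (\<lambda>n. w n (\<gamma> j s))" using convergent_imp_Bseq by (auto simp: convergent_def)
      then obtain M where M: "\<And>n. norm (w n (\<gamma> j s)) \<le> M" by (auto simp: Bseq_def)
      \<comment> \<open>Boundedness spreads from one point of the curve to all others, as
        \<open>L + 1\<close> bounds the variation of every \<open>w n\<close>.\<close>
      have "norm (w n (\<gamma> j p)) \<le> M + (L + 1)" for n
      proof -
        have "ennreal \<bar>w n (\<gamma> j p) - w n (\<gamma> j s)\<bar> \<le> pV (w n)"
          using joinable_le_pV[OF arclength_curve_joinable[of "l j" "\<gamma> j" s p]] arc j s p by auto
        also have "\<dots> \<le> ennreal (L + 1)"
          using w[of n] by (rule order_trans) (auto intro!: ennreal_leI simp: field_simps)
        finally have "\<bar>w n (\<gamma> j p) - w n (\<gamma> j s)\<bar> \<le> L + 1"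
          using \<open>0 \<le> L\<close> by (subst (asm) ennreal_le_iff) auto
        then show ?thesis using M[of n] by (auto simp: abs_if split: if_splits)
      qed
      then have "Bseq (\<lambda>n. w n (\<gamma> j p))" by (rule BseqI')
      then show ?thesis by (simp add: B_def)
    qed
    show "(\<Sum>j<n. ennreal \<bar>v (\<gamma> j (l j)) - v (\<gamma> j 0)\<bar>) \<le> ennreal L"
    proof (rule ennreal_le_epsilon)
      fix e :: real assume "0 < e"
      \<comment> \<open>An error \<open>d\<close> at both ends of \<open>n\<close> curves totals at
        most \<open>e/2\<close>; the other half of \<open>e\<close> absorbs
        \<open>1 / real (Suc m)\<close>.\<close>
      define d where "d = e / (4 * real (Suc n))"
      have "0 < d" using \<open>0 < e\<close> by (simp add: d_def)
      obtain N where N: "1 / real (Suc N) < e/2" using nat_approx_posE[of "e/2"] \<open>0 < e\<close> by auto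
      obtain m where m: "m \<ge> N"
        "\<forall>x\<in>(\<lambda>j. \<gamma> j 0) ` {..<n} \<union> (\<lambda>j. \<gamma> j (l j)) ` {..<n}. dist (w' m x) (v x) < d"
        using v[OF _ \<open>0 < d\<close>, of "(\<lambda>j. \<gamma> j 0) ` {..<n} \<union> (\<lambda>j. \<gamma> j (l j)) ` {..<n}" N] by auto
      have "\<bar>v (\<gamma> j (l j)) - v (\<gamma> j 0)\<bar> \<le> \<bar>w m (\<gamma> j (l j)) - w m (\<gamma> j 0)\<bar> + 2 * d" if "j < n" for j
      proof (cases "l j = 0")
        case False
        then have "0 < l j" using l[OF that] by simp
        then have "\<gamma> j (l j) \<in> B" "\<gamma> j 0 \<in> B" using inB[OF that] by auto
        moreover have "dist (w' m (\<gamma> j (l j))) (v (\<gamma> j (l j))) < d" "dist (w' m (\<gamma> j 0)) (v (\<gamma> j 0)) < d"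
          using m that by auto
        ultimately show ?thesis by (auto simp: w'_def dist_real_def)
      qed (use \<open>0 < d\<close> in simp)
      then have "(\<Sum>j<n. ennreal \<bar>v (\<gamma> j (l j)) - v (\<gamma> j 0)\<bar>)
          \<le> (\<Sum>j<n. ennreal \<bar>w m (\<gamma> j (l j)) - w m (\<gamma> j 0)\<bar> + ennreal (2 * d))"
        using \<open>0 < d\<close> by (intro sum_mono) (simp add: ennreal_plus[symmetric] ennreal_leI del: ennreal_plus)
      also have "\<dots> = (\<Sum>j<n. ennreal \<bar>w m (\<gamma> j (l j)) - w m (\<gamma> j 0)\<bar>) + ennreal (real n * (2 * d))"
        using \<open>0 < d\<close> by (simp add: sum.distrib ennreal_mult ennreal_of_nat_eq_real_of_nat)
      also have "\<dots> \<le> pV (w m) + ennreal (e / 2)"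
      proof (intro add_mono ennreal_leI)
        show "(\<Sum>j<n. ennreal \<bar>w m (\<gamma> j (l j)) - w m (\<gamma> j 0)\<bar>) \<le> pV (w m)"
          unfolding pV_def using arc disj by (intro SUP_upper2[of "(n, l, \<gamma>)"]) auto
        show "real n * (2 * d) \<le> e / 2" using \<open>0 < e\<close> by (simp add: d_def field_simps)
      qed
      also have "pV (w m) \<le> ennreal (L + e / 2)"
      proof -
        have "1 / real (Suc m) \<le> 1 / real (Suc N)" using m by (intro divide_left_mono) auto
        then show ?thesis using w[of m] N by (elim order_trans) (intro ennreal_leI, linarith)
      qed
      also have "ennreal (L + e / 2) + ennreal (e / 2) = ennreal L + ennreal e"
        using \<open>0 \<le> L\<close> \<open>0 < e\<close> by (simp add: ennreal_plus[symmetric] del: ennreal_plus)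
      finally show "(\<Sum>j<n. ennreal \<bar>v (\<gamma> j (l j)) - v (\<gamma> j 0)\<bar>) \<le> ennreal L + ennreal e"
        by (simp add: add_right_mono)
    qed
  qed
  finally show ?thesis .
qed

section \<open>From local convergence in L^1 to convergence almost everywhere\<close>

lemma countable_subcover_if_dense_sequence:
  fixes d :: "nat \<Rightarrow> 'a::metric_space"
  assumes d: "\<And>x e. 0 < e \<Longrightarrow> \<exists>n. dist (d n) x < e" and r: "\<And>x::'a. 0 < r x"
  obtains c :: "nat \<Rightarrow> 'a" where "(\<Union>k. ball (c k) (r (c k))) = UNIV"
proof -
  \<comment> \<open>Lindeloef's argument: for each small ball around a point of the dense sequence
    that fits into some \<open>ball x (r x)\<close>, one such \<open>x\<close> is picked.\<close>
  define Q where "Q n m x \<longleftrightarrow> ball (d n) (1 / real (Suc m)) \<subseteq> ball x (r x)" for n m x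
  define c where "c k = (case prod_decode k of (n, m) \<Rightarrow> SOME x. Q n m x)" for k
  have "x \<in> (\<Union>k. ball (c k) (r (c k)))" for x
  proof -
    obtain m where m: "1 / real (Suc m) < r x / 2" using nat_approx_posE[of "r x / 2"] r[of x] by auto
    obtain n where n: "dist (d n) x < 1 / real (Suc m)" using d[of "1 / real (Suc m)" x] by auto
    have "Q n m x"
      unfolding Q_def
    proof
      fix y assume "y \<in> ball (d n) (1 / real (Suc m))"
      then show "y \<in> ball x (r x)"
        using m n dist_triangle[of x y "d n"] by (auto simp: dist_commute)
    qed
    then have "Q n m (SOME x. Q n m x)" by (rule someI)
    then have "Q n m (c (prod_encode (n, m)))" by (simp add: c_def)
    then have "x \<in> ball (c (prod_encode (n, m))) (r (c (prod_encode (n, m))))"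
      unfolding Q_def using n by auto
    then show ?thesis by blast
  qed
  then show ?thesis by (intro that) auto
qed

lemma Liminf_less_imp_frequently:
  fixes f :: "'i \<Rightarrow> ennreal"
  assumes "Liminf F f < c"
  shows "\<exists>\<^sub>F i in F. f i < c"
  using assms Liminf_bounded[of c f F] unfolding frequently_def not_less by (metis not_le)

lemma Var_le_total_variation:
  fixes u :: "'a::metric_space \<Rightarrow> real"
  assumes fin: "emeasure hausdorff1 (UNIV :: 'a set) < \<infinity>"
  shows "Var u \<le> total_variation u"
  unfolding total_variation_def
proof (rule INF_greatest, clarify)
  fix us :: "nat \<Rightarrow> 'a \<Rightarrow> real" and gs :: "nat \<Rightarrow> 'a \<Rightarrow> ennreal"
  assume conv: "L1loc_tendsto us u" and ug: "\<forall>i. upper_gradient (gs i) (\<lambda>x. ereal (us i x))"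
  show "Var u \<le> liminf (\<lambda>i. \<integral>\<^sup>+ x. gs i x \<partial>hausdorff1)"
  proof (cases "liminf (\<lambda>i. \<integral>\<^sup>+ x. gs i x \<partial>hausdorff1)")
    case (real L)
    obtain r where "\<forall>x. 0 < r x \<and> set_integrable hausdorff1 (ball x (r x)) u \<and>
        (\<forall>i. set_integrable hausdorff1 (ball x (r x)) (us i)) \<and>
        (\<lambda>i. LINT y:ball x (r x)|hausdorff1. \<bar>us i y - u y\<bar>) \<longlonglongrightarrow> 0"
      using choice[OF conv[unfolded L1loc_tendsto_def]] by blast
    then have r: "\<And>x. 0 < r x" "\<And>x. set_integrable hausdorff1 (ball x (r x)) u"
      "\<And>x i. set_integrable hausdorff1 (ball x (r x)) (us i)"
      "\<And>x. (\<lambda>i. LINT y:ball x (r x)|hausdorff1. \<bar>us i y - u y\<bar>) \<longlonglongrightarrow> 0"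
      by auto
    obtain d :: "nat \<Rightarrow> 'a" where d: "\<And>x e. 0 < e \<Longrightarrow> \<exists>n. dist (d n) x < e"
      using hausdorff1_finite_dense_sequence[OF fin] by blast
    obtain c where c: "(\<Union>k::nat. ball (c k) (r (c k))) = UNIV"
      using countable_subcover_if_dense_sequence[of d r, OF d r(1)] by blast
    define A where "A k = ball (c k) (r (c k))" for k
    define D where "D i k = (LINT y:A k|hausdorff1. \<bar>us i y - u y\<bar>)" for i k
    \<comment> \<open>The index chosen for \<open>n\<close> controls only the first
      \<open>n + 1\<close> balls, with an error summable in \<open>n\<close>; this lets one sequence
      serve every ball.\<close>
    have "\<exists>i. (\<integral>\<^sup>+ x. gs i x \<partial>hausdorff1) < ennreal (L + 1 / real (Suc n)) \<and> (\<forall>k\<in>{..n}. D i k < (1/2) ^ n)" for n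
    proof -
      have "\<forall>\<^sub>F i in sequentially. \<forall>k\<in>{..n}. D i k < (1/2) ^ n"
      proof (intro eventually_ball_finite ballI)
        fix k
        have "(\<lambda>i. D i k) \<longlonglongrightarrow> 0" using r(4)[of "c k"] by (simp add: D_def A_def)
        then show "\<forall>\<^sub>F i in sequentially. D i k < (1/2) ^ n"
          by (rule order_tendstoD) simp
      qed simp
      note ev = this
      have "liminf (\<lambda>i. \<integral>\<^sup>+ x. gs i x \<partial>hausdorff1) < ennreal (L + 1 / real (Suc n))"
        using real by (simp add: ennreal_less_iff)
      from frequently_eventually_conj[OF Liminf_less_imp_frequently[OF this] ev]
      show ?thesis by (auto dest: frequently_ex)
    qed
    then obtain s where s: "\<And>n. (\<integral>\<^sup>+ x. gs (s n) x \<partial>hausdorff1) < ennreal (L + 1 / real (Suc n))"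
      "\<And>n k. k \<le> n \<Longrightarrow> D (s n) k < (1/2) ^ n"
      by (metis atMost_iff)
    have "AE x in hausdorff1. x \<in> A k \<longrightarrow> (\<lambda>n. us (s n) x) \<longlonglongrightarrow> u x" for k
    proof -
      \<comment> \<open>The shift by \<open>k\<close> leaves only indices that control the ball
        \<open>A k\<close>. The integrals of the errors then have a finite sum, so the errors tend
        to 0 almost everywhere on it.\<close>
      define f where "f n y = indicator (A k) y *\<^sub>R \<bar>us (s (n + k)) y - u y\<bar>" for n y
      have int: "integrable hausdorff1 (f n)" for n
      proof -
        have "integrable hausdorff1 (\<lambda>y. indicator (A k) y *\<^sub>R us (s (n + k)) y - indicator (A k) y *\<^sub>R u y)"
          using r(2,3)[of "c k"] unfolding A_def set_integrable_def by (intro Bochner_Integration.integrable_diff) auto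
        then have "integrable hausdorff1 (\<lambda>y. \<bar>indicator (A k) y *\<^sub>R us (s (n + k)) y - indicator (A k) y *\<^sub>R u y\<bar>)"
          by (rule integrable_abs)
        also have "(\<lambda>y. \<bar>indicator (A k) y *\<^sub>R us (s (n + k)) y - indicator (A k) y *\<^sub>R u y\<bar>) = f n"
          by (auto simp: f_def indicator_def fun_eq_iff)
        finally show ?thesis .
      qed
      have meas: "(\<lambda>y. ennreal (f n y)) \<in> borel_measurable hausdorff1" for n
        using int[of n] by auto
      have "(\<integral>\<^sup>+ y. ennreal (f n y) \<partial>hausdorff1) \<le> ennreal ((1/2) ^ n)" for n
      proof -
        have "(\<integral>\<^sup>+ y. ennreal (f n y) \<partial>hausdorff1) = ennreal (D (s (n + k)) k)"
          using int[of n] unfolding D_def set_lebesgue_integral_def f_def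
          by (intro nn_integral_eq_integral) auto
        also have "\<dots> \<le> ennreal ((1/2) ^ (n + k))"
          using s(2)[of k "n + k"] by (intro ennreal_leI) auto
        also have "\<dots> \<le> ennreal ((1/2) ^ n)"
          by (intro ennreal_leI power_decreasing) auto
        finally show ?thesis .
      qed
      then have "(\<Sum>n. \<integral>\<^sup>+ y. ennreal (f n y) \<partial>hausdorff1) \<le> (\<Sum>n. ennreal ((1/2) ^ n))"
        by (intro suminf_le) auto
      also have "\<dots> = ennreal (\<Sum>n. (1/2) ^ n)"
        by (intro suminf_ennreal2) (auto intro: summable_geometric)
      finally have "(\<integral>\<^sup>+ y. (\<Sum>n. ennreal (f n y)) \<partial>hausdorff1) < \<infinity>"
        using meas by (subst nn_integral_suminf) (auto simp: order.strict_trans1)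
      then have "AE y in hausdorff1. (\<Sum>n. ennreal (f n y)) \<noteq> \<infinity>"
        using meas by (intro nn_integral_noteq_infinite) auto
      then show ?thesis
      proof eventually_elim
        case (elim y)
        have "summable (\<lambda>n. f n y)"
          using elim by (intro summable_suminf_not_top) (auto simp: f_def)
        then have lim: "(\<lambda>n. f n y) \<longlonglongrightarrow> 0" by (rule summable_LIMSEQ_zero)
        show ?case
        proof
          assume "y \<in> A k"
          then have "(\<lambda>n. \<bar>us (s (n + k)) y - u y\<bar>) \<longlonglongrightarrow> 0" using lim by (simp add: f_def)
          then have "(\<lambda>n. us (s (n + k)) y - u y) \<longlonglongrightarrow> 0" by (rule tendsto_rabs_zero_cancel)
          then have "(\<lambda>n. us (s (n + k)) y) \<longlonglongrightarrow> u y" by (simp add: LIM_zero_iff)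
          then show "(\<lambda>n. us (s n) y) \<longlonglongrightarrow> u y" by (rule LIMSEQ_offset)
        qed
      qed
    qed
    then have "AE x in hausdorff1. \<forall>k. x \<in> A k \<longrightarrow> (\<lambda>n. us (s n) x) \<longlonglongrightarrow> u x"
      unfolding AE_all_countable by blast
    then have AE: "AE x in hausdorff1. (\<lambda>n. us (s n) x) \<longlonglongrightarrow> u x"
    proof eventually_elim
      case (elim x)
      have "x \<in> (\<Union>k. A k)" using c by (simp add: A_def)
      then show ?case using elim by blast
    qed
    have "Var u \<le> ennreal L"
    proof (rule Var_le_if_pV_le_AE_tendsto[OF _ _ AE])
      show "0 \<le> L" using real by simp
      show "pV (us (s n)) \<le> ennreal (L + 1 / real (Suc n))" for n
        using upper_gradient_pV_le[of "gs (s n)" "us (s n)"] ug s(1)[of n] by (meson less_imp_le order_trans)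
    qed
    then show ?thesis using real by simp
  qed simp
qed

section \<open>Local connectedness by paths of finite length\<close>

text \<open>If \<open>y\<close> is close to \<open>x\<close> but cannot be chained to \<open>x\<close> with steps below \<open>\<eta>\<close>, then the chain component
  of \<open>y\<close> reaches the boundary of the ball and has measure at least \<open>\<epsilon>/2\<close>. Components obtained for
  points \<open>y\<close> converging fast to \<open>x\<close> are disjoint.\<close>

lemma locally_chain_connected:
  fixes x :: "'a::metric_space"
  assumes con: "connected (UNIV :: 'a set)" and fin: "emeasure hausdorff1 (UNIV :: 'a set) < \<infinity>"
    and "0 < \<epsilon>"
  shows "\<exists>\<delta>>0. \<forall>y\<in>ball x \<delta>. \<forall>\<eta>>0. (\<lambda>a b. a \<in> ball x \<epsilon> \<and> b \<in> ball x \<epsilon> \<and> dist a b < \<eta>)\<^sup>*\<^sup>* x y"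
proof (rule ccontr)
  define R where "R \<eta> = (\<lambda>a b. a \<in> ball x \<epsilon> \<and> b \<in> ball x \<epsilon> \<and> dist a b < \<eta>)" for \<eta>
  assume "\<not> ?thesis"
  then have ex: "\<exists>y \<eta>. y \<in> ball x \<delta> \<and> 0 < \<eta> \<and> \<not> (R \<eta>)\<^sup>*\<^sup>* x y" if "0 < \<delta>" for \<delta>
    unfolding R_def using that by blast
  have sym: "(R \<eta>)\<^sup>*\<^sup>* a b \<Longrightarrow> (R \<eta>)\<^sup>*\<^sup>* b a" for \<eta> a b
    by (rule sympD[OF symp_rtranclp]) (auto simp: R_def symp_def dist_commute)
  have mono: "(R \<eta>)\<^sup>*\<^sup>* a b \<Longrightarrow> (R \<eta>')\<^sup>*\<^sup>* a b" if "\<eta> \<le> \<eta>'" for \<eta> \<eta>' a b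
    using that by (elim rtranclp_mono[THEN predicate2D, rotated]) (auto simp: R_def)
  define bad where "bad = (\<lambda>(y, \<eta>). y \<in> ball x (\<epsilon>/2) \<and> 0 < \<eta> \<and> \<not> (R \<eta>)\<^sup>*\<^sup>* x y)"
  have "\<exists>p. \<forall>k. bad (p k) \<and> (dist x (fst (p (Suc k))) < snd (p k) \<and> snd (p (Suc k)) \<le> snd (p k))"
  proof (rule dependent_nat_choice)
    show "\<exists>p. bad p" using ex[of "\<epsilon>/2"] \<open>0 < \<epsilon>\<close> by (auto simp: bad_def)
    fix p and n :: nat assume "bad p"
    then have "0 < snd p" by (auto simp: bad_def)
    \<comment> \<open>The new point lies within the previous step size of \<open>x\<close>, and step
      sizes never grow. If its component met an earlier one, the earlier one would therefore contain
      \<open>x\<close>.\<close>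
    then obtain y \<eta> where "y \<in> ball x (min (\<epsilon>/2) (snd p))" "0 < \<eta>" "\<not> (R \<eta>)\<^sup>*\<^sup>* x y"
      using ex[of "min (\<epsilon>/2) (snd p)"] \<open>0 < \<epsilon>\<close> by auto
    then show "\<exists>q. bad q \<and> (dist x (fst q) < snd p \<and> snd q \<le> snd p)"
      using mono[of "min \<eta> (snd p)" \<eta> x y] \<open>0 < snd p\<close>
      by (intro exI[of _ "(y, min \<eta> (snd p))"]) (auto simp: bad_def)
  qed
  then obtain p where p: "\<And>k. bad (p k)" "\<And>k. dist x (fst (p (Suc k))) < snd (p k)"
    "\<And>k. snd (p (Suc k)) \<le> snd (p k)" by auto
  have anti: "snd (p k) \<le> snd (p j)" if "j \<le> k" for j k
    using that p(3) by (rule lift_Suc_antimono_le[rotated])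
  define A where "A k = {z. (R (snd (p k)))\<^sup>*\<^sup>* (fst (p k)) z}" for k
  have step: "z' \<in> A k" if "z \<in> A k" "z \<in> ball x \<epsilon>" "z' \<in> ball x \<epsilon>" "dist z z' < snd (p k)" for z z' k
    using that unfolding A_def R_def by (auto intro: rtranclp.rtrancl_into_rtrancl)
  have yk: "fst (p k) \<in> ball x (\<epsilon>/2)" "0 < snd (p k)" "x \<notin> A k" for k
    using p(1)[of k] sym by (auto simp: bad_def A_def split: prod.splits)
  have A_sub: "A k \<subseteq> ball x \<epsilon>" for k
  proof
    fix z assume "z \<in> A k"
    then have "(R (snd (p k)))\<^sup>*\<^sup>* (fst (p k)) z" by (simp add: A_def)
    then show "z \<in> ball x \<epsilon>"
    proof (cases rule: rtranclp.cases)
      case rtrancl_refl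
      then show ?thesis using yk(1)[of k] \<open>0 < \<epsilon>\<close> by auto
    qed (auto simp: R_def)
  qed
  have A_open: "open (A k)" for k
    unfolding open_dist
  proof (intro ballI)
    fix z assume z: "z \<in> A k"
    then have zx: "z \<in> ball x \<epsilon>" using A_sub by blast
    then obtain e where e: "0 < e" "ball z e \<subseteq> ball x \<epsilon>" using open_ball openE by blast
    have "z' \<in> A k" if "dist z' z < min e (snd (p k))" for z'
    proof (rule step[OF z zx])
      have "z' \<in> ball z e" using that by (simp add: dist_commute)
      then show "z' \<in> ball x \<epsilon>" using e by blast
      show "dist z z' < snd (p k)" using that by (simp add: dist_commute)
    qed
    then show "\<exists>e>0. \<forall>y. dist y z < e \<longrightarrow> y \<in> A k"
      using e yk(2)[of k] by (intro exI[of _ "min e (snd (p k))"]) auto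
  qed
  have A_image: "{\<epsilon>/2..<\<epsilon>} \<subseteq> dist x ` A k" for k
  proof
    fix s assume s: "s \<in> {\<epsilon>/2..<\<epsilon>}"
    show "s \<in> dist x ` A k"
    proof (rule ccontr)
      assume no: "s \<notin> dist x ` A k"
      \<comment> \<open>If \<open>A k\<close> missed the sphere of radius \<open>s\<close>, this set
        would be clopen, nonempty and without \<open>x\<close>, against connectedness.\<close>
      define U where "U = A k \<inter> ball x s"
      have "open U" unfolding U_def using A_open by auto
      moreover have "open (- U)"
        unfolding open_dist
      proof (intro ballI)
        fix z assume z: "z \<in> - U"
        consider "s < dist x z" | "z \<notin> A k" "dist x z \<le> s"
          using z no by (fastforce simp: U_def not_less)
        then show "\<exists>e>0. \<forall>y. dist y z < e \<longrightarrow> y \<in> - U"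
        proof cases
          case 1
          have "y \<in> - U" if "dist y z < dist x z - s" for y
            using that dist_triangle[of x z y] by (auto simp: U_def)
          then show ?thesis using 1 by (intro exI[of _ "dist x z - s"]) auto
        next
          case 2
          then have "z \<in> ball x \<epsilon>" using s by auto
          then have "y \<in> - U" if "dist y z < snd (p k)" for y
            using step[of y k z] that 2 A_sub[of k] by (auto simp: U_def)
          then show ?thesis using yk(2)[of k] by blast
        qed
      qed
      then have "closed U" by (simp add: closed_def)
      moreover have "fst (p k) \<in> U" using yk(1)[of k] s by (auto simp: U_def A_def)
      moreover have "x \<notin> U" using yk(3)[of k] by (simp add: U_def)
      ultimately show False
        using con unfolding connected_clopen by (auto simp: openin_open_eq)
    qed
  qed
  have A_ge: "ennreal (\<epsilon>/2) \<le> emeasure hausdorff1 (A k)" for k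
  proof -
    have "emeasure lborel {\<epsilon>/2..<\<epsilon>} \<le> hausdorff1_outer (A k)"
      using A_image
    proof (rule lborel_le_hausdorff1_outer[rotated])
      show "dist x a - dist x b \<le> dist a b" for a b
        using dist_triangle[of x a b] by (simp add: dist_commute)
    qed simp
    then show ?thesis using \<open>0 < \<epsilon>\<close> A_open by (simp add: emeasure_hausdorff1)
  qed
  have A_disj: "A j \<inter> A k = {}" if "j < k" for j k
  proof (rule ccontr)
    assume "A j \<inter> A k \<noteq> {}"
    then obtain z where "(R (snd (p j)))\<^sup>*\<^sup>* (fst (p j)) z" "(R (snd (p k)))\<^sup>*\<^sup>* (fst (p k)) z"
      by (auto simp: A_def)
    then have "(R (snd (p j)))\<^sup>*\<^sup>* (fst (p j)) (fst (p k))"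
      using mono[OF anti, of j k "fst (p k)" z] that sym rtranclp_trans by (metis less_imp_le)
    moreover have "R (snd (p j)) (fst (p k)) x"
    proof -
      define i where "i = k - 1"
      have i: "k = Suc i" "j \<le> i" using \<open>j < k\<close> by (auto simp: i_def)
      then have "dist x (fst (p k)) < snd (p j)" using p(2)[of i] anti[of j i] by auto
      then show ?thesis using yk(1)[of k] \<open>0 < \<epsilon>\<close> by (auto simp: R_def dist_commute)
    qed
    ultimately have "x \<in> A j" by (auto simp: A_def intro: rtranclp.rtrancl_into_rtrancl)
    then show False using yk(3) by blast
  qed
  obtain n where n: "emeasure hausdorff1 (UNIV :: 'a set) < of_nat n * ennreal (\<epsilon>/2)"
    using ennreal_of_nat_mult_unbounded[OF fin, of "\<epsilon>/2"] \<open>0 < \<epsilon>\<close> by auto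
  have "of_nat n * ennreal (\<epsilon>/2) = (\<Sum>k<n. ennreal (\<epsilon>/2))" by simp
  also have "\<dots> \<le> (\<Sum>k<n. emeasure hausdorff1 (A k))" using A_ge by (rule sum_mono)
  also have "\<dots> = emeasure hausdorff1 (\<Union>k<n. A k)"
  proof (rule sum_emeasure)
    show "disjoint_family_on A {..<n}"
      unfolding disjoint_family_on_def using A_disj by (metis Int_commute linorder_neqE_nat)
  qed (use A_open in auto)
  also have "\<dots> \<le> emeasure hausdorff1 (UNIV :: 'a set)" by (intro emeasure_mono) auto
  finally show False using n by simp
qed

text \<open>In a shortest chain the balls around every other point are disjoint, which bounds the number of
  steps; so the chains behave like paths of bounded length and converge as the steps shrink.\<close>

lemma chains_imp_joinable:
  fixes x :: "'a::metric_space"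
  assumes con: "connected (UNIV :: 'a set)" and fin: "emeasure hausdorff1 (UNIV :: 'a set) < \<infinity>"
    and K: "compact K" "x \<in> K"
    and chain: "\<And>\<eta>. 0 < \<eta> \<Longrightarrow> (\<lambda>a b. a \<in> K \<and> b \<in> K \<and> dist a b < \<eta>)\<^sup>*\<^sup>* x y"
  shows "joinable K x y"
proof (cases "x = y")
  case True
  then show ?thesis using joinable_refl[OF K(2)] by simp
next
  case False
  obtain M where M: "emeasure hausdorff1 (UNIV :: 'a set) = ennreal M" "0 \<le> M"
    using fin by (cases "emeasure hausdorff1 (UNIV :: 'a set)") auto
  \<comment> \<open>At least \<open>(n + 1) / 2\<close> disjoint balls of radius
    \<open>h / 2\<close>, each of measure at least \<open>h / 2\<close>, fit into measure
    \<open>M\<close>; so a chain of \<open>n\<close> steps has \<open>(n + 1) * h\<close> at most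
    \<open>4 * M\<close>.\<close>
  define L where "L = 4 * M"
  have "\<exists>c. c ` {0..L} \<subseteq> K \<and> dist (c 0) x \<le> \<eta> \<and> dist (c L) y \<le> \<eta> \<and>
              (\<forall>s\<in>{0..L}. \<forall>t\<in>{0..L}. dist (c s) (c t) \<le> \<bar>s - t\<bar> + \<eta>)" if "0 < \<eta>" for \<eta>
  proof -
    \<comment> \<open>The cap \<open>dist x y\<close> ensures that no ball of radius
      \<open>h / 2\<close> is the whole space, as the packing bound requires.\<close>
    define h where "h = min \<eta> (dist x y)"
    have h: "0 < h" "h \<le> \<eta>" "h \<le> dist x y" using that False by (auto simp: h_def)
    define R where "R = (\<lambda>a b. a \<in> K \<and> b \<in> K \<and> dist a b < h)"
    have "R\<^sup>*\<^sup>* x y" unfolding R_def using h by (intro chain)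
    then have ex: "\<exists>n. (R ^^ n) x y" by (rule rtranclp_imp_relpowp)
    define n where "n = (LEAST n. (R ^^ n) x y)"
    have n: "(R ^^ n) x y" unfolding n_def using ex by (rule LeastI_ex)
    have n_min: "n \<le> m" if "(R ^^ m) x y" for m
      unfolding n_def using that by (rule Least_le)
    obtain f where f: "f 0 = x" "f n = y" "\<And>i. i < n \<Longrightarrow> R (f i) (f (Suc i))"
      using n unfolding relpowp_fun_conv by blast
    have pow: "(R ^^ k) (f i) (f (i + k))" if "i + k \<le> n" for i k
      unfolding relpowp_fun_conv using that f(3) by (intro exI[of _ "\<lambda>j. f (i + j)"]) auto
    have fK: "f i \<in> K" if "i \<le> n" for i
      using f(1) f(3)[of "i - 1"] K(2) that by (cases i) (auto simp: R_def)
    \<comment> \<open>Otherwise a direct step from \<open>f i\<close> to \<open>f j\<close> would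
      shorten the chain.\<close>
    have far: "h \<le> dist (f i) (f j)" if ij: "i + 2 \<le> j" "j \<le> n" for i j
    proof (rule ccontr)
      assume "\<not> ?thesis"
      then have "(R ^^ 1) (f i) (f j)" using fK ij by (auto simp: R_def)
      moreover have "(R ^^ i) x (f i)" using pow[of 0 i] f(1) ij by simp
      moreover have "(R ^^ (n - j)) (f j) y" using pow[of j "n - j"] f(2) ij by simp
      ultimately have "(R ^^ (i + 1 + (n - j))) x y"
        unfolding relpowp_add by blast
      then show False using n_min[of "i + 1 + (n - j)"] ij by auto
    qed
    define F where "F = (\<lambda>i. f (2 * i)) ` {..n div 2}"
    have far2: "h \<le> dist (f (2 * i)) (f (2 * j))" if "i \<noteq> j" "i \<le> n div 2" "j \<le> n div 2" for i j
      using far[of "2 * i" "2 * j"] far[of "2 * j" "2 * i"] that by (cases "i < j") (auto simp: dist_commute)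
    have "inj_on (\<lambda>i. f (2 * i)) {..n div 2}"
      using far2 h(1) by (force simp: inj_on_def)
    then have card: "card F = Suc (n div 2)" by (simp add: F_def card_image)
    have "of_nat (card F) * ennreal (h/2) \<le> ennreal M"
      unfolding M(1)[symmetric]
    proof (rule card_disjoint_balls_le[OF con])
      show "disjoint_family_on (\<lambda>x. ball x (h/2)) F"
        unfolding disjoint_family_on_def
      proof (intro ballI impI disjoint_ballI)
        fix a b assume "a \<in> F" "b \<in> F" "a \<noteq> b"
        then obtain i j where "a = f (2 * i)" "b = f (2 * j)" "i \<noteq> j" "i \<le> n div 2" "j \<le> n div 2"
          by (auto simp: F_def)
        then show "h / 2 + h / 2 \<le> dist a b" using far2 by simp
      qed
      show "ball z (h/2) \<noteq> UNIV" for z :: 'a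
      proof
        assume "ball z (h/2) = UNIV"
        then have "dist z x < h/2" "dist z y < h/2" by (metis UNIV_I mem_ball)+
        then show False using h(3) dist_triangle[of x y z] by (simp add: dist_commute)
      qed
    qed (simp add: F_def)
    moreover have "of_nat (card F) * ennreal (h/2) = ennreal (real (card F) * (h/2))"
      unfolding ennreal_of_nat_eq_real_of_nat using h(1) by (intro ennreal_mult[symmetric]) auto
    ultimately have "real (card F) * (h/2) \<le> M" using M(2) by (simp only: ennreal_le_iff)
    then have "(real n + 1) * h \<le> L"
    proof -
      have "n + 1 \<le> 2 * card F" unfolding card by presburger
      then have "real n + 1 \<le> 2 * real (card F)" by linarith
      then have "(real n + 1) * h \<le> (2 * real (card F)) * h" using h(1) by (intro mult_right_mono) auto
      then show ?thesis using \<open>real (card F) * (h/2) \<le> M\<close> by (simp add: L_def)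
    qed
    have lip: "dist (f i) (f j) \<le> real (j - i) * h" if "i \<le> j" "j \<le> n" for i j
      using that
    proof (induction j rule: dec_induct)
      case (step m)
      then have "dist (f m) (f (Suc m)) < h" using f(3)[of m] by (auto simp: R_def)
      then show ?case
        using step dist_triangle[of "f i" "f (Suc m)" "f m"] by (simp add: Suc_diff_le algebra_simps)
    qed simp
    \<comment> \<open>A step function that runs through the chain at unit speed and rests at
      \<open>y\<close> once the chain is used up. Rounding costs at most one step of size
      \<open>h\<close>.\<close>
    define c where "c s = f (min n (nat \<lfloor>s / h\<rfloor>))" for s
    have lip_c: "dist (c s) (c t) \<le> t - s + \<eta>" if "0 \<le> s" "s \<le> t" for s t
    proof -
      define i j where "i = min n (nat \<lfloor>s / h\<rfloor>)" and "j = min n (nat \<lfloor>t / h\<rfloor>)"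
      have st: "0 \<le> s / h" "s / h \<le> t / h" using that h(1) by (auto intro: divide_right_mono)
      then have "i \<le> j" unfolding i_def j_def by (intro min.mono nat_mono floor_mono) auto
      have "real (j - i) \<le> t / h - s / h + 1"
      proof (cases "nat \<lfloor>s / h\<rfloor> \<le> n")
        case True
        then have i: "real i = of_int \<lfloor>s / h\<rfloor>" using st by (simp add: i_def)
        have "real j \<le> real (nat \<lfloor>t / h\<rfloor>)" by (simp add: j_def)
        also have "\<dots> = of_int \<lfloor>t / h\<rfloor>" using st by simp
        finally have "real j \<le> of_int \<lfloor>t / h\<rfloor>" .
        then show ?thesis using i \<open>i \<le> j\<close> by (simp add: of_nat_diff) linarith
      qed (use st in \<open>simp add: i_def j_def\<close>)
      then have "real (j - i) * h \<le> (t / h - s / h + 1) * h"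
        using h(1) by (intro mult_right_mono) auto
      also have "\<dots> = t - s + h" using h(1) by (simp add: field_simps)
      also have "\<dots> \<le> t - s + \<eta>" using h(2) by simp
      finally have "real (j - i) * h \<le> t - s + \<eta>" .
      then show ?thesis using lip[OF \<open>i \<le> j\<close>] by (simp add: c_def i_def j_def)
    qed
    have "real n \<le> L / h" using \<open>(real n + 1) * h \<le> L\<close> h(1) by (simp add: field_simps)
    then have "n \<le> nat \<lfloor>L / h\<rfloor>" by (simp add: le_nat_floor)
    then have "c L = y" using f(2) by (simp add: c_def)
    moreover have "c 0 = x" using f(1) by (simp add: c_def)
    moreover have "c ` {0..L} \<subseteq> K" using fK by (auto simp: c_def)
    moreover have "dist (c s) (c t) \<le> \<bar>s - t\<bar> + \<eta>" if "s \<in> {0..L}" "t \<in> {0..L}" for s t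
      using lip_c[of s t] lip_c[of t s] that by (cases "s \<le> t") (auto simp: dist_commute)
    ultimately show ?thesis using \<open>0 < \<eta>\<close> by (intro exI[of _ c]) auto
  qed
  moreover have "0 \<le> L" using M(2) by (simp add: L_def)
  ultimately obtain \<gamma> where "1-lipschitz_on {0..L} \<gamma>" "\<gamma> 0 = x" "\<gamma> L = y" "\<gamma> ` {0..L} \<subseteq> K"
    using lipschitz_path_limit[OF K(1)] by blast
  then show ?thesis using \<open>0 \<le> L\<close> by (intro joinableI[of L \<gamma>]) auto
qed

text \<open>Half the radius leaves room for a closed ball, compact because the space is, in which
  chains with ever smaller steps yield a path.\<close>

lemma locally_joinable:
  fixes x :: "'a::complete_space"
  assumes con: "connected (UNIV :: 'a set)" and fin: "emeasure hausdorff1 (UNIV :: 'a set) < \<infinity>"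
    and "0 < \<epsilon>"
  shows "\<exists>\<delta>>0. \<forall>y\<in>ball x \<delta>. joinable (ball x \<epsilon>) x y"
proof -
  obtain \<delta> where \<delta>: "0 < \<delta>" "\<And>y \<eta>. y \<in> ball x \<delta> \<Longrightarrow> 0 < \<eta> \<Longrightarrow>
      (\<lambda>a b. a \<in> ball x (\<epsilon>/2) \<and> b \<in> ball x (\<epsilon>/2) \<and> dist a b < \<eta>)\<^sup>*\<^sup>* x y"
    using locally_chain_connected[OF con fin, of "\<epsilon>/2" x] \<open>0 < \<epsilon>\<close> by auto
  have "compact (cball x (\<epsilon>/2))"
    using compact_UNIV_if_hausdorff1_finite[OF con fin] compact_Int_closed[of UNIV "cball x (\<epsilon>/2)"] by simp
  moreover have "(\<lambda>a b. a \<in> cball x (\<epsilon>/2) \<and> b \<in> cball x (\<epsilon>/2) \<and> dist a b < \<eta>)\<^sup>*\<^sup>* x y"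
    if "y \<in> ball x \<delta>" "0 < \<eta>" for y \<eta>
    using \<delta>(2)[OF that] by (elim rtranclp_mono[THEN predicate2D, rotated]) auto
  ultimately have "joinable (cball x (\<epsilon>/2)) x y" if "y \<in> ball x \<delta>" for y
    using that \<open>0 < \<epsilon>\<close> by (intro chains_imp_joinable[OF con fin]) auto
  moreover have "cball x (\<epsilon>/2) \<subseteq> ball x \<epsilon>" using \<open>0 < \<epsilon>\<close> by auto
  ultimately show ?thesis using \<delta>(1) joinable_mono by blast
qed

section \<open>Banach's indicatrix\<close>

text \<open>The inserted 1 supplies the bound when \<open>F\<close> has fewer than two
  points.\<close>

lemma finite_imp_dist_bounded_below:
  fixes F :: "'a::metric_space set"
  assumes "finite F"
  obtains \<delta> where "0 < \<delta>" "\<And>x y. x \<in> F \<Longrightarrow> y \<in> F \<Longrightarrow> x \<noteq> y \<Longrightarrow> \<delta> \<le> dist x y"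
proof -
  have "finite {d. \<exists>x\<in>F. \<exists>y\<in>F. d = dist x y}" using assms by simp
  then have fin: "finite (insert 1 ({d. \<exists>x\<in>F. \<exists>y\<in>F. d = dist x y} - {0}))" by simp
  define \<delta> where "\<delta> = Min (insert 1 ({d. \<exists>x\<in>F. \<exists>y\<in>F. d = dist x y} - {0}))"
  have "\<delta> \<in> insert 1 ({d. \<exists>x\<in>F. \<exists>y\<in>F. d = dist x y} - {0})"
    unfolding \<delta>_def using fin by (rule Min_in) simp
  then have "0 < \<delta>" by auto
  moreover have "\<delta> \<le> dist x y" if "x \<in> F" "y \<in> F" "x \<noteq> y" for x y
    unfolding \<delta>_def using fin by (rule Min_le) (use that in auto)
  ultimately show ?thesis by (rule that)
qed

text \<open>Points of \<open>S t\<close> are eventually separated by the cells \<open>E m i\<close>, and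
  the number of cells that can meet \<open>S t\<close> has bounded integral.\<close>

lemma indicatrix_bound:
  fixes S :: "real \<Rightarrow> 'a::metric_space set" and E :: "nat \<Rightarrow> nat \<Rightarrow> 'a set"
    and a b :: "nat \<Rightarrow> nat \<Rightarrow> real"
  assumes mesh: "\<And>m i x y. x \<in> E m i \<Longrightarrow> y \<in> E m i \<Longrightarrow> dist x y \<le> \<eta> m" and \<eta>: "\<eta> \<longlonglongrightarrow> 0"
    and cover: "\<And>m t x. t \<notin> Z \<Longrightarrow> x \<in> S t \<Longrightarrow> \<exists>i. x \<in> E m i \<and> a m i \<le> t \<and> t \<le> b m i"
    and len: "\<And>m. (\<Sum>i. ennreal (b m i - a m i)) \<le> P"
  shows "\<exists>H. H \<in> borel_measurable borel \<and> (\<integral>\<^sup>+ t. H t \<partial>lborel) \<le> P \<and>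
    (\<forall>t. t \<notin> Z \<longrightarrow> H t < \<infinity> \<longrightarrow> finite (S t) \<and> of_nat (card (S t)) \<le> H t)"
proof -
  \<comment> \<open>The number of cells whose interval contains \<open>t\<close>. An interval with
    right end below its left end counts 0, in agreement with \<open>ennreal\<close> of its negative
    length.\<close>
  define N where "N m t = (\<Sum>i. indicator {a m i..b m i} t :: ennreal)" for m t
  define H where "H t = liminf (\<lambda>m. N m t)" for t
  have N: "N m \<in> borel_measurable borel" for m unfolding N_def by measurable
  have "(\<integral>\<^sup>+ t. N m t \<partial>lborel) \<le> P" for m
  proof -
    have "(\<integral>\<^sup>+ t. N m t \<partial>lborel) = (\<Sum>i. \<integral>\<^sup>+ t. indicator {a m i..b m i} t \<partial>lborel)"
      unfolding N_def by (rule nn_integral_suminf) simp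
    also have "\<dots> = (\<Sum>i. ennreal (b m i - a m i))"
    proof (rule suminf_cong)
      fix i
      show "(\<integral>\<^sup>+ t. indicator {a m i..b m i} t \<partial>lborel) = ennreal (b m i - a m i)"
        by (cases "a m i \<le> b m i") (auto simp: ennreal_neg)
    qed
    finally show ?thesis using len by simp
  qed
  then have "liminf (\<lambda>m. \<integral>\<^sup>+ t. N m t \<partial>lborel) \<le> P"
    by (intro Liminf_le) auto
  moreover have "(\<integral>\<^sup>+ t. H t \<partial>lborel) \<le> liminf (\<lambda>m. \<integral>\<^sup>+ t. N m t \<partial>lborel)"
    unfolding H_def using N by (intro nn_integral_liminf) auto
  ultimately have "(\<integral>\<^sup>+ t. H t \<partial>lborel) \<le> P" by simp
  moreover have "H \<in> borel_measurable borel"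
    unfolding H_def using N by measurable
  moreover have "finite (S t) \<and> of_nat (card (S t)) \<le> H t" if t: "t \<notin> Z" "H t < \<infinity>" for t
  proof -
    have le: "of_nat (card F) \<le> H t" if F: "finite F" "F \<subseteq> S t" for F
    proof -
      obtain \<delta> where \<delta>: "0 < \<delta>" "\<And>x y. x \<in> F \<Longrightarrow> y \<in> F \<Longrightarrow> x \<noteq> y \<Longrightarrow> \<delta> \<le> dist x y"
        using finite_imp_dist_bounded_below[OF F(1)] by blast
      have "\<forall>\<^sub>F m in sequentially. of_nat (card F) \<le> N m t"
        using order_tendstoD(2)[OF \<eta> \<delta>(1)]
      proof eventually_elim
        case (elim m)
        have "\<forall>x\<in>F. \<exists>i. x \<in> E m i \<and> a m i \<le> t \<and> t \<le> b m i"
          using cover[OF t(1)] F(2) by blast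
        then obtain i where i: "\<And>x. x \<in> F \<Longrightarrow> x \<in> E m (i x) \<and> a m (i x) \<le> t \<and> t \<le> b m (i x)"
          by metis
        have "inj_on i F"
        proof (rule inj_onI, rule ccontr)
          fix x y assume "x \<in> F" "y \<in> F" "i x = i y" "x \<noteq> y"
          then show False using i[of x] i[of y] mesh[of x m "i x" y] \<delta>(2)[of x y] elim by auto
        qed
        then have "of_nat (card F) = (\<Sum>j\<in>i ` F. indicator {a m j..b m j} t :: ennreal)"
          using i by (subst sum.reindex) (auto simp: indicator_def)
        also have "\<dots> \<le> N m t"
          unfolding N_def using F(1) by (intro sum_le_suminf) auto
        finally show ?case .
      qed
      then show ?thesis unfolding H_def by (rule Liminf_bounded)
    qed
    have "finite (S t)"
    proof (rule ccontr)
      assume "infinite (S t)"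
      obtain n where n: "H t < of_nat n * ennreal 1"
        using ennreal_of_nat_mult_unbounded[OF t(2), of 1] by auto
      obtain F where "finite F" "F \<subseteq> S t" "card F = n"
        using infinite_arbitrarily_large[OF \<open>infinite (S t)\<close>] by blast
      then show False using le[of F] n by auto
    qed
    then show ?thesis using le by blast
  qed
  ultimately show ?thesis by (intro exI[of _ H]) blast
qed

text \<open>A case of Eilenberg's inequality: the cells come from covers of small mesh, and the
  interval of a cell spans the distances from \<open>c\<close> to its points, so it is no longer
  than the diameter.\<close>

lemma AE_finite_sphere:
  fixes c :: "'a::metric_space"
  assumes fin: "emeasure hausdorff1 (UNIV :: 'a set) < \<infinity>"
  shows "AE \<rho> in lborel. finite {x. dist c x = \<rho>}"
proof -
  have out: "hausdorff1_outer (UNIV :: 'a set) < \<infinity>" using fin by (simp add: hausdorff1_UNIV)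
  have "\<exists>E. (UNIV :: 'a set) = (\<Union>i::nat. E i) \<and> (\<forall>i. bounded (E i) \<and> diameter (E i) \<le> 1 / real (Suc m)) \<and>
      (\<Sum>i. ennreal (diameter (E i))) \<le> hausdorff1_outer (UNIV :: 'a set) + 1" for m
  proof -
    obtain E :: "nat \<Rightarrow> 'a set" where "UNIV \<subseteq> (\<Union>i. E i)" "\<And>i. bounded (E i)"
      "\<And>i. diameter (E i) \<le> 1 / real (Suc m)"
      "(\<Sum>i. ennreal (diameter (E i))) \<le> hausdorff1_outer (UNIV :: 'a set) + 1"
      by (rule hausdorff1_cover[OF out, of "1 / real (Suc m)"]) (simp, rule that)
    then show ?thesis by (intro exI[of _ E] conjI allI) blast+
  qed
  then obtain E :: "nat \<Rightarrow> nat \<Rightarrow> 'a set" where E: "\<And>m. UNIV = (\<Union>i. E m i)"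
    "\<And>m i. bounded (E m i)" "\<And>m i. diameter (E m i) \<le> 1 / real (Suc m)"
    "\<And>m. (\<Sum>i. ennreal (diameter (E m i))) \<le> hausdorff1_outer (UNIV :: 'a set) + 1"
    by metis
  define a where "a m i = (if E m i = {} then 1 else Inf (dist c ` E m i))" for m i
  define b where "b m i = (if E m i = {} then 0 else Sup (dist c ` E m i))" for m i
  have bdd: "bdd_above (dist c ` E m i)" "bdd_below (dist c ` E m i)"
    "Sup (dist c ` E m i) - Inf (dist c ` E m i) \<le> diameter (E m i)" if ne: "E m i \<noteq> {}" for m i
  proof -
    have "s - t \<le> diameter (E m i)" if st: "s \<in> dist c ` E m i" "t \<in> dist c ` E m i" for s t
    proof -
      obtain x y where xy: "x \<in> E m i" "y \<in> E m i" "s = dist c x" "t = dist c y" using st by auto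
      then have "s - t \<le> dist x y" using dist_triangle[of c x y] by (simp add: dist_commute)
      then show ?thesis using diameter_bounded_bound[OF E(2) xy(1,2)] by simp
    qed
    then show "bdd_above (dist c ` E m i)" "bdd_below (dist c ` E m i)"
      "Sup (dist c ` E m i) - Inf (dist c ` E m i) \<le> diameter (E m i)"
      using bdd_Sup_minus_Inf_le[of "dist c ` E m i" "diameter (E m i)"] ne by auto
  qed
  have mesh: "dist x y \<le> 1 / real (Suc m)" if "x \<in> E m i" "y \<in> E m i" for m i x y
    using diameter_bounded_bound[OF E(2), of x m i y] E(3)[of m i] that by simp
  have lim: "(\<lambda>m. 1 / real (Suc m)) \<longlonglongrightarrow> 0"
    using LIMSEQ_inverse_real_of_nat by (simp add: inverse_eq_divide)
  have cover: "\<exists>i. x \<in> E m i \<and> a m i \<le> t \<and> t \<le> b m i" if "t \<notin> {}" "x \<in> {x. dist c x = t}" for m t x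
  proof -
    obtain i where "x \<in> E m i" using E(1)[of m] by blast
    then show ?thesis
      using bdd[of m i] that by (intro exI[of _ i]) (auto simp: a_def b_def intro: cInf_lower cSup_upper)
  qed
  have len: "(\<Sum>i. ennreal (b m i - a m i)) \<le> hausdorff1_outer (UNIV :: 'a set) + 1" for m
  proof -
    have "(\<Sum>i. ennreal (b m i - a m i)) \<le> (\<Sum>i. ennreal (diameter (E m i)))"
      using bdd(3) by (intro suminf_le ennreal_leI) (auto simp: a_def b_def)
    then show ?thesis using E(4)[of m] by simp
  qed
  have "\<exists>H. H \<in> borel_measurable borel \<and> (\<integral>\<^sup>+ t. H t \<partial>lborel) \<le> hausdorff1_outer (UNIV :: 'a set) + 1 \<and>
    (\<forall>t. t \<notin> {} \<longrightarrow> H t < \<infinity> \<longrightarrow>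
      finite {x. dist c x = t} \<and> of_nat (card {x. dist c x = t}) \<le> H t)"
    by (rule indicatrix_bound[of E "\<lambda>m. 1 / real (Suc m)" _ _ a b]) (fact mesh lim cover len)+
  then obtain H :: "real \<Rightarrow> ennreal" where H: "H \<in> borel_measurable borel"
    "(\<integral>\<^sup>+ t. H t \<partial>lborel) \<le> hausdorff1_outer (UNIV :: 'a set) + 1"
    "\<And>t. H t < \<infinity> \<Longrightarrow> finite {x. dist c x = t}"
    by blast
  have "AE t in lborel. H t \<noteq> \<infinity>"
  proof (rule nn_integral_noteq_infinite)
    show "(\<integral>\<^sup>+ t. H t \<partial>lborel) \<noteq> \<infinity>"
      using H(2) out by (auto simp: top_unique)
  qed (use H(1) in simp)
  then show ?thesis
    by eventually_elim (use H(3) in \<open>auto simp: less_top\<close>)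
qed

section \<open>Discontinuities, cut sets and cells of a function of finite pointwise
  variation\<close>

lemma countable_discontinuities:
  fixes v :: "'a::complete_space \<Rightarrow> real"
  assumes con: "connected (UNIV :: 'a set)" and fin: "emeasure hausdorff1 (UNIV :: 'a set) < \<infinity>"
    and pV: "pV v < \<infinity>"
  shows "countable {x. \<not> isCont v x}"
proof -
  define J where "J n = {x. \<forall>\<delta>>0. \<exists>y\<in>ball x \<delta>. 1 / real (Suc n) \<le> \<bar>v y - v x\<bar>}" for n
  \<comment> \<open>Finitely many points of large oscillation have disjoint balls around them, each
    containing a path from the centre between whose ends \<open>v\<close> changes by at least
    \<open>1 / real (Suc n)\<close>.\<close>
  have card_le: "of_nat (card F) * ennreal (1 / real (Suc n)) \<le> pV v" if F: "finite F" "F \<subseteq> J n" for F n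
  proof -
    obtain \<epsilon> where \<epsilon>: "0 < \<epsilon>" "disjoint_family_on (\<lambda>x. ball x \<epsilon>) F"
    proof -
      obtain \<delta> where \<delta>: "0 < \<delta>" "\<And>x y. x \<in> F \<Longrightarrow> y \<in> F \<Longrightarrow> x \<noteq> y \<Longrightarrow> \<delta> \<le> dist x y"
        using finite_imp_dist_bounded_below[OF F(1)] by blast
      have "disjoint_family_on (\<lambda>x. ball x (\<delta>/2)) F"
        unfolding disjoint_family_on_def
        by (intro ballI impI disjoint_ballI) (use \<delta>(2) in auto)
      then show ?thesis using that[of "\<delta>/2"] \<delta>(1) by simp
    qed
    have "\<exists>y. joinable (ball x \<epsilon>) x y \<and> 1 / real (Suc n) \<le> \<bar>v y - v x\<bar>" if "x \<in> F" for x
    proof -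
      obtain \<delta> where "0 < \<delta>" "\<forall>y\<in>ball x \<delta>. joinable (ball x \<epsilon>) x y"
        using locally_joinable[OF con fin \<epsilon>(1)] by blast
      then show ?thesis using F(2) that unfolding J_def by blast
    qed
    then obtain y where y: "\<And>x. x \<in> F \<Longrightarrow> joinable (ball x \<epsilon>) x (y x)"
      "\<And>x. x \<in> F \<Longrightarrow> 1 / real (Suc n) \<le> \<bar>v (y x) - v x\<bar>" by metis
    have "of_nat (card F) * ennreal (1 / real (Suc n)) = (\<Sum>x\<in>F. ennreal (1 / real (Suc n)))" by simp
    also have "\<dots> \<le> (\<Sum>x\<in>F. ennreal \<bar>v (y x) - v x\<bar>)" using y(2) by (intro sum_mono ennreal_leI)
    also have "\<dots> \<le> pV v"
      using F(1) \<epsilon>(2) y(1) by (rule sum_joinable_le_pV)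
    finally show ?thesis .
  qed
  have "finite (J n)" for n
  proof (rule ccontr)
    assume "infinite (J n)"
    obtain k where k: "pV v < of_nat k * ennreal (1 / real (Suc n))"
      using ennreal_of_nat_mult_unbounded[OF pV, of "1 / real (Suc n)"] by auto
    obtain F where "finite F" "F \<subseteq> J n" "card F = k"
      using infinite_arbitrarily_large[OF \<open>infinite (J n)\<close>] by blast
    then show False using card_le[of F n] k by auto
  qed
  then have "countable (\<Union>n. J n)" by (intro countable_UN) (auto intro: countable_finite)
  moreover have "{x. \<not> isCont v x} \<subseteq> (\<Union>n. J n)"
  proof
    fix x assume "x \<in> {x. \<not> isCont v x}"
    then obtain e where e: "0 < e" "\<And>\<delta>. 0 < \<delta> \<Longrightarrow> \<exists>y. dist y x < \<delta> \<and> \<not> dist (v y) (v x) < e"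
      unfolding continuous_at_eps_delta by blast
    obtain n where n: "1 / real (Suc n) < e" using nat_approx_posE[OF e(1)] by auto
    have "\<exists>y\<in>ball x \<delta>. 1 / real (Suc n) \<le> \<bar>v y - v x\<bar>" if pos: "0 < \<delta>" for \<delta>
    proof -
      obtain y where "dist y x < \<delta>" "\<not> dist (v y) (v x) < e" using e(2)[OF pos] by blast
      then show ?thesis using n by (intro bexI[of _ y]) (auto simp: dist_real_def dist_commute)
    qed
    then have "x \<in> J n" by (auto simp: J_def)
    then show "x \<in> (\<Union>n. J n)" by blast
  qed
  ultimately show ?thesis by (rule countable_subset[rotated])
qed

text \<open>Classes of joinable points are open, so connectedness leaves only one. In particular
  \<open>v\<close> is bounded when \<open>pV v\<close> is finite.\<close>

lemma joinable_UNIV: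
  fixes x y :: "'a::complete_space"
  assumes con: "connected (UNIV :: 'a set)" and fin: "emeasure hausdorff1 (UNIV :: 'a set) < \<infinity>"
  shows "joinable UNIV x y"
proof -
  define U where "U = {z. joinable UNIV x z}"
  have *: "\<exists>\<delta>>0. \<forall>w\<in>ball z \<delta>. joinable UNIV z w" for z :: 'a
    using locally_joinable[OF con fin zero_less_one, of z] joinable_mono by blast
  have "open U"
    unfolding open_contains_ball
  proof
    fix z assume "z \<in> U"
    then show "\<exists>e>0. ball z e \<subseteq> U"
      using *[of z] joinable_trans unfolding U_def by blast
  qed
  moreover have "open (- U)"
    unfolding open_contains_ball
  proof
    fix z assume z: "z \<in> - U"
    obtain \<delta> where \<delta>: "0 < \<delta>" "\<forall>w\<in>ball z \<delta>. joinable UNIV z w" using *[of z] by blast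
    have "ball z \<delta> \<subseteq> - U"
    proof
      fix w assume "w \<in> ball z \<delta>"
      then have "joinable UNIV w z" using \<delta>(2) joinable_sym by blast
      then show "w \<in> - U" using z joinable_trans unfolding U_def by blast
    qed
    then show "\<exists>e>0. ball z e \<subseteq> - U" using \<delta>(1) by blast
  qed
  moreover have "x \<in> U" by (simp add: U_def joinable_refl)
  ultimately have "U = UNIV"
    using con unfolding connected_clopen by (auto simp: openin_open_eq closed_def)
  then show ?thesis by (auto simp: U_def)
qed

lemma ex_finite_cut_set:
  assumes con: "connected (UNIV :: 'a::complete_space set)"
    and fin: "emeasure hausdorff1 (UNIV :: 'a::complete_space set) < \<infinity>"
    and "countable (J :: 'a::complete_space set)" and "0 < (\<eta>::real)"
  obtains Q where "finite Q" "Q \<inter> J = {}" "\<And>y z. joinable (- Q) y z \<Longrightarrow> dist y z \<le> \<eta>"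
proof -
  \<comment> \<open>A path that starts within \<open>h\<close> of a centre and cannot cross a sphere
    of radius below \<open>2 * h\<close> around it has its ends less than \<open>3 * h\<close>
    apart.\<close>
  define h where "h = \<eta> / 4"
  have h: "0 < h" using \<open>0 < \<eta>\<close> by (simp add: h_def)
  have "compact (UNIV :: 'a set)" using con fin by (rule compact_UNIV_if_hausdorff1_finite)
  then obtain k :: "'a set" where k: "finite k" "UNIV \<subseteq> (\<Union>x\<in>k. ball x h)"
    unfolding compact_eq_totally_bounded using h by blast
  \<comment> \<open>Finiteness of the sphere and avoidance of \<open>J\<close> each exclude only a
    null set of radii, while the interval has positive length.\<close>
  have "\<exists>\<rho>. h < \<rho> \<and> \<rho> < 2 * h \<and> finite {x. dist c x = \<rho>} \<and> \<rho> \<notin> dist c ` J" for c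
  proof (rule ccontr)
    assume no: "\<not> ?thesis"
    have "AE \<rho> in lborel. \<rho> \<notin> dist c ` J"
      using \<open>countable J\<close> by (intro AE_not_in countable_imp_null_set_lborel) simp
    with AE_finite_sphere[OF fin, of c] have "AE \<rho> in lborel. \<rho> \<notin> {h<..<2*h}"
      by eventually_elim (use no in auto)
    then have "emeasure lborel {h<..<2*h} = 0"
      by (subst (asm) AE_iff_measurable[of "{h<..<2*h}"]) auto
    then show False using h by simp
  qed
  then obtain \<rho> where \<rho>: "\<And>c. h < \<rho> c" "\<And>c. \<rho> c < 2 * h" "\<And>c. finite {x. dist c x = \<rho> c}"
    "\<And>c. \<rho> c \<notin> dist c ` J" by metis
  define Q where "Q = (\<Union>c\<in>k. {x. dist c x = \<rho> c})"
  show ?thesis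
  proof (rule that)
    show "finite Q" unfolding Q_def using k(1) \<rho>(3) by blast
    have "x \<notin> J" if "x \<in> Q" for x
    proof
      assume "x \<in> J"
      obtain c where "dist c x = \<rho> c" using \<open>x \<in> Q\<close> by (auto simp: Q_def)
      then have "\<rho> c \<in> dist c ` J" using \<open>x \<in> J\<close> by (metis imageI)
      then show False using \<rho>(4) by blast
    qed
    then show "Q \<inter> J = {}" by blast
    fix y z assume yz: "joinable (- Q) y z"
    have "y \<in> (\<Union>x\<in>k. ball x h)" using k(2) by blast
    then obtain c where c: "c \<in> k" "dist c y < h" by auto
    obtain L \<gamma> where g: "0 \<le> (L::real)" "1-lipschitz_on {0..L} \<gamma>" "\<gamma> 0 = y" "\<gamma> L = z" "\<gamma> ` {0..L} \<subseteq> - Q"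
      using yz by (rule joinableE)
    have "dist c z < \<rho> c"
    proof (rule ccontr)
      assume "\<not> ?thesis"
      moreover have "continuous_on {0..L} (\<lambda>s. dist c (\<gamma> s))"
        using lipschitz_on_continuous_on[OF g(2)] by (intro continuous_intros)
      ultimately obtain s where "0 \<le> s" "s \<le> L" "dist c (\<gamma> s) = \<rho> c"
        using IVT'[of "\<lambda>s. dist c (\<gamma> s)" 0 "\<rho> c" L] c(2) \<rho>(1)[of c] g(1,3,4) by auto
      then have "\<gamma> s \<in> Q" using c(1) by (auto simp: Q_def)
      moreover have "\<gamma> s \<in> \<gamma> ` {0..L}" using \<open>0 \<le> s\<close> \<open>s \<le> L\<close> by simp
      ultimately show False using g(5) by blast
    qed
    then show "dist y z \<le> \<eta>"
      using c(2) \<rho>(2)[of c] dist_triangle[of y z c] \<open>0 < \<eta>\<close> by (simp add: h_def dist_commute)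
  qed
qed

text \<open>The cells are the classes of mutually joinable points of the complement of \<open>Q\<close>, listed along a
  dense sequence; empty cells get the empty interval \<open>{1..0}\<close>.\<close>

lemma ex_cells:
  fixes v :: "'a::complete_space \<Rightarrow> real"
  assumes con: "connected (UNIV :: 'a set)" and fin: "emeasure hausdorff1 (UNIV :: 'a set) < \<infinity>"
    and pV: "pV v < \<infinity>" and Q: "finite Q" "\<And>y z. joinable (- Q) y z \<Longrightarrow> dist y z \<le> \<eta>"
  obtains E :: "nat \<Rightarrow> 'a set" and a b :: "nat \<Rightarrow> real"
  where "\<And>i x y. x \<in> E i \<Longrightarrow> y \<in> E i \<Longrightarrow> dist x y \<le> \<eta>"
    "\<And>x t. x \<notin> Q \<Longrightarrow> x \<in> frontier {x. t < v x} \<Longrightarrow> \<exists>i. x \<in> E i \<and> a i \<le> t \<and> t \<le> b i"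
    "(\<Sum>i. ennreal (b i - a i)) \<le> pV v"
proof -
  obtain P where P: "pV v = ennreal P" "0 \<le> P" using pV by (cases "pV v") auto
  \<comment> \<open>Boundedness makes the real \<open>Inf\<close> and \<open>Sup\<close> of
    \<open>v\<close> over a cell meaningful.\<close>
  have v_bdd: "v y - v x \<le> P" for x y
    using joinable_le_pV[OF joinable_UNIV[OF con fin], of v y x] P by (simp add: abs_le_iff)
  obtain d :: "nat \<Rightarrow> 'a" where d: "\<And>x e. 0 < e \<Longrightarrow> \<exists>n. dist (d n) x < e"
    using hausdorff1_finite_dense_sequence[OF fin] by blast
  define J where "J = joinable (- Q)"
  have nhd: "\<exists>\<delta>>0. \<forall>y\<in>ball x \<delta>. J x y" if "x \<notin> Q" for x
  proof -
    have "open (- Q)" using Q(1) by (simp add: finite_imp_closed open_Compl)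
    then obtain \<epsilon> where \<epsilon>: "0 < \<epsilon>" "ball x \<epsilon> \<subseteq> - Q" using \<open>x \<notin> Q\<close> openE by blast
    then show ?thesis
      using locally_joinable[OF con fin \<epsilon>(1), of x] joinable_mono[OF _ \<epsilon>(2)] unfolding J_def by blast
  qed
  define E where "E i = (if \<forall>j<i. \<not> J (d j) (d i) then {z. J (d i) z} else {})" for i
  define a where "a i = (if E i = {} then 1 else Inf (v ` E i))" for i
  define b where "b i = (if E i = {} then 0 else Sup (v ` E i))" for i
  have bdd: "bdd_below (v ` E i)" "bdd_above (v ` E i)" if "E i \<noteq> {}" for i
  proof -
    have "s - t \<le> P" if "s \<in> v ` E i" "t \<in> v ` E i" for s t
      using that v_bdd by auto
    then show "bdd_below (v ` E i)" "bdd_above (v ` E i)"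
      using bdd_Sup_minus_Inf_le[of "v ` E i" P] \<open>E i \<noteq> {}\<close> by simp_all
  qed
  have E_join: "joinable (E i) x y" if "x \<in> E i" "y \<in> E i" for i x y
  proof -
    have E: "E i = {z. joinable (- Q) (d i) z}" using that by (auto simp: E_def J_def split: if_splits)
    have "joinable (E i) (d i) z" if "z \<in> E i" for z
      using joinable_within_class[of "- Q" "d i" z] that unfolding E by simp
    from joinable_trans[OF joinable_sym[OF this[OF that(1)]] this[OF that(2)]] show ?thesis .
  qed
  have E_disj: "disjoint_family E"
  proof -
    have "E j \<inter> E i = {}" if "j < i" for i j
    proof (rule ccontr)
      assume "E j \<inter> E i \<noteq> {}"
      then obtain z where "J (d j) z" "J (d i) z" "\<not> J (d j) (d i)"
        using \<open>j < i\<close> by (auto simp: E_def split: if_splits)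
      then show False using joinable_trans[OF _ joinable_sym] unfolding J_def by blast
    qed
    then show ?thesis unfolding disjoint_family_on_def by (metis Int_commute linorder_neqE_nat)
  qed
  show ?thesis
  proof (rule that[of E a b])
    show "dist x y \<le> \<eta>" if "x \<in> E i" "y \<in> E i" for i x y
    proof -
      have "J (d i) x" "J (d i) y" using that by (auto simp: E_def split: if_splits)
      then have "joinable (- Q) x y" unfolding J_def using joinable_sym joinable_trans by blast
      then show ?thesis by (rule Q(2))
    qed
    show "\<exists>i. x \<in> E i \<and> a i \<le> t \<and> t \<le> b i" if x: "x \<notin> Q" "x \<in> frontier {x. t < v x}" for x t
    proof -
      obtain \<delta> where \<delta>: "0 < \<delta>" "\<forall>y\<in>ball x \<delta>. J x y" using nhd[OF x(1)] by blast
      obtain n where "dist (d n) x < \<delta>" using d[OF \<delta>(1)] by blast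
      then have "J x (d n)" using \<delta>(2) by (simp add: dist_commute)
      then have ex: "J (d n) x" unfolding J_def by (rule joinable_sym)
      define i where "i = (LEAST n. J (d n) x)"
      have i: "J (d i) x" unfolding i_def using ex by (rule LeastI)
      have "\<not> J (d j) (d i)" if "j < i" for j
      proof
        assume "J (d j) (d i)"
        then have "J (d j) x" using i joinable_trans unfolding J_def by blast
        then show False using that not_less_Least unfolding i_def by blast
      qed
      then have E: "E i = {z. J (d i) z}" by (simp add: E_def)
      \<comment> \<open>A whole ball around \<open>x\<close> belongs to its cell, so values of
        \<open>v\<close> above \<open>t\<close> and values not above \<open>t\<close> both occur in
        that cell.\<close>
      have sub: "ball x \<delta> \<subseteq> E i"
      proof
        fix y assume "y \<in> ball x \<delta>"
        then have "J x y" using \<delta>(2) by blast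
        then show "y \<in> E i" unfolding E using i joinable_trans unfolding J_def by blast
      qed
      have "x \<in> E i" using sub \<delta>(1) by auto
      then have ne: "E i \<noteq> {}" by auto
      obtain y z where yz: "t < v y" "dist x y < \<delta>" "\<not> t < v z" "dist x z < \<delta>"
        using x(2) \<delta>(1) unfolding frontier_straddle by blast
      have "y \<in> E i" "z \<in> E i" using yz sub by (auto simp: subset_iff)
      then have "a i \<le> v z" "v y \<le> b i"
        using bdd[OF ne] ne by (auto simp: a_def b_def intro: cInf_lower cSup_upper)
      then show ?thesis using \<open>x \<in> E i\<close> yz by (intro exI[of _ i]) auto
    qed
    show "(\<Sum>i. ennreal (b i - a i)) \<le> pV v"
    proof (rule suminf_le_const)
      fix n
      show "(\<Sum>i<n. ennreal (b i - a i)) \<le> pV v"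
      proof (rule ennreal_le_epsilon)
        fix e :: real assume "0 < e"
        \<comment> \<open>Near-extremal points lose \<open>e'\<close> at each end of the interval of
          a cell, hence at most \<open>e\<close> over the \<open>n\<close> cells considered.\<close>
        define e' where "e' = e / (2 * real (Suc n))"
        have e': "0 < e'" "real n * (2 * e') \<le> e" using \<open>0 < e\<close> by (auto simp: e'_def field_simps)
        define I where "I = {i. i < n \<and> E i \<noteq> {}}"
        have "\<exists>y z. y \<in> E i \<and> z \<in> E i \<and> b i - a i \<le> \<bar>v z - v y\<bar> + 2 * e'" if "i \<in> I" for i
        proof -
          have ne: "v ` E i \<noteq> {}" using that by (simp add: I_def)
          obtain y where y: "y \<in> E i" "v y < a i + e'"
            using cInf_lessD[OF ne, of "a i + e'"] e' ne by (auto simp: a_def)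
          obtain z where z: "z \<in> E i" "b i - e' < v z"
            using less_cSupD[OF ne, of "b i - e'"] e' ne by (auto simp: b_def)
          show ?thesis using y z by (intro exI[of _ y] exI[of _ z]) auto
        qed
        then obtain y z where yz: "\<And>i. i \<in> I \<Longrightarrow> y i \<in> E i" "\<And>i. i \<in> I \<Longrightarrow> z i \<in> E i"
          "\<And>i. i \<in> I \<Longrightarrow> b i - a i \<le> \<bar>v (z i) - v (y i)\<bar> + 2 * e'" by metis
        have "(\<Sum>i<n. ennreal (b i - a i)) = (\<Sum>i\<in>I. ennreal (b i - a i))"
          by (rule sum.mono_neutral_right) (auto simp: I_def a_def b_def ennreal_neg)
        also have "\<dots> \<le> (\<Sum>i\<in>I. ennreal \<bar>v (z i) - v (y i)\<bar> + ennreal (2 * e'))"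
          using yz(3) e' by (intro sum_mono) (simp add: ennreal_plus[symmetric] ennreal_leI del: ennreal_plus)
        also have "\<dots> = (\<Sum>i\<in>I. ennreal \<bar>v (z i) - v (y i)\<bar>) + (\<Sum>i\<in>I. ennreal (2 * e'))"
          by (rule sum.distrib)
        also have "\<dots> \<le> pV v + ennreal e"
        proof (rule add_mono)
          show "(\<Sum>i\<in>I. ennreal \<bar>v (z i) - v (y i)\<bar>) \<le> pV v"
            using yz E_join E_disj
            by (intro sum_joinable_le_pV[where E = E]) (auto simp: I_def disjoint_family_on_def)
          have "(\<Sum>i\<in>I. ennreal (2 * e')) \<le> (\<Sum>i<n. ennreal (2 * e'))"
            by (rule sum_mono2) (auto simp: I_def)
          also have "\<dots> = ennreal (real n * (2 * e'))"
            using e' by (simp add: ennreal_of_nat_eq_real_of_nat ennreal_mult)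
          also have "\<dots> \<le> ennreal e" using e' by (intro ennreal_leI)
          finally show "(\<Sum>i\<in>I. ennreal (2 * e')) \<le> ennreal e" .
        qed
        finally show "(\<Sum>i<n. ennreal (b i - a i)) \<le> pV v + ennreal e" .
      qed
    qed simp
  qed
qed

text \<open>The points of a cut set are continuity points of \<open>v\<close>, so the frontier of
  \<open>{x. t < v x}\<close> can contain one only if \<open>t\<close> is the value there. The
  countable set \<open>Z\<close> collects these values.\<close>

lemma frontier_superlevel_indicatrix:
  fixes v :: "'a::complete_space \<Rightarrow> real"
  assumes con: "connected (UNIV :: 'a set)" and fin: "emeasure hausdorff1 (UNIV :: 'a set) < \<infinity>"
    and pV: "pV v < \<infinity>"
  obtains H :: "real \<Rightarrow> ennreal" and Z where "H \<in> borel_measurable borel" "(\<integral>\<^sup>+ t. H t \<partial>lborel) \<le> pV v"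
    "countable Z" "\<And>t. t \<notin> Z \<Longrightarrow> H t < \<infinity> \<Longrightarrow>
      finite (frontier {x. t < v x}) \<and> of_nat (card (frontier {x. t < v x})) \<le> H t"
proof -
  define J where "J = {x. \<not> isCont v x}"
  have "countable J" unfolding J_def using con fin pV by (rule countable_discontinuities)
  have "\<exists>Q. finite Q \<and> Q \<inter> J = {} \<and> (\<forall>y z. joinable (- Q) y z \<longrightarrow> dist y z \<le> 1 / real (Suc m))" for m
    by (rule ex_finite_cut_set[OF con fin \<open>countable J\<close>, of "1 / real (Suc m)"]) auto
  then obtain Q where Q: "\<And>m. finite (Q m)" "\<And>m. Q m \<inter> J = {}"
    "\<And>m y z. joinable (- Q m) y z \<Longrightarrow> dist y z \<le> 1 / real (Suc m)" by metis
  define cells where "cells m E a b \<longleftrightarrow> (\<forall>i x y. x \<in> E i \<longrightarrow> y \<in> E i \<longrightarrow> dist x y \<le> 1 / real (Suc m)) \<and>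
    (\<forall>x t. x \<notin> Q m \<longrightarrow> x \<in> frontier {x. t < v x} \<longrightarrow> (\<exists>i. x \<in> E i \<and> a i \<le> t \<and> t \<le> b i)) \<and>
    (\<Sum>i::nat. ennreal (b i - a i)) \<le> pV v" for m E a b
  have "\<exists>E a b. cells m E a b" for m
    unfolding cells_def by (rule ex_cells[OF con fin pV Q(1)[of m] Q(3)[of m]]) (assumption, blast)
  then obtain E a b where cells: "\<And>m. cells m (E m) (a m) (b m)" by metis
  have E: "\<And>m i x y. x \<in> E m i \<Longrightarrow> y \<in> E m i \<Longrightarrow> dist x y \<le> 1 / real (Suc m)"
    "\<And>m x t. x \<notin> Q m \<Longrightarrow> x \<in> frontier {x. t < v x} \<Longrightarrow> \<exists>i. x \<in> E m i \<and> a m i \<le> t \<and> t \<le> b m i"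
    "\<And>m. (\<Sum>i::nat. ennreal (b m i - a m i)) \<le> pV v"
    using cells unfolding cells_def by blast+
  define Z where "Z = (\<Union>m. v ` Q m)"
  have "countable Z" unfolding Z_def by (rule countable_UN) (simp_all add: countable_finite Q(1))
  have avoid: "x \<notin> Q m" if t: "t \<notin> Z" and x: "x \<in> frontier {x. t < v x}" for t x m
  proof
    assume "x \<in> Q m"
    then have "v x \<noteq> t" using t by (auto simp: Z_def)
    have "isCont v x" using Q(2)[of m] \<open>x \<in> Q m\<close> by (auto simp: J_def)
    then obtain \<delta> where \<delta>: "0 < \<delta>" "\<And>y. dist y x < \<delta> \<Longrightarrow> dist (v y) (v x) < \<bar>v x - t\<bar>"
      using \<open>v x \<noteq> t\<close> unfolding continuous_at_eps_delta by (metis zero_less_abs_iff right_minus_eq)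
    obtain y z where "t < v y" "dist x y < \<delta>" "\<not> t < v z" "dist x z < \<delta>"
      using x \<delta>(1) unfolding frontier_straddle by blast
    then show False using \<delta>(2)[of y] \<delta>(2)[of z] by (auto simp: dist_real_def dist_commute)
  qed
  have lim: "(\<lambda>m. 1 / real (Suc m)) \<longlonglongrightarrow> 0"
    using LIMSEQ_inverse_real_of_nat by (simp add: inverse_eq_divide)
  have cover: "\<exists>i. x \<in> E m i \<and> a m i \<le> t \<and> t \<le> b m i" if "t \<notin> Z" "x \<in> frontier {x. t < v x}" for m t x
    using avoid[OF that] that(2) by (rule E(2))
  have "\<exists>H. H \<in> borel_measurable borel \<and> (\<integral>\<^sup>+ t. H t \<partial>lborel) \<le> pV v \<and>
    (\<forall>t. t \<notin> Z \<longrightarrow> H t < \<infinity> \<longrightarrow>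
      finite (frontier {x. t < v x}) \<and> of_nat (card (frontier {x. t < v x})) \<le> H t)"
    by (rule indicatrix_bound[of E "\<lambda>m. 1 / real (Suc m)" _ _ a b]) (fact E lim cover)+
  then show ?thesis using \<open>countable Z\<close> that by blast
qed

section \<open>Approximation of the level sets\<close>

text \<open>The distance to \<open>F\<close>, rescaled around each \<open>x\<close> by its own
  radius \<open>r x\<close> and truncated at 1; the inserted 1 also gives the minimum a value for
  empty \<open>F\<close>.\<close>

definition cutoff :: "'a::metric_space set \<Rightarrow> ('a \<Rightarrow> real) \<Rightarrow> 'a \<Rightarrow> real" where
  "cutoff F r y = Min (insert 1 ((\<lambda>x. dist x y / r x) ` F))"

text \<open>A sum instead of a maximum: it dominates the slope of the minimum, and its integral
  splits over the points of \<open>F\<close>.\<close>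

definition cutoff_gradient :: "'a::metric_space set \<Rightarrow> ('a \<Rightarrow> real) \<Rightarrow> 'a \<Rightarrow> ennreal" where
  "cutoff_gradient F r y = (\<Sum>x\<in>F. indicator (ball x (r x)) y * ennreal (1 / r x))"

lemma cutoff_le:
  assumes "finite F"
  shows "cutoff F r y \<le> 1" "x \<in> F \<Longrightarrow> cutoff F r y \<le> dist x y / r x"
  unfolding cutoff_def using assms by (auto intro: Min_le)

lemma cutoff_cases:
  assumes "finite F"
  obtains "cutoff F r y = 1" | x where "x \<in> F" "cutoff F r y = dist x y / r x"
proof -
  have "cutoff F r y \<in> insert 1 ((\<lambda>x. dist x y / r x) ` F)"
    unfolding cutoff_def using assms by (intro Min_in) auto
  then show ?thesis using that by auto
qed

lemma cutoff_nonneg: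
  assumes "finite F" "\<And>x. x \<in> F \<Longrightarrow> 0 < r x"
  shows "0 \<le> cutoff F r y"
  using assms(1) by (rule cutoff_cases[of F r y]) (use assms(2) in \<open>auto simp: less_imp_le\<close>)

lemma cutoff_eq_0:
  assumes "finite F" "\<And>x. x \<in> F \<Longrightarrow> 0 < r x" "y \<in> F"
  shows "cutoff F r y = 0"
  using cutoff_le(2)[OF assms(1,3), of r y] cutoff_nonneg[of F r y] assms by simp

lemma cutoff_eq_1:
  assumes "finite F" "\<And>x. x \<in> F \<Longrightarrow> 0 < r x" "\<And>x. x \<in> F \<Longrightarrow> y \<notin> ball x (r x)"
  shows "cutoff F r y = 1"
proof (rule cutoff_cases[OF assms(1), of r y])
  fix x assume x: "x \<in> F" "cutoff F r y = dist x y / r x"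
  have "0 < r x" "r x \<le> dist x y" using assms(2,3)[OF x(1)] by auto
  then have "1 \<le> dist x y / r x" by (simp add: le_divide_eq)
  then show ?thesis using x(2) cutoff_le(1)[OF assms(1), of r y] by linarith
qed

lemma continuous_on_cutoff:
  assumes "finite F" "\<And>x. x \<in> F \<Longrightarrow> 0 < r x"
  shows "continuous_on UNIV (cutoff F r)"
  using assms
proof (induction F rule: finite_induct)
  case empty
  then show ?case by (simp add: cutoff_def)
next
  case (insert x F)
  have "cutoff (insert x F) r y = min (dist x y / r x) (cutoff F r y)" for y
    unfolding cutoff_def using insert(1) by (subst image_insert, subst insert_commute, subst Min_insert) auto
  then have "cutoff (insert x F) r = (\<lambda>y. min (dist x y / r x) (cutoff F r y))" by auto
  moreover have "r x \<noteq> 0" using insert.prems[of x] by auto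
  ultimately show ?case using insert by (auto intro!: continuous_intros)
qed

text \<open>Until \<open>dist x (\<gamma> s) / r\<close> reaches the level \<open>c\<close>, at most
  1, the path is inside the ball; gaining this height from either end takes a parameter length of at
  least \<open>r\<close> times the gain.\<close>

lemma dist_increase_le_integral:
  fixes \<gamma> :: "real \<Rightarrow> 'a::metric_space"
  assumes lip: "1-lipschitz_on {p..q} \<gamma>" and "p \<le> q" "0 < r" "c \<le> 1"
    and c: "c \<le> dist x (\<gamma> q) / r \<or> c \<le> dist x (\<gamma> p) / r"
  shows "ennreal (c - min (dist x (\<gamma> p) / r) (dist x (\<gamma> q) / r))
    \<le> (\<integral>\<^sup>+ s\<in>{p..q}. indicator (ball x r) (\<gamma> s) * ennreal (1 / r) \<partial>lborel)"
proof -
  let ?I = "\<integral>\<^sup>+ s\<in>{p..q}. indicator (ball x r) (\<gamma> s) * ennreal (1 / r) \<partial>lborel"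
  define f where "f s = dist x (\<gamma> s) / r" for s
  have cont: "continuous_on {p..q} f"
    unfolding f_def using lipschitz_on_continuous_on[OF lip] \<open>0 < r\<close> by (intro continuous_intros) auto
  have f_lip: "f s - f t \<le> \<bar>s - t\<bar> / r" if "s \<in> {p..q}" "t \<in> {p..q}" for s t
  proof -
    have "dist x (\<gamma> s) - dist x (\<gamma> t) \<le> dist (\<gamma> s) (\<gamma> t)"
      using dist_triangle[of x "\<gamma> s" "\<gamma> t"] by (simp add: dist_commute)
    also have "\<dots> \<le> \<bar>s - t\<bar>" using lipschitz_onD[OF lip that] by (simp add: dist_real_def)
    finally show ?thesis using \<open>0 < r\<close> by (simp add: f_def diff_divide_distrib[symmetric] divide_right_mono)
  qed
  \<comment> \<open>The parameters at which the level is at least \<open>c\<close>. Its first and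
    last elements delimit the stretches inside the ball next to the two ends of the path.\<close>
  define A where "A = {p..q} \<inter> f -` {c..}"
  have "closed A" unfolding A_def using cont by (intro continuous_closed_preimage) auto
  then have A: "compact A" using compact_Int_closed[of "{p..q}" A] by (simp add: A_def Int_absorb1 Int_assoc[symmetric])
  have main: "ennreal (c - f e) \<le> ?I"
    if e: "e \<in> {p..q}" and m: "m \<in> A" and I: "{a<..<b} \<subseteq> {p..q} - A" "a \<le> b" "\<bar>m - e\<bar> = b - a" for e m a b
  proof -
    have "c - f e \<le> (b - a) / r"
      using f_lip[of m e] m e I(3) by (auto simp: A_def)
    then have "ennreal (c - f e) \<le> ennreal (1 / r) * ennreal (b - a)"
      using \<open>0 < r\<close> I(2) by (simp add: ennreal_mult[symmetric] ennreal_leI)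
    also have "\<dots> = (\<integral>\<^sup>+ s. ennreal (1 / r) * indicator {a<..<b} s \<partial>lborel)"
      using I(2) by (subst nn_integral_cmult_indicator) auto
    also have "\<dots> \<le> ?I"
    proof (rule nn_integral_mono)
      fix s
      show "ennreal (1 / r) * indicator {a<..<b} s \<le> indicator (ball x r) (\<gamma> s) * ennreal (1 / r) * indicator {p..q} s"
      proof (cases "s \<in> {a<..<b}")
        case True
        then have "s \<in> {p..q}" "f s < c" using I(1) by (auto simp: A_def)
        then have "dist x (\<gamma> s) < r" using \<open>c \<le> 1\<close> \<open>0 < r\<close> using less_le_trans[of "f s" c 1] by (simp add: f_def)
        then show ?thesis using \<open>s \<in> {p..q}\<close> by (simp add: indicator_def)
      qed simp
    qed
    finally show ?thesis .
  qed
  show ?thesis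
  proof (cases "A = {}")
    case True
    then show ?thesis using c \<open>p \<le> q\<close> by (auto simp: A_def f_def)
  next
    case False
    obtain m1 where m1: "m1 \<in> A" "\<And>s. s \<in> A \<Longrightarrow> m1 \<le> s" using compact_attains_inf[OF A False] by blast
    obtain m2 where m2: "m2 \<in> A" "\<And>s. s \<in> A \<Longrightarrow> s \<le> m2" using compact_attains_sup[OF A False] by blast
    have m: "m1 \<in> {p..q}" "m2 \<in> {p..q}" using m1(1) m2(1) by (auto simp: A_def)
    have "ennreal (c - f p) \<le> ?I"
    proof (rule main[of p m1 p m1])
      show "{p<..<m1} \<subseteq> {p..q} - A" using m by (auto dest!: m1(2))
    qed (use m1(1) m in auto)
    moreover have "ennreal (c - f q) \<le> ?I"
    proof (rule main[of q m2 m2 q])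
      show "{m2<..<q} \<subseteq> {p..q} - A" using m by (auto dest!: m2(2))
    qed (use m2(1) m in auto)
    ultimately show ?thesis unfolding f_def[symmetric] by (auto simp: min_def)
  qed
qed

text \<open>The increase is charged to a single ball, around the point that realizes the minimum at
  the lower end; at the other end the cutoff is at most the rescaled distance from the same
  point.\<close>

lemma cutoff_along_path:
  fixes \<gamma> :: "real \<Rightarrow> 'a::metric_space"
  assumes F: "finite F" "\<And>x. x \<in> F \<Longrightarrow> 0 < r x" and lip: "1-lipschitz_on {p..q} \<gamma>" and "p \<le> q"
  shows "ennreal \<bar>cutoff F r (\<gamma> q) - cutoff F r (\<gamma> p)\<bar> \<le> (\<integral>\<^sup>+ s\<in>{p..q}. cutoff_gradient F r (\<gamma> s) \<partial>lborel)"
proof -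
  have *: "ennreal (cutoff F r y - cutoff F r z) \<le> (\<integral>\<^sup>+ s\<in>{p..q}. cutoff_gradient F r (\<gamma> s) \<partial>lborel)"
    if yz: "y = \<gamma> p \<and> z = \<gamma> q \<or> y = \<gamma> q \<and> z = \<gamma> p" for y z
  proof (rule cutoff_cases[OF F(1), of r z])
    assume "cutoff F r z = 1"
    then have "cutoff F r y - cutoff F r z \<le> 0" using cutoff_le(1)[OF F(1), of r y] by simp
    then show ?thesis by (simp add: ennreal_neg)
  next
    fix x assume x: "x \<in> F" "cutoff F r z = dist x z / r x"
    have "cutoff F r y - cutoff F r z \<le> cutoff F r y - min (dist x (\<gamma> p) / r x) (dist x (\<gamma> q) / r x)"
      using x yz by auto
    then have "ennreal (cutoff F r y - cutoff F r z)
        \<le> ennreal (cutoff F r y - min (dist x (\<gamma> p) / r x) (dist x (\<gamma> q) / r x))"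
      by (rule ennreal_leI)
    also have "\<dots> \<le> (\<integral>\<^sup>+ s\<in>{p..q}. indicator (ball x (r x)) (\<gamma> s) * ennreal (1 / r x) \<partial>lborel)"
      using cutoff_le(1)[OF F(1), of r y] cutoff_le(2)[OF F(1) x(1), of r y] x(1) yz
      by (intro dist_increase_le_integral lip \<open>p \<le> q\<close> F(2)) auto
    also have "\<dots> \<le> (\<integral>\<^sup>+ s\<in>{p..q}. cutoff_gradient F r (\<gamma> s) \<partial>lborel)"
      unfolding cutoff_gradient_def using F(1) x(1)
      by (intro nn_integral_mono mult_right_mono member_le_sum) auto
    finally show ?thesis .
  qed
  show ?thesis
    using *[of "\<gamma> q" "\<gamma> p"] *[of "\<gamma> p" "\<gamma> q"]
    by (cases "cutoff F r (\<gamma> p) \<le> cutoff F r (\<gamma> q)") auto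
qed

text \<open>A curve that joins \<open>E\<close> to its complement meets \<open>frontier E\<close>, where the cutoff vanishes.\<close>

lemma cutoff_indicator_along_curve:
  fixes \<gamma> :: "real \<Rightarrow> 'a::metric_space"
  assumes F: "finite (frontier E)" "\<And>x. x \<in> frontier E \<Longrightarrow> 0 < r x" and arc: "arclength_curve l \<gamma>"
  defines "w \<equiv> \<lambda>y. cutoff (frontier E) r y * indicat_real E y"
  shows "ennreal \<bar>w (\<gamma> l) - w (\<gamma> 0)\<bar> \<le> (\<integral>\<^sup>+ s\<in>{0..l}. cutoff_gradient (frontier E) r (\<gamma> s) \<partial>lborel)"
proof -
  let ?I = "\<lambda>J. \<integral>\<^sup>+ s\<in>J. cutoff_gradient (frontier E) r (\<gamma> s) \<partial>lborel"
  let ?\<phi> = "cutoff (frontier E) r"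
  have "0 \<le> l" using arc by (simp add: arclength_curve_def)
  have lip: "1-lipschitz_on {0..l} \<gamma>" using arc by (rule arclength_curve_lipschitz)
  show ?thesis
  proof (cases "\<gamma> ` {0..l} \<inter> frontier E = {}")
    case True
    have "connected (\<gamma> ` {0..l})"
      using lipschitz_on_continuous_on[OF lip] by (intro connected_continuous_image) auto
    then have "\<gamma> ` {0..l} \<inter> E = {} \<or> \<gamma> ` {0..l} - E = {}"
      using connected_Int_frontier True by blast
    moreover have "\<gamma> 0 \<in> \<gamma> ` {0..l}" "\<gamma> l \<in> \<gamma> ` {0..l}" using \<open>0 \<le> l\<close> by auto
    ultimately have "indicat_real E (\<gamma> l) = indicat_real E (\<gamma> 0)" by (auto simp: indicator_def)
    then have "\<bar>w (\<gamma> l) - w (\<gamma> 0)\<bar> \<le> \<bar>?\<phi> (\<gamma> l) - ?\<phi> (\<gamma> 0)\<bar>"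
      by (auto simp: w_def indicator_def)
    then show ?thesis
      using cutoff_along_path[of "frontier E" r 0 l \<gamma>] F lip \<open>0 \<le> l\<close> by (meson ennreal_leI order_trans)
  next
    case False
    then obtain s where s: "s \<in> {0..l}" "\<gamma> s \<in> frontier E" by blast
    have zero: "?\<phi> (\<gamma> s) = 0" using F s(2) by (intro cutoff_eq_0)
    have pos: "0 \<le> ?\<phi> y" for y
      using F by (intro cutoff_nonneg)
    have sub: "?I I \<le> ?I {0..l}" if "I \<subseteq> {0..l}" for I
      using that by (intro nn_integral_mono mult_left_mono) (auto simp: indicator_def)
    have "ennreal (?\<phi> (\<gamma> 0)) \<le> ?I {0..s}"
      using cutoff_along_path[of "frontier E" r 0 s \<gamma>] F lipschitz_on_subset[OF lip, of "{0..s}"] zero pos s by auto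
    also have "\<dots> \<le> ?I {0..l}"
      using s by (intro sub) auto
    finally have 1: "ennreal (?\<phi> (\<gamma> 0)) \<le> ?I {0..l}" .
    have "ennreal (?\<phi> (\<gamma> l)) \<le> ?I {s..l}"
      using cutoff_along_path[of "frontier E" r s l \<gamma>] F lipschitz_on_subset[OF lip, of "{s..l}"] zero pos s by auto
    also have "\<dots> \<le> ?I {0..l}"
      using s by (intro sub) auto
    finally have 2: "ennreal (?\<phi> (\<gamma> l)) \<le> ?I {0..l}" .
    \<comment> \<open>Both values of \<open>w\<close> lie between 0 and the cutoff, so their
      difference is bounded by a maximum instead of a sum and no factor 2 arises.\<close>
    have "\<bar>w (\<gamma> l) - w (\<gamma> 0)\<bar> \<le> max (?\<phi> (\<gamma> 0)) (?\<phi> (\<gamma> l))"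
      using pos[of "\<gamma> 0"] pos[of "\<gamma> l"] by (auto simp: w_def indicator_def)
    then have "ennreal \<bar>w (\<gamma> l) - w (\<gamma> 0)\<bar> \<le> ennreal (max (?\<phi> (\<gamma> 0)) (?\<phi> (\<gamma> l)))"
      by (rule ennreal_leI)
    also have "\<dots> \<le> ?I {0..l}"
      using 1 2 by (auto simp: max_def)
    finally show ?thesis .
  qed
qed

lemma borel_measurable_cutoff_gradient: "cutoff_gradient F r \<in> borel_measurable borel"
  unfolding cutoff_gradient_def by (intro borel_measurable_sum borel_measurable_times_ennreal borel_measurable_indicator) auto

lemma nn_integral_cutoff_gradient:
  assumes "finite F" "0 \<le> C" "\<And>x. x \<in> F \<Longrightarrow> 0 < r x" "\<And>x. x \<in> F \<Longrightarrow> emeasure hausdorff1 (ball x (r x)) \<le> ennreal (C * r x)"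
  shows "(\<integral>\<^sup>+ y. cutoff_gradient F r y \<partial>hausdorff1) \<le> ennreal (C * real (card F))"
proof -
  have "(\<integral>\<^sup>+ y. cutoff_gradient F r y \<partial>hausdorff1)
      = (\<Sum>x\<in>F. \<integral>\<^sup>+ y. indicator (ball x (r x)) y * ennreal (1 / r x) \<partial>hausdorff1)"
    unfolding cutoff_gradient_def
    by (intro nn_integral_sum borel_measurable_times_ennreal borel_measurable_indicator) auto
  also have "\<dots> = (\<Sum>x\<in>F. emeasure hausdorff1 (ball x (r x)) * ennreal (1 / r x))"
    by (intro sum.cong refl) (subst nn_integral_multc, auto intro!: borel_measurable_indicator)
  also have "\<dots> \<le> (\<Sum>x\<in>F. ennreal C)"
  proof (rule sum_mono)
    fix x assume x: "x \<in> F"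
    have "emeasure hausdorff1 (ball x (r x)) * ennreal (1 / r x) \<le> ennreal (C * r x) * ennreal (1 / r x)"
      using assms(4)[OF x] by (rule mult_right_mono) simp
    also have "\<dots> = ennreal C" using assms(2) assms(3)[OF x] by (simp add: ennreal_mult[symmetric])
    finally show "emeasure hausdorff1 (ball x (r x)) * ennreal (1 / r x) \<le> ennreal C" .
  qed
  also have "\<dots> = ennreal (C * real (card F))"
    using assms(2) by (simp add: ennreal_mult ennreal_of_nat_eq_real_of_nat mult.commute)
  finally show ?thesis .
qed

section \<open>Choice of the radii and of the levels\<close>

lemma Liminf_density_radius:
  fixes x :: "'a::metric_space"
  assumes "Liminf (at_right 0) (\<lambda>r. emeasure hausdorff1 (ball x r) / ennreal r) < ennreal C" and "0 < \<epsilon>"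
  shows "\<exists>r>0. r < \<epsilon> \<and> emeasure hausdorff1 (ball x r) \<le> ennreal (C * r)"
proof -
  have "0 < ennreal C" using assms(1) by (rule order.strict_trans1[rotated]) simp
  then have "0 < C" by simp
  have "\<exists>\<^sub>F r in at_right 0. emeasure hausdorff1 (ball x r) / ennreal r < ennreal C"
    using assms(1) by (rule Liminf_less_imp_frequently)
  moreover have "\<forall>\<^sub>F r in at_right 0. 0 < r \<and> r < \<epsilon>"
    using \<open>0 < \<epsilon>\<close> by (auto simp: eventually_at_right_field)
  ultimately obtain r where r: "emeasure hausdorff1 (ball x r) / ennreal r < ennreal C" "0 < r" "r < \<epsilon>"
    using frequently_ex[OF frequently_eventually_conj] by blast
  have "emeasure hausdorff1 (ball x r) = emeasure hausdorff1 (ball x r) / ennreal r * ennreal r"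
    using r(2) by (simp add: ennreal_divide_times mult_divide_eq_ennreal)
  also have "\<dots> \<le> ennreal C * ennreal r" using r(1) by (intro mult_right_mono) auto
  also have "\<dots> = ennreal (C * r)" using \<open>0 < C\<close> r(2) by (simp add: ennreal_mult)
  finally show ?thesis using r(2,3) by blast
qed

lemma sum_indicator_Ico:
  fixes c h t :: real
  assumes "0 \<le> h"
  shows "(\<Sum>j<n. indicator {c + real j * h..<c + real (Suc j) * h} t :: ennreal) = indicator {c..<c + real n * h} t"
proof (induction n)
  case (Suc n)
  have "c \<le> c + real n * h" "c + real n * h \<le> c + real (Suc n) * h" using assms by (auto simp: algebra_simps)
  then show ?case unfolding sum.lessThan_Suc Suc by (auto simp: indicator_def)
qed simp

text \<open>Averaging over the offset \<open>\<theta>\<close> shows that some grid of mesh \<open>h\<close> does not exceed the mean.\<close>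

lemma ex_good_levels:
  fixes H :: "real \<Rightarrow> ennreal" and h c P :: real
  assumes H: "H \<in> borel_measurable borel" "(\<integral>\<^sup>+ t. H t \<partial>lborel) \<le> ennreal P" and "0 \<le> P"
    and Z: "countable Z" and "0 < h"
  obtains \<theta> where "0 \<le> \<theta>" "\<theta> < h" "\<And>j. j < n \<Longrightarrow> c + \<theta> + real j * h \<notin> Z"
    "(\<Sum>j<n. H (c + \<theta> + real j * h)) * ennreal h \<le> ennreal (P + 1)"
proof (rule ccontr)
  assume no: "\<not> thesis"
  have H_shift: "(\<lambda>\<theta>. H (a + \<theta>)) \<in> borel_measurable borel" for a
    by (rule measurable_compose[OF _ H(1)]) simp
  define \<psi> where "\<psi> \<theta> = (\<Sum>j<n. H (c + real j * h + \<theta>))" for \<theta>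
  have "AE \<theta> in lborel. \<theta> \<notin> (\<Union>j. (\<lambda>z. z - (c + real j * h)) ` Z)"
    using Z by (intro AE_not_in countable_imp_null_set_lborel countable_UN) auto
  \<comment> \<open>If every offset that avoids \<open>Z\<close> failed, integrating over a period
    of length \<open>h\<close> would bound \<open>P + 1\<close> by \<open>P\<close>; the summand 1
    is there to make this absurd.\<close>
  then have "AE \<theta> in lborel. ennreal ((P + 1) / h) * indicator {0..<h} \<theta> \<le> \<psi> \<theta> * indicator {0..<h} \<theta>"
  proof eventually_elim
    case (elim \<theta>)
    have Zj: "c + \<theta> + real j * h \<notin> Z" for j
    proof
      assume "c + \<theta> + real j * h \<in> Z"
      then have "(c + \<theta> + real j * h) - (c + real j * h) \<in> (\<lambda>z. z - (c + real j * h)) ` Z" by (rule imageI)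
      then show False using elim by (auto simp: algebra_simps)
    qed
    show ?case
    proof (cases "\<theta> \<in> {0..<h}")
      case True
      then have "\<not> (\<Sum>j<n. H (c + \<theta> + real j * h)) * ennreal h \<le> ennreal (P + 1)"
        using no that[of \<theta>] Zj by auto
      moreover have "(\<Sum>j<n. H (c + \<theta> + real j * h)) = \<psi> \<theta>"
        unfolding \<psi>_def by (intro sum.cong) (auto simp: algebra_simps)
      ultimately have "ennreal (P + 1) \<le> \<psi> \<theta> * ennreal h" by simp
      then have "ennreal (P + 1) * ennreal (1 / h) \<le> \<psi> \<theta> * ennreal h * ennreal (1 / h)"
        by (rule mult_right_mono) simp
      moreover have "ennreal (P + 1) * ennreal (1 / h) = ennreal ((P + 1) / h)"
        using ennreal_mult[of "P + 1" "1 / h"] \<open>0 < h\<close> \<open>0 \<le> P\<close> by simp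
      moreover have "ennreal h * ennreal (1 / h) = 1"
        using ennreal_mult[of h "1 / h"] \<open>0 < h\<close> by simp
      ultimately show ?thesis using True by (simp add: mult.assoc)
    qed simp
  qed
  then have "(\<integral>\<^sup>+ \<theta>. ennreal ((P + 1) / h) * indicator {0..<h} \<theta> \<partial>lborel)
      \<le> (\<integral>\<^sup>+ \<theta>. \<psi> \<theta> * indicator {0..<h} \<theta> \<partial>lborel)"
    by (rule nn_integral_mono_AE)
  also have "\<dots> = (\<Sum>j<n. \<integral>\<^sup>+ \<theta>. H (c + real j * h + \<theta>) * indicator {0..<h} \<theta> \<partial>lborel)"
    unfolding \<psi>_def sum_distrib_right
    using H_shift by (intro nn_integral_sum borel_measurable_times_ennreal borel_measurable_indicator) auto
  \<comment> \<open>Translation turns the \<open>n\<close> copies of \<open>{0..<h}\<close> into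
    adjacent intervals that tile \<open>{c..<c + real n * h}\<close>.\<close>
  also have "\<dots> = (\<Sum>j<n. \<integral>\<^sup>+ t. H t * indicator {c + real j * h..<c + real (Suc j) * h} t \<partial>lborel)"
  proof (rule sum.cong[OF refl])
    fix j
    have "(\<lambda>t. H t * indicator {c + real j * h..<c + real (Suc j) * h} t) \<in> borel_measurable borel"
      using H(1) by (intro borel_measurable_times_ennreal borel_measurable_indicator) auto
    then have "(\<integral>\<^sup>+ t. H t * indicator {c + real j * h..<c + real (Suc j) * h} t \<partial>lborel)
        = (\<integral>\<^sup>+ \<theta>. H (c + real j * h + \<theta>) * indicator {c + real j * h..<c + real (Suc j) * h} (c + real j * h + \<theta>) \<partial>lborel)"
      by (subst nn_integral_real_affine[of _ 1 "c + real j * h"]) auto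
    also have "\<dots> = (\<integral>\<^sup>+ \<theta>. H (c + real j * h + \<theta>) * indicator {0..<h} \<theta> \<partial>lborel)"
      by (intro nn_integral_cong) (auto simp: indicator_def algebra_simps)
    finally show "(\<integral>\<^sup>+ \<theta>. H (c + real j * h + \<theta>) * indicator {0..<h} \<theta> \<partial>lborel)
        = (\<integral>\<^sup>+ t. H t * indicator {c + real j * h..<c + real (Suc j) * h} t \<partial>lborel)" by simp
  qed
  also have "\<dots> = (\<integral>\<^sup>+ t. (\<Sum>j<n. H t * indicator {c + real j * h..<c + real (Suc j) * h} t) \<partial>lborel)"
    using H(1) by (intro nn_integral_sum[symmetric] borel_measurable_times_ennreal borel_measurable_indicator) auto
  also have "\<dots> = (\<integral>\<^sup>+ t. H t * indicator {c..<c + real n * h} t \<partial>lborel)"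
    using \<open>0 < h\<close> by (simp only: sum_distrib_left[symmetric] sum_indicator_Ico less_imp_le)
  also have "\<dots> \<le> (\<integral>\<^sup>+ t. H t \<partial>lborel)"
    by (intro nn_integral_mono) (auto simp: indicator_def)
  also have "\<dots> \<le> ennreal P" by (rule H(2))
  finally have "(\<integral>\<^sup>+ \<theta>. ennreal ((P + 1) / h) * indicator {0..<h} \<theta> \<partial>lborel) \<le> ennreal P" .
  moreover have "(\<integral>\<^sup>+ \<theta>. ennreal ((P + 1) / h) * indicator {0..<h} \<theta> \<partial>lborel) = ennreal (P + 1)"
    using \<open>0 < h\<close> \<open>0 \<le> P\<close> by (subst nn_integral_cmult_indicator) (auto simp: ennreal_mult[symmetric])
  ultimately show False using \<open>0 \<le> P\<close> by (simp add: ennreal_le_iff)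
qed

text \<open>\<open>h\<close> times the number of grid points below \<open>s\<close> is
  \<open>s - t\<close> rounded up to a multiple of \<open>h\<close>, provided that the grid reaches
  \<open>s\<close>.\<close>

lemma staircase_approx:
  fixes t h s :: real
  assumes "0 < h" "t \<le> s"
  shows "s \<le> t + real n * h \<Longrightarrow> s - t \<le> h * (\<Sum>j<n. indicat_real {..<s} (t + real j * h)) \<and>
    h * (\<Sum>j<n. indicat_real {..<s} (t + real j * h)) \<le> s - t + h"
proof (induction n)
  case 0
  then show ?case using assms by simp
next
  case (Suc n)
  show ?case
  proof (cases "s \<le> t + real n * h")
    case True
    then show ?thesis using Suc.IH by (simp add: indicator_def)
  next
    case False
    have "t + real j * h < s" if "j \<le> n" for j
    proof -
      have "real j * h \<le> real n * h" using that \<open>0 < h\<close> by (intro mult_right_mono) auto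
      then show ?thesis using False by simp
    qed
    then have "(\<Sum>j<Suc n. indicat_real {..<s} (t + real j * h)) = (\<Sum>j<Suc n. 1)"
      by (intro sum.cong) (auto simp: indicator_def)
    then have "h * (\<Sum>j<Suc n. indicat_real {..<s} (t + real j * h)) = h * real (Suc n)" by simp
    then show ?thesis using False Suc.prems by (simp add: algebra_simps)
  qed
qed

section \<open>Assembly of the approximating functions\<close>

lemma borel_measurable_if_countable_discontinuities:
  fixes v :: "'a::metric_space \<Rightarrow> real"
  assumes J: "countable {x. \<not> isCont v x}"
  shows "v \<in> borel_measurable borel"
proof (rule borel_measurableI_greater)
  fix t
  define S where "S = {x. t < v x}"
  have "x \<in> interior S" if x: "x \<in> S" "isCont v x" for x
  proof -
    obtain \<delta> where "0 < \<delta>" "\<And>y. dist y x < \<delta> \<Longrightarrow> dist (v y) (v x) < v x - t"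
      using x unfolding continuous_at_eps_delta S_def by (metis diff_gt_0_iff_gt mem_Collect_eq)
    then have "ball x \<delta> \<subseteq> S" by (force simp: S_def dist_real_def dist_commute)
    then show ?thesis using \<open>0 < \<delta>\<close> mem_interior by blast
  qed
  \<comment> \<open>A superlevel set differs from its interior by discontinuities of
    \<open>v\<close> only, hence by a countable set.\<close>
  then have "S = interior S \<union> (S \<inter> {x. \<not> isCont v x})" using interior_subset by blast
  moreover have "S \<inter> {x. \<not> isCont v x} \<in> sets borel"
  proof (rule sets.countable)
    show "countable (S \<inter> {x. \<not> isCont v x})" using J by (rule countable_subset[rotated]) blast
  qed simp
  ultimately have "S \<in> sets borel" by (metis borel_open open_interior sets.Un)
  then show "{x \<in> space borel. t < v x} \<in> sets borel" by (simp add: S_def)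
qed

text \<open>The bound on the gradient is independent of \<open>h\<close>, while the bound on the L^1
  error is proportional to it; \<open>h\<close> tending to 0 gives the approximating
  sequence.\<close>

lemma ex_upper_gradient_approx:
  fixes v :: "'a::complete_space \<Rightarrow> real"
  assumes con: "connected (UNIV :: 'a set)" and fin: "emeasure hausdorff1 (UNIV :: 'a set) = ennreal M" "0 \<le> M"
    and density: "\<And>x::'a. Liminf (at_right 0) (\<lambda>r. emeasure hausdorff1 (ball x r) / ennreal r) < ennreal C"
    and pV: "pV v = ennreal P" "0 \<le> P" and bound: "\<And>x. \<bar>v x\<bar> \<le> B" and "0 < h"
  shows "\<exists>w g. upper_gradient g (\<lambda>x. ereal (w x)) \<and> w \<in> borel_measurable borel \<and> (\<exists>K. \<forall>x. \<bar>w x\<bar> \<le> K) \<and>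
    (\<integral>\<^sup>+ x. g x \<partial>hausdorff1) \<le> ennreal (C * (P + 1)) \<and>
    (\<integral>\<^sup>+ x. ennreal \<bar>w x - v x\<bar> \<partial>hausdorff1) \<le> ennreal (h * (M + C * (P + 1)))"
proof -
  have fin': "emeasure hausdorff1 (UNIV :: 'a set) < \<infinity>" and pV': "pV v < \<infinity>" using fin pV by auto
  have "0 < ennreal C" using density[of undefined] by (rule order.strict_trans1[rotated]) simp
  then have "0 < C" by simp
  have v_borel: "v \<in> borel_measurable borel"
    using con fin' pV' by (intro borel_measurable_if_countable_discontinuities countable_discontinuities)
  obtain H :: "real \<Rightarrow> ennreal" and Z where H: "H \<in> borel_measurable borel" "(\<integral>\<^sup>+ t. H t \<partial>lborel) \<le> ennreal P"
    and Z: "countable Z" and HZ: "\<And>t. t \<notin> Z \<Longrightarrow> H t < \<infinity> \<Longrightarrow>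
      finite (frontier {x. t < v x}) \<and> of_nat (card (frontier {x. t < v x})) \<le> H t"
    using frontier_superlevel_indicatrix[OF con fin' pV'] unfolding pV(1) by metis
  \<comment> \<open>The grid starts in \<open>{- B - h..<- B}\<close>, below all values of
    \<open>v\<close>, and reaches at least \<open>B\<close> after \<open>n\<close> steps.\<close>
  obtain n where n: "2 * B + h \<le> real n * h" using reals_Archimedean3[OF \<open>0 < h\<close>] less_imp_le by blast
  obtain \<theta> where \<theta>: "0 \<le> \<theta>" "\<theta> < h" "\<And>j. j < n \<Longrightarrow> - B - h + \<theta> + real j * h \<notin> Z"
    "(\<Sum>j<n. H (- B - h + \<theta> + real j * h)) * ennreal h \<le> ennreal (P + 1)"
    using ex_good_levels[OF H pV(2) Z \<open>0 < h\<close>, of n "- B - h"] by metis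
  define t0 where "t0 = - B - h + \<theta>"
  define t where "t j = t0 + real j * h" for j
  define E where "E j = {x. t j < v x}" for j
  have E_borel: "E j \<in> sets borel" for j
    unfolding E_def using v_borel by measurable
  have sumH: "(\<Sum>j<n. H (t j)) * ennreal h \<le> ennreal (P + 1)" using \<theta>(4) by (simp add: t_def t0_def)
  have "H (t j) < \<infinity>" if "j < n" for j
  proof -
    have "H (t j) * ennreal h \<le> (\<Sum>j<n. H (t j)) * ennreal h"
      using that by (intro mult_right_mono member_le_sum) auto
    also have "\<dots> < \<infinity>" using sumH by (rule order.strict_trans1) simp
    finally show ?thesis using \<open>0 < h\<close> by (cases "H (t j)") (auto simp: ennreal_top_mult)
  qed
  then have F: "finite (frontier (E j))" "of_nat (card (frontier (E j))) \<le> H (t j)" if "j < n" for j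
    using HZ[of "t j"] \<theta>(3)[OF that] that by (auto simp: t_def t0_def E_def)
  define N where "N = (\<Sum>j<n. real (card (frontier (E j)))) * h"
  have "N \<le> P + 1"
  proof -
    have "ennreal N = (\<Sum>j<n. of_nat (card (frontier (E j)))) * ennreal h"
      unfolding N_def using \<open>0 < h\<close>
      by (simp add: ennreal_mult sum_nonneg ennreal_of_nat_eq_real_of_nat flip: of_nat_sum)
    also have "\<dots> \<le> (\<Sum>j<n. H (t j)) * ennreal h"
      using F(2) by (intro mult_right_mono sum_mono) auto
    also have "\<dots> \<le> ennreal (P + 1)" by (rule sumH)
    finally show ?thesis using pV(2) by (simp only: ennreal_le_iff)
  qed
  have "\<exists>r>0. r < h \<and> emeasure hausdorff1 (ball x r) \<le> ennreal (C * r)" for x :: 'a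
    using density \<open>0 < h\<close> by (rule Liminf_density_radius)
  then obtain r where r: "\<And>x::'a. 0 < r x" "\<And>x. r x < h" "\<And>x. emeasure hausdorff1 (ball x (r x)) \<le> ennreal (C * r x)"
    by metis
  define \<phi> where "\<phi> j = cutoff (frontier (E j)) r" for j
  define G where "G j = cutoff_gradient (frontier (E j)) r" for j
  \<comment> \<open>The staircase exceeds \<open>v - t0\<close> by at most \<open>h\<close>.
    Subtracting \<open>h\<close> puts \<open>w\<close> below \<open>v\<close>, so rounding and
    cutting off err in the same direction.\<close>
  define w where "w y = t0 - h + h * (\<Sum>j<n. \<phi> j y * indicat_real (E j) y)" for y
  define g where "g y = (\<Sum>j<n. ennreal h * G j y)" for y
  have G_borel: "G j \<in> borel_measurable borel" for j
    unfolding G_def by (rule borel_measurable_cutoff_gradient)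
  have g_borel: "g \<in> borel_measurable borel" unfolding g_def using G_borel by measurable
  have \<phi>_borel: "\<phi> j \<in> borel_measurable borel" if "j < n" for j
    unfolding \<phi>_def using F(1)[OF that] r(1) by (intro borel_measurable_continuous_onI continuous_on_cutoff) auto
  have \<phi>: "0 \<le> \<phi> j y" "\<phi> j y \<le> 1" if "j < n" for j y
    unfolding \<phi>_def using F(1)[OF that] r(1) by (auto intro: cutoff_nonneg cutoff_le)
  have w_borel: "w \<in> borel_measurable borel"
    unfolding w_def using \<phi>_borel E_borel by (intro borel_measurable_add borel_measurable_times borel_measurable_sum borel_measurable_const borel_measurable_indicator) auto
  have w_bound: "\<bar>w y\<bar> \<le> \<bar>t0 - h\<bar> + h * real n" for y
  proof -
    have "\<bar>\<Sum>j<n. \<phi> j y * indicat_real (E j) y\<bar> \<le> (\<Sum>j<n. \<bar>\<phi> j y * indicat_real (E j) y\<bar>)" by (rule sum_abs)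
    also have "\<dots> \<le> (\<Sum>j<n. 1)" using \<phi> by (intro sum_mono) (auto simp: indicator_def)
    finally have "h * \<bar>\<Sum>j<n. \<phi> j y * indicat_real (E j) y\<bar> \<le> h * real n" using \<open>0 < h\<close> by simp
    moreover have "\<bar>w y\<bar> \<le> \<bar>t0 - h\<bar> + \<bar>h * (\<Sum>j<n. \<phi> j y * indicat_real (E j) y)\<bar>"
      unfolding w_def by (rule abs_triangle_ineq)
    moreover have "\<bar>h * (\<Sum>j<n. \<phi> j y * indicat_real (E j) y)\<bar> = h * \<bar>\<Sum>j<n. \<phi> j y * indicat_real (E j) y\<bar>"
      using \<open>0 < h\<close> by (simp only: abs_mult abs_of_pos)
    ultimately show ?thesis by linarith
  qed
  have ug: "upper_gradient g (\<lambda>x. ereal (w x))"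
    unfolding upper_gradient_def
  proof (intro conjI allI impI)
    show "g \<in> borel_measurable borel" by (rule g_borel)
    fix l and \<gamma> :: "real \<Rightarrow> 'a" assume arc: "arclength_curve l \<gamma>"
    define I where "I = (\<lambda>f :: 'a \<Rightarrow> ennreal. \<integral>\<^sup>+ s\<in>{0..l}. f (\<gamma> s) \<partial>lborel)"
    define wj where "wj j y = \<phi> j y * indicat_real (E j) y" for j y
    \<comment> \<open>Continuity of \<open>\<gamma>\<close> is known on \<open>{0..l}\<close> only,
      so measurability is stated for the integrand multiplied by the indicator.\<close>
    have meas: "(\<lambda>s. f (\<gamma> s) * indicator {0..l} s) \<in> borel_measurable lborel"
      if f: "f \<in> borel_measurable borel" for f :: "'a \<Rightarrow> ennreal"
    proof -
      have "\<gamma> \<in> borel_measurable (restrict_space borel {0..l})"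
        using arc by (intro borel_measurable_continuous_on_restrict) (auto simp: arclength_curve_def)
      then have "(\<lambda>s. f (\<gamma> s)) \<in> borel_measurable (restrict_space borel {0..l})" using f by simp
      then show ?thesis
        by (subst (asm) borel_measurable_restrict_space_iff_ennreal) auto
    qed
    have "ennreal \<bar>w (\<gamma> l) - w (\<gamma> 0)\<bar> \<le> (\<Sum>j<n. ennreal h * ennreal \<bar>wj j (\<gamma> l) - wj j (\<gamma> 0)\<bar>)"
    proof -
      have "w (\<gamma> l) - w (\<gamma> 0) = h * (\<Sum>j<n. wj j (\<gamma> l) - wj j (\<gamma> 0))"
        by (simp add: w_def wj_def sum_subtractf right_diff_distrib)
      then have "\<bar>w (\<gamma> l) - w (\<gamma> 0)\<bar> \<le> h * (\<Sum>j<n. \<bar>wj j (\<gamma> l) - wj j (\<gamma> 0)\<bar>)"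
        using \<open>0 < h\<close> by (simp add: abs_mult sum_abs)
      then have "ennreal \<bar>w (\<gamma> l) - w (\<gamma> 0)\<bar> \<le> ennreal (h * (\<Sum>j<n. \<bar>wj j (\<gamma> l) - wj j (\<gamma> 0)\<bar>))"
        by (rule ennreal_leI)
      also have "\<dots> = (\<Sum>j<n. ennreal h * ennreal \<bar>wj j (\<gamma> l) - wj j (\<gamma> 0)\<bar>)"
        using \<open>0 < h\<close> by (simp add: ennreal_mult sum_nonneg sum_distrib_left[symmetric] sum_ennreal)
      finally show ?thesis .
    qed
    also have "\<dots> \<le> (\<Sum>j<n. ennreal h * I (G j))"
    proof (intro sum_mono mult_left_mono)
      fix j assume "j \<in> {..<n}"
      then show "ennreal \<bar>wj j (\<gamma> l) - wj j (\<gamma> 0)\<bar> \<le> I (G j)"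
        unfolding wj_def \<phi>_def I_def G_def using F(1) r(1)
        by (intro cutoff_indicator_along_curve arc) auto
    qed simp
    also have "\<dots> = (\<Sum>j<n. \<integral>\<^sup>+ s. ennreal h * (G j (\<gamma> s) * indicator {0..l} s) \<partial>lborel)"
      unfolding I_def using meas[OF G_borel] by (intro sum.cong refl nn_integral_cmult[symmetric]) auto
    also have "\<dots> = (\<integral>\<^sup>+ s. (\<Sum>j<n. ennreal h * (G j (\<gamma> s) * indicator {0..l} s)) \<partial>lborel)"
      using meas[OF G_borel] by (intro nn_integral_sum[symmetric]) auto
    also have "\<dots> = I g"
      unfolding I_def g_def by (simp add: sum_distrib_right mult.assoc)
    finally have "ennreal \<bar>w (\<gamma> l) - w (\<gamma> 0)\<bar> \<le> I g" .
    then have "enn2ereal (ennreal \<bar>w (\<gamma> l) - w (\<gamma> 0)\<bar>) \<le> enn2ereal (I g)"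
      by (simp add: less_eq_ennreal.rep_eq)
    then show "\<bar>ereal (w (\<gamma> l)) - ereal (w (\<gamma> 0))\<bar> \<le> enn2ereal (\<integral>\<^sup>+ s\<in>{0..l}. g (\<gamma> s) \<partial>lborel)"
      by (simp add: enn2ereal_ennreal I_def)
  qed
  have intG: "(\<integral>\<^sup>+ y. G j y \<partial>hausdorff1) \<le> ennreal (C * real (card (frontier (E j))))" if "j < n" for j
    unfolding G_def using F(1)[OF that] r \<open>0 < C\<close> by (intro nn_integral_cutoff_gradient) auto
  have int_g: "(\<integral>\<^sup>+ y. g y \<partial>hausdorff1) \<le> ennreal (C * (P + 1))"
  proof -
    have GH: "G j \<in> borel_measurable hausdorff1" for j using G_borel by (rule measurable_hausdorff1I)
    have "(\<integral>\<^sup>+ y. g y \<partial>hausdorff1) = (\<Sum>j<n. \<integral>\<^sup>+ y. ennreal h * G j y \<partial>hausdorff1)"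
      unfolding g_def using GH by (intro nn_integral_sum) auto
    also have "\<dots> = (\<Sum>j<n. ennreal h * \<integral>\<^sup>+ y. G j y \<partial>hausdorff1)"
      using GH by (intro sum.cong refl nn_integral_cmult) auto
    also have "\<dots> \<le> (\<Sum>j<n. ennreal h * ennreal (C * real (card (frontier (E j)))))"
      using intG by (intro sum_mono mult_left_mono) auto
    also have "\<dots> = (\<Sum>j<n. ennreal (h * (C * real (card (frontier (E j))))))"
      using \<open>0 < h\<close> \<open>0 < C\<close> by (intro sum.cong refl ennreal_mult[symmetric]) auto
    also have "\<dots> = ennreal (\<Sum>j<n. h * (C * real (card (frontier (E j)))))"
      using \<open>0 < h\<close> \<open>0 < C\<close> by (intro sum_ennreal) auto
    also have "(\<Sum>j<n. h * (C * real (card (frontier (E j))))) = C * N"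
      by (simp add: N_def sum_distrib_left sum_distrib_right mult_ac)
    also have "ennreal (C * N) \<le> ennreal (C * (P + 1))"
      using \<open>N \<le> P + 1\<close> \<open>0 < C\<close> by (intro ennreal_leI) simp
    finally show ?thesis .
  qed
  have near: "ennreal \<bar>w y - v y\<bar> \<le> ennreal h + ennreal h * g y" for y
  proof -
    have "t0 < v y" using bound[of y] \<theta>(2) by (simp add: t0_def)
    moreover have "v y \<le> t0 + real n * h" using bound[of y] \<theta>(1) n by (simp add: t0_def)
    ultimately have st: "v y - t0 \<le> h * (\<Sum>j<n. indicat_real {..<v y} (t j))"
      "h * (\<Sum>j<n. indicat_real {..<v y} (t j)) \<le> v y - t0 + h"
      using staircase_approx[OF \<open>0 < h\<close>, of t0 "v y" n] by (simp_all add: t_def)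
    have ind: "indicat_real {..<v y} (t j) = indicat_real (E j) y" for j
      by (simp add: E_def indicator_def)
    have "\<bar>w y - v y\<bar> \<le> h + h * (\<Sum>j<n. 1 - \<phi> j y)"
    proof -
      have "(\<Sum>j<n. indicat_real (E j) y) - (\<Sum>j<n. \<phi> j y * indicat_real (E j) y) \<le> (\<Sum>j<n. 1 - \<phi> j y)"
        unfolding sum_subtractf[symmetric] using \<phi> by (intro sum_mono) (auto simp: indicator_def)
      then have "h * ((\<Sum>j<n. indicat_real (E j) y) - (\<Sum>j<n. \<phi> j y * indicat_real (E j) y)) \<le> h * (\<Sum>j<n. 1 - \<phi> j y)"
        using \<open>0 < h\<close> by (intro mult_left_mono) auto
      moreover have "(\<Sum>j<n. \<phi> j y * indicat_real (E j) y) \<le> (\<Sum>j<n. indicat_real (E j) y)"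
        using \<phi> by (intro sum_mono) (auto simp: indicator_def)
      then have "h * (\<Sum>j<n. \<phi> j y * indicat_real (E j) y) \<le> h * (\<Sum>j<n. indicat_real (E j) y)"
        using \<open>0 < h\<close> by (intro mult_left_mono) auto
      ultimately show ?thesis using st unfolding ind w_def by (auto simp: right_diff_distrib abs_if)
    qed
    then have "ennreal \<bar>w y - v y\<bar> \<le> ennreal (h + h * (\<Sum>j<n. 1 - \<phi> j y))" by (rule ennreal_leI)
    also have "\<dots> = ennreal h + ennreal h * ennreal (\<Sum>j<n. 1 - \<phi> j y)"
    proof -
      have "0 \<le> (\<Sum>j<n. 1 - \<phi> j y)" using \<phi> by (intro sum_nonneg) auto
      then show ?thesis using \<open>0 < h\<close> by (simp add: ennreal_mult)
    qed
    also have "ennreal (\<Sum>j<n. 1 - \<phi> j y) = (\<Sum>j<n. ennreal (1 - \<phi> j y))"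
      using \<phi> by (intro sum_ennreal[symmetric]) auto
    also have "ennreal h + ennreal h * (\<Sum>j<n. ennreal (1 - \<phi> j y)) = ennreal h + (\<Sum>j<n. ennreal h * ennreal (1 - \<phi> j y))"
      by (simp only: sum_distrib_left)
    also have "\<dots> \<le> ennreal h + (\<Sum>j<n. ennreal h * (ennreal h * G j y))"
    proof (intro add_left_mono sum_mono mult_left_mono)
      fix j assume j: "j \<in> {..<n}"
      \<comment> \<open>Where the cutoff is below 1, some ball contains \<open>y\<close> and the
        gradient is at least \<open>1 / r x\<close>, which exceeds \<open>1 / h\<close> because the
        radii are smaller than \<open>h\<close>.\<close>
      show "ennreal (1 - \<phi> j y) \<le> ennreal h * G j y"
      proof (cases "\<exists>x\<in>frontier (E j). y \<in> ball x (r x)")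
        case True
        then obtain x where x: "x \<in> frontier (E j)" "y \<in> ball x (r x)" by blast
        have "ennreal (1 - \<phi> j y) \<le> ennreal 1" using \<phi>[of j y] j by (intro ennreal_leI) auto
        also have "\<dots> \<le> ennreal (h * (1 / r x))" using r(1,2)[of x] by (intro ennreal_leI) simp
        also have "\<dots> = ennreal h * (indicator (ball x (r x)) y * ennreal (1 / r x))"
          using x r(1)[of x] \<open>0 < h\<close> by (simp add: ennreal_mult[symmetric])
        also have "\<dots> \<le> ennreal h * G j y"
          unfolding G_def cutoff_gradient_def using x(1) F(1)[of j] j by (intro mult_left_mono member_le_sum) auto
        finally show ?thesis .
      next
        case False
        then have "\<phi> j y = 1"
          unfolding \<phi>_def using F(1)[of j] r(1) j by (intro cutoff_eq_1) auto
        then show ?thesis by simp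
      qed
    qed simp
    also have "(\<Sum>j<n. ennreal h * (ennreal h * G j y)) = ennreal h * g y"
      by (simp add: g_def sum_distrib_left)
    finally show ?thesis .
  qed
  have gH: "g \<in> borel_measurable hausdorff1" using g_borel by (rule measurable_hausdorff1I)
  have "(\<integral>\<^sup>+ y. ennreal \<bar>w y - v y\<bar> \<partial>hausdorff1) \<le> (\<integral>\<^sup>+ y. ennreal h + ennreal h * g y \<partial>hausdorff1)"
    using near by (intro nn_integral_mono)
  also have "\<dots> = ennreal h * ennreal M + ennreal h * (\<integral>\<^sup>+ y. g y \<partial>hausdorff1)"
    using gH fin(1) by (subst nn_integral_add) (auto simp: nn_integral_cmult)
  also have "\<dots> \<le> ennreal h * ennreal M + ennreal h * ennreal (C * (P + 1))"
    using int_g by (intro add_left_mono mult_left_mono) auto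
  also have "\<dots> = ennreal (h * (M + C * (P + 1)))"
    using \<open>0 < h\<close> \<open>0 < C\<close> fin(2) pV(2) by (simp add: ennreal_mult[symmetric] ennreal_plus[symmetric] distrib_left del: ennreal_plus)
  finally have int_w: "(\<integral>\<^sup>+ y. ennreal \<bar>w y - v y\<bar> \<partial>hausdorff1) \<le> ennreal (h * (M + C * (P + 1)))" .
  show ?thesis using ug w_borel w_bound int_g int_w by blast
qed

text \<open>\<open>u\<close> is determined by \<open>v\<close> only up to a null set. The
  Caratheodory measure is complete, so every subset of a null set is measurable.\<close>

lemma AE_eq_borel_measurable_hausdorff1:
  fixes u v :: "'a::metric_space \<Rightarrow> real"
  assumes v: "v \<in> borel_measurable hausdorff1" and AE: "AE x in hausdorff1. v x = u x"
  shows "u \<in> borel_measurable hausdorff1"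
proof (rule borel_measurableI_greater)
  fix t
  define N where "N = {x. \<not> v x = u x}"
  have "hausdorff1_outer N = 0" using AE by (simp add: AE_hausdorff1_iff N_def)
  then have null: "A \<in> sets hausdorff1" if "A \<subseteq> N" for A
    using null_in_sets_hausdorff1 hausdorff1_outer_mono[OF that] by simp
  have "{x \<in> space hausdorff1. t < v x} \<in> sets hausdorff1"
    using v by (rule borel_measurable_less[OF borel_measurable_const])
  then have "({x. t < v x} - N) \<union> ({x. t < u x} \<inter> N) \<in> sets hausdorff1"
    using null by (intro sets.Un sets.Diff) auto
  moreover have "({x. t < v x} - N) \<union> ({x. t < u x} \<inter> N) = {x. t < u x}"
    by (auto simp: N_def)
  ultimately show "{x \<in> space hausdorff1. t < u x} \<in> sets hausdorff1" by simp
qed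

lemma total_variation_finite:
  fixes u :: "'a::complete_space \<Rightarrow> real"
  assumes con: "connected (UNIV :: 'a set)" and fin: "emeasure hausdorff1 (UNIV :: 'a set) < \<infinity>"
    and density: "\<And>x::'a. Liminf (at_right 0) (\<lambda>r. emeasure hausdorff1 (ball x r) / ennreal r) < ennreal C"
    and Var: "Var u < \<infinity>"
  shows "total_variation u < \<infinity>"
proof -
  obtain v where AE: "AE x in hausdorff1. v x = u x" and pV: "pV v < \<infinity>"
    using Var unfolding Var_def INF_less_iff by auto
  obtain P where P: "pV v = ennreal P" "0 \<le> P" using pV by (cases "pV v") auto
  obtain M where M: "emeasure hausdorff1 (UNIV :: 'a set) = ennreal M" "0 \<le> M"
    using fin by (cases "emeasure hausdorff1 (UNIV :: 'a set)") auto
  interpret finite_measure "hausdorff1 :: 'a measure" using fin by (intro finite_measureI) auto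
  \<comment> \<open>Every point can be joined to \<open>undefined\<close>, an arbitrary base point,
    so \<open>v\<close> deviates from its value there by at most \<open>P\<close>.\<close>
  define B where "B = \<bar>v undefined\<bar> + P"
  have bound: "\<bar>v x\<bar> \<le> B" for x
  proof -
    have "ennreal \<bar>v x - v undefined\<bar> \<le> ennreal P"
      using joinable_le_pV[OF joinable_UNIV[OF con fin], of v x undefined] P by simp
    then have "\<bar>v x - v undefined\<bar> \<le> P" using P(2) by (simp add: ennreal_le_iff)
    then show ?thesis by (simp add: B_def)
  qed
  define K where "K = M + C * (P + 1)"
  define Q where "Q i w g \<longleftrightarrow> upper_gradient g (\<lambda>x. ereal (w x)) \<and> w \<in> borel_measurable borel \<and> (\<exists>K. \<forall>x. \<bar>w x\<bar> \<le> K) \<and>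
    (\<integral>\<^sup>+ x. g x \<partial>hausdorff1) \<le> ennreal (C * (P + 1)) \<and>
    (\<integral>\<^sup>+ x. ennreal \<bar>w x - v x\<bar> \<partial>hausdorff1) \<le> ennreal (1 / real (Suc i) * K)" for i :: nat and w :: "'a \<Rightarrow> real" and g
  have "\<exists>w g. Q i w g" for i
    unfolding Q_def K_def
    by (rule ex_upper_gradient_approx[OF con M density P bound]) simp
  then obtain w g where Q: "\<And>i. Q i (w i) (g i)" by metis
  have v_meas: "v \<in> borel_measurable hausdorff1"
    by (intro measurable_hausdorff1I borel_measurable_if_countable_discontinuities
        countable_discontinuities con fin pV)
  have u_int: "integrable hausdorff1 u"
  proof (rule integrable_const_bound[of _ B])
    show "AE x in hausdorff1. norm (u x) \<le> B" using AE by eventually_elim (use bound in \<open>metis real_norm_def\<close>)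
  qed (rule AE_eq_borel_measurable_hausdorff1[OF v_meas AE])
  have w_int: "integrable hausdorff1 (w i)" for i
  proof -
    obtain K where "\<And>x. \<bar>w i x\<bar> \<le> K" "w i \<in> borel_measurable borel" using Q[of i] by (auto simp: Q_def)
    then show ?thesis by (intro integrable_const_bound[of _ K] measurable_hausdorff1I) auto
  qed
  have "L1loc_tendsto w u"
    unfolding L1loc_tendsto_def
  \<comment> \<open>The convergence is global in L^1, so the radius 1 serves at every point.\<close>
  proof (intro allI exI[of _ 1] conjI)
    fix x :: 'a
    show "set_integrable hausdorff1 (ball x 1) u"
      unfolding set_integrable_def using u_int by (intro integrable_mult_indicator) simp_all
    show "set_integrable hausdorff1 (ball x 1) (w i)" for i
      unfolding set_integrable_def using w_int by (intro integrable_mult_indicator) simp_all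
    define D where "D i = (LINT y:ball x 1|hausdorff1. \<bar>w i y - u y\<bar>)" for i
    have d_int: "integrable hausdorff1 (\<lambda>y. \<bar>w i y - u y\<bar>)" for i
      using u_int w_int by (intro integrable_abs Bochner_Integration.integrable_diff)
    have "0 \<le> D i" for i
      unfolding D_def set_lebesgue_integral_def by (intro integral_nonneg_AE) auto
    moreover have "D i \<le> 1 / real (Suc i) * K" for i
    proof -
      have "D i \<le> (LINT y|hausdorff1. \<bar>w i y - u y\<bar>)"
        unfolding D_def set_lebesgue_integral_def
        using d_int by (intro integral_mono integrable_mult_indicator) (auto simp: indicator_def)
      moreover have "ennreal (LINT y|hausdorff1. \<bar>w i y - u y\<bar>) \<le> ennreal (1 / real (Suc i) * K)"
      proof -
        have "ennreal (LINT y|hausdorff1. \<bar>w i y - u y\<bar>) = (\<integral>\<^sup>+ y. ennreal \<bar>w i y - u y\<bar> \<partial>hausdorff1)"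
          using d_int by (intro nn_integral_eq_integral[symmetric]) auto
        also have "\<dots> = (\<integral>\<^sup>+ y. ennreal \<bar>w i y - v y\<bar> \<partial>hausdorff1)"
        proof (rule nn_integral_cong_AE)
          show "AE y in hausdorff1. ennreal \<bar>w i y - u y\<bar> = ennreal \<bar>w i y - v y\<bar>"
            using AE by eventually_elim simp
        qed
        also have "\<dots> \<le> ennreal (1 / real (Suc i) * K)" using Q[of i] by (simp only: Q_def)
        finally show ?thesis .
      qed
      moreover have "0 \<le> 1 / real (Suc i) * K"
      proof -
        have "0 < ennreal C" using density[of undefined] by (rule order.strict_trans1[rotated]) simp
        then show ?thesis using M(2) P(2) by (simp add: K_def)
      qed
      ultimately show ?thesis by (simp only: ennreal_le_iff)
    qed
    moreover have "(\<lambda>i. 1 / real (Suc i) * K) \<longlonglongrightarrow> 0 * K"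
      using LIMSEQ_inverse_real_of_nat by (intro tendsto_mult tendsto_const) (simp add: inverse_eq_divide)
    ultimately have "D \<longlonglongrightarrow> 0"
      by (intro tendsto_sandwich[of "\<lambda>_. 0" D _ "\<lambda>i. 1 / real (Suc i) * K"]) (auto intro!: always_eventually)
    then show "(\<lambda>i. LINT y:ball x 1|hausdorff1. \<bar>w i y - u y\<bar>) \<longlonglongrightarrow> 0"
      by (simp only: D_def[abs_def])
  qed simp
  moreover have "\<forall>i. upper_gradient (g i) (\<lambda>x. ereal (w i x))" using Q by (simp add: Q_def)
  ultimately have "total_variation u \<le> liminf (\<lambda>i. \<integral>\<^sup>+ x. g i x \<partial>hausdorff1)"
    unfolding total_variation_def by (intro INF_lower2[of "(w, g)"]) auto
  also have "\<dots> \<le> ennreal (C * (P + 1))"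
    using Q by (intro Liminf_le always_eventually) (auto simp: Q_def)
  also have "\<dots> < \<infinity>" by simp
  finally show ?thesis .
qed

theorem theorem1p1:
  fixes u :: "'a::complete_space \<Rightarrow> real"
  assumes "connected (UNIV :: 'a set)"
    and "emeasure hausdorff1 (UNIV :: 'a set) < \<infinity>"
  shows "(total_variation u < \<infinity> \<longrightarrow> Var u \<le> total_variation u) \<and>
    ((\<exists>C\<^sub>0::real. \<forall>x::'a.
        Liminf (at_right 0) (\<lambda>r. emeasure hausdorff1 (ball x r) / ennreal r) < ennreal C\<^sub>0) \<longrightarrow>
      Var u < \<infinity> \<longrightarrow> total_variation u < \<infinity>)"
  using Var_le_total_variation[OF assms(2)] total_variation_finite[OF assms] by blast

end
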